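(* Let $m$ be a positive even integer satisfying $m\equiv 0\pmod 3$, $\nu_3(m(m+1))=1$, $\nu_2(m(m+1))\leq 5$, and $\nu_p(m(m+1))\leq 1$ for every prime $p\geq 5$ with $p\not\equiv 1\pmod{12}$. Then there is no tight spherical $5$-design in dimension $n=(2m+1)^2-2$.
   Context: For a prime $p$ and a positive integer $a$, $\nu_p(a)$ denotes the exponent of $p$ in the prime factorization of $a$. A spherical $t$-design in dimension $n$ is a finite nonempty subset $D$ of the unit sphere $\mathbb{S}^{n-1}\subset\mathbb{R}^n$ such that $\frac{1}{|D|}\sum_{x\in D}f(x)=\int_{\mathbb{S}^{n-1}}f\,d\sigma$ for every real polynomial $f$ in $n$ variables of total degree at most $t$, where $\sigma$ is the surface measure normalized to total mass $1$. Every spherical $5$-design in dimension $n$ satisfies $|D|\geq 2\binom{n+1}{2}=n(n+1)$ (Delsarte, Goethals, Seidel); a spherical $5$-design is called tight if $|D|=n(n+1)$. *)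

theory Defs
  imports "HOL-Analysis.Analysis" "HOL-Number_Theory.Cong"
begin

text \<open>Surface measure on the unit sphere, given by polar coordinates: a Borel set \<open>A\<close> on the
  sphere has surface area \<open>n\<close> times the Lebesgue measure of the open cone
  \<open>{r x | 0 < r < 1, x \<in> A}\<close>, which is the preimage of \<open>A\<close> under \<open>sgn x = x / norm x\<close> in the
  punctured unit ball (see \<open>emeasure_sphere_surface_measure\<close> below).\<close>

definition sphere_surface_measure :: "(real ^ 'n::finite) measure" where
  "sphere_surface_measure =
     scale_measure (of_nat CARD('n))
       (distr (restrict_space lborel (ball 0 1 - {0})) (restrict_space borel (sphere 0 1)) sgn)"

definition normalized_surface_measure :: "(real ^ 'n::finite) measure" where
  "normalized_surface_measure = uniform_measure sphere_surface_measure (sphere 0 1)"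

lemma space_sphere_surface_measure: "space sphere_surface_measure = sphere 0 1"
  by (simp add: sphere_surface_measure_def space_scale_measure space_restrict_space)

lemma sets_sphere_surface_measure:
  "sets sphere_surface_measure = sets (restrict_space borel (sphere 0 1))"
  by (simp add: sphere_surface_measure_def)

lemma measurable_sgn_sphere:
  "sgn \<in> restrict_space lborel (ball (0 :: real ^ 'n::finite) 1 - {0}) \<rightarrow>\<^sub>M
     restrict_space borel (sphere 0 1)"
proof (rule measurable_restrict_space2)
  show "sgn \<in> space (restrict_space lborel (ball (0 :: real ^ 'n) 1 - {0})) \<rightarrow> sphere 0 1"
    by (auto simp: space_restrict_space norm_sgn)
  have "(sgn :: real ^ 'n \<Rightarrow> _) \<in> borel_measurable lborel"
    unfolding sgn_div_norm by measurable
  then show "sgn \<in> borel_measurable (restrict_space lborel (ball (0 :: real ^ 'n) 1 - {0}))"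
    by (rule measurable_restrict_space1)
qed

lemma emeasure_sphere_surface_measure:
  fixes A :: "(real ^ 'n::finite) set"
  assumes "A \<in> sets borel" "A \<subseteq> sphere 0 1"
  shows "emeasure sphere_surface_measure A =
    of_nat CARD('n) * emeasure lborel {r *\<^sub>R x | r x. 0 < r \<and> r < 1 \<and> x \<in> A}"
proof -
  have A: "A \<in> sets (restrict_space borel (sphere 0 1))"
    using assms by (auto simp: sets_restrict_space_iff)
  have eq: "sgn -` A \<inter> (ball 0 1 - {0}) = {r *\<^sub>R x | r x. 0 < r \<and> r < 1 \<and> x \<in> A}"
  proof (intro equalityI subsetI)
    fix y assume y: "y \<in> sgn -` A \<inter> (ball 0 1 - {0})"
    then have "y = norm y *\<^sub>R sgn y" "0 < norm y" "norm y < 1" "sgn y \<in> A"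
      by (auto simp: sgn_div_norm)
    then show "y \<in> {r *\<^sub>R x | r x. 0 < r \<and> r < 1 \<and> x \<in> A}" by blast
  next
    fix y assume "y \<in> {r *\<^sub>R x | r x. 0 < r \<and> r < 1 \<and> x \<in> A}"
    then obtain r x where y: "y = r *\<^sub>R x" "0 < r" "r < 1" "x \<in> A" by blast
    with assms(2) have "norm x = 1" by auto
    with y show "y \<in> sgn -` A \<inter> (ball 0 1 - {0})"
      by (auto simp: sgn_div_norm)
  qed
  have sub: "{r *\<^sub>R x | r x. 0 < r \<and> r < 1 \<and> x \<in> A} \<subseteq> ball 0 1 - {0}"
    using eq by blast
  have "emeasure (distr (restrict_space lborel (ball 0 1 - {0}))
          (restrict_space borel (sphere 0 1)) sgn) A
      = emeasure (restrict_space lborel (ball 0 1 - {0}))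
          {r *\<^sub>R x | r x. 0 < r \<and> r < 1 \<and> x \<in> A}"
    by (simp add: emeasure_distr[OF measurable_sgn_sphere A] space_restrict_space eq)
  also have "\<dots> = emeasure lborel {r *\<^sub>R x | r x. 0 < r \<and> r < 1 \<and> x \<in> A}"
    by (rule emeasure_restrict_space[OF _ sub]) simp
  finally show ?thesis
    by (simp add: sphere_surface_measure_def)
qed

lemma emeasure_normalized_surface_measure_sphere:
  "emeasure normalized_surface_measure (sphere (0 :: real ^ 'n::finite) 1) = 1"
proof -
  let ?S = "sphere (0 :: real ^ 'n) 1"
  have cone: "{r *\<^sub>R x | r x. 0 < r \<and> r < 1 \<and> x \<in> ?S} = ball 0 1 - {0}"
  proof (intro equalityI subsetI)
    fix y :: "real ^ 'n" assume y: "y \<in> ball 0 1 - {0}"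
    then have "y = norm y *\<^sub>R sgn y" "0 < norm y" "norm y < 1" "sgn y \<in> ?S"
      by (auto simp: sgn_div_norm)
    then show "y \<in> {r *\<^sub>R x | r x. 0 < r \<and> r < 1 \<and> x \<in> ?S}" by blast
  qed auto
  have "emeasure lborel (ball 0 1 - {0 :: real ^ 'n}) = emeasure lborel (ball (0 :: real ^ 'n) 1)"
    by (subst emeasure_Diff) auto
  then have "emeasure sphere_surface_measure ?S
      = of_nat CARD('n) * emeasure lborel (ball (0 :: real ^ 'n) 1)"
    using cone by (subst emeasure_sphere_surface_measure) auto
  moreover have "emeasure lborel (ball (0 :: real ^ 'n) 1) \<noteq> 0"
    using less_imp_neq[OF unit_ball_vol_pos, of "real CARD('n)"]
    by (simp add: emeasure_ball ennreal_eq_0_iff not_le)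
  moreover have "emeasure lborel (ball (0 :: real ^ 'n) 1) \<noteq> \<infinity>"
    by (simp add: emeasure_ball)
  ultimately have "emeasure sphere_surface_measure ?S \<noteq> 0"
    "emeasure sphere_surface_measure ?S \<noteq> \<infinity>"
    by (auto simp: ennreal_mult_eq_top_iff)
  then show ?thesis
    unfolding normalized_surface_measure_def by (intro emeasure_uniform_measure_1)
qed

text \<open>A monomial is given by its exponents \<open>\<alpha>\<close>, its total degree being \<open>\<Sum>i. \<alpha> i\<close>.\<close>

definition polynomial_of_degree_le :: "nat \<Rightarrow> (real ^ 'n::finite \<Rightarrow> real) \<Rightarrow> bool" where
  "polynomial_of_degree_le t f \<longleftrightarrow>
     (\<exists>c :: ('n \<Rightarrow> nat) \<Rightarrow> real.
        f = (\<lambda>x. \<Sum>\<alpha> | (\<Sum>i\<in>UNIV. \<alpha> i) \<le> t. c \<alpha> * (\<Prod>i\<in>UNIV. (x $ i) ^ \<alpha> i)))"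

lemma finite_exponents_le: "finite {\<alpha> :: 'n::finite \<Rightarrow> nat. (\<Sum>i\<in>UNIV. \<alpha> i) \<le> t}"
proof (rule finite_subset)
  have "\<alpha> i \<le> (\<Sum>i\<in>UNIV. \<alpha> i)" for \<alpha> :: "'n \<Rightarrow> nat" and i
    by (rule member_le_sum) auto
  then show "{\<alpha> :: 'n \<Rightarrow> nat. (\<Sum>i\<in>UNIV. \<alpha> i) \<le> t} \<subseteq> Pi\<^sub>E UNIV (\<lambda>_. {..t})"
    by (fastforce intro: order_trans)
  show "finite (Pi\<^sub>E (UNIV :: 'n set) (\<lambda>_. {..t}))"
    by (intro finite_PiE) auto
qed

definition spherical_design :: "nat \<Rightarrow> (real ^ 'n::finite) set \<Rightarrow> bool" where
  "spherical_design t D \<longleftrightarrow>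
     finite D \<and> D \<noteq> {} \<and> D \<subseteq> sphere 0 1 \<and>
     (\<forall>f. polynomial_of_degree_le t f \<longrightarrow>
        1 / real (card D) * (\<Sum>x\<in>D. f x) = (LINT x|normalized_surface_measure. f x))"

definition tight_spherical_5_design :: "(real ^ 'n::finite) set \<Rightarrow> bool" where
  "tight_spherical_5_design D \<longleftrightarrow>
     spherical_design 5 D \<and> card D = CARD('n) * (CARD('n) + 1)"

end

(*
  The lines of a tight 5-design, rescaled to norm t = 2m + 1 and mutual inner products +1 or -1,
  generate an integral lattice L. Write M = m (m + 1). The design identities
    sum_x (x,v)^2 = 2 M t (v,v)   and   sum_x (x,v)^4 = 6 M (v,v)^2,
  applied to vectors v of the dual lattice, restrict L at every prime p, and the squarefree class D
  of its discriminant leads to a contradiction: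

  - If p >= 5 and p^2 does not divide M, then L is unimodular at p, so p does not divide D.
  - At p = 2, a vector v of the dual lattice orthogonal to a line x makes all inner products of
    2 v + x odd, which forces 2 (v,v) to be integral at 2. Hence the orthogonal complement of x
    splits into blocks (2a, b; b, 2c) up to scaling, with b odd, and D is 3 mod 4.
  - Together with the hypothesis on the primes not congruent to 1 mod 12 this leaves D = 3 P with P
    a product of primes congruent to 1 mod 12.
  - At p = 3, L is then the sum of a unimodular lattice U and a rank one lattice of norm 3 z with
    z = 1 mod 3. The Gram matrix ((x,y)^2) = 4 M I + J of the tensors x (x) x, taken mod 9, relates
    the form M/3 * sum c_x^2 on functions c on the lines to the form of U mod 3, and comparing
    Gauss sums gives U discriminant -1 mod 3. So P = -1 mod 3, whereas P = 1 mod 12.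
*)
theory Submission
  imports Defs "HOL-Library.Numeral_Type" "HOL-Library.Uprod" "HOL-Computational_Algebra.Squarefree"
begin

text \<open>What links the primes is one fact: each prime gets its own orthogonal basis of R^n, made
  of vectors with rational inner products to the lines. The second moment then makes the inner
  products between any two such bases rational, so their products of norms multiply to a rational
  square, and one squarefree number D can be tested at each prime against a basis adapted to it. The
  bounds on the valuations of M mark the reach of the fourth moment. A basis vector of norm
  divisible by p with integral coordinates forces p^2 | 6 M. At 2, odd k make (k^2 - 1) (k^2 - 9) a
  multiple of 384 = 2^7 * 3, and what survives division by the moments is 32 / M, integral at 2 as
  64 does not divide M. At 3, fourth powers and squares agree, so w = 3 (v,v) satisfies w (w - 1) =
  0 mod 3 for dual v; two orthogonal summands of norm divisible by 3 would give w = 2. The Gauss sum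
  comparison needs no count of dimensions: both sides are real, the unknown factor is the positive
  cardinality of a subspace, and only the sign is read off.\<close>

section \<open>Moments of the surface measure\<close>

text \<open>The library proves that orthogonal maps preserve Lebesgue measure only for well-ordered index
  types, so coordinates are transported to a well-ordered copy of the index type.\<close>

typedef 'a well_ordered_copy = "UNIV :: 'a set" ..

definition some_well_order :: "('a \<times> 'a) set" where
  "some_well_order = (SOME r. well_order_on UNIV r)"

lemma well_order_on_some_well_order: "well_order_on UNIV some_well_order"
  unfolding some_well_order_def using well_order_on by (rule someI_ex)

instantiation well_ordered_copy :: (type) wellorder
begin

definition less_eq_well_ordered_copy :: "'a well_ordered_copy \<Rightarrow> 'a well_ordered_copy \<Rightarrow> bool" where
  "(x :: 'a well_ordered_copy) \<le> y \<longleftrightarrow> (Rep_well_ordered_copy x, Rep_well_ordered_copy y) \<in> some_well_order"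

definition less_well_ordered_copy :: "'a well_ordered_copy \<Rightarrow> 'a well_ordered_copy \<Rightarrow> bool" where
  "(x :: 'a well_ordered_copy) < y \<longleftrightarrow> x \<le> y \<and> \<not> y \<le> x"

instance
proof
  have wo: "refl (some_well_order :: ('a \<times> 'a) set)" "trans (some_well_order :: ('a \<times> 'a) set)"
    "antisym (some_well_order :: ('a \<times> 'a) set)" "total (some_well_order :: ('a \<times> 'a) set)"
    "wf (some_well_order - Id :: ('a \<times> 'a) set)"
    using well_order_on_some_well_order[where 'a = 'a]
    by (auto simp: well_order_on_def linear_order_on_def partial_order_on_def preorder_on_def)
  fix x y z :: "'a well_ordered_copy"
  show "(x < y) = (x \<le> y \<and> \<not> y \<le> x)"
    by (rule less_well_ordered_copy_def)
  show "x \<le> x" using wo(1) by (auto simp: less_eq_well_ordered_copy_def refl_on_def)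
  show "x \<le> y \<Longrightarrow> y \<le> z \<Longrightarrow> x \<le> z"
    using wo(2) by (auto simp: less_eq_well_ordered_copy_def dest: transD)
  show "x \<le> y \<Longrightarrow> y \<le> x \<Longrightarrow> x = y"
    using wo(3) by (auto simp: less_eq_well_ordered_copy_def Rep_well_ordered_copy_inject dest: antisymD)
  show "x \<le> y \<or> y \<le> x"
    using wo(4) wo(1)
    by (auto simp: less_eq_well_ordered_copy_def total_on_def refl_on_def) (metis)
  fix P :: "'a well_ordered_copy \<Rightarrow> bool" and a
  assume step: "\<And>x. (\<And>y. y < x \<Longrightarrow> P y) \<Longrightarrow> P x"
  have "P (Abs_well_ordered_copy u)" for u
  proof (induction u rule: wf_induct_rule[OF wo(5)])
    case (1 u)
    show ?case
    proof (rule step)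
      fix y assume "y < Abs_well_ordered_copy u"
      then have "(Rep_well_ordered_copy y, u) \<in> some_well_order - Id"
        using wo(1) by (auto simp: less_well_ordered_copy_def less_eq_well_ordered_copy_def
            Abs_well_ordered_copy_inverse refl_on_def)
      from 1[OF this] show "P y" by (simp add: Rep_well_ordered_copy_inverse)
    qed
  qed
  from this[of "Rep_well_ordered_copy a"] show "P a" by (simp add: Rep_well_ordered_copy_inverse)
qed

end

lemma bij_Rep_well_ordered_copy: "bij Rep_well_ordered_copy"
  by (metis (no_types, lifting) Abs_well_ordered_copy_inverse Rep_well_ordered_copy_inverse UNIV_I bijI')

instance well_ordered_copy :: (finite) finite
proof
  show "finite (UNIV :: 'a well_ordered_copy set)"
    using bij_betw_finite[OF bij_Rep_well_ordered_copy[where 'a = 'a]] by simp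
qed

definition reindex_vec :: "real ^ 'n::finite \<Rightarrow> real ^ 'n well_ordered_copy" where
  "reindex_vec x = (\<chi> i. x $ Rep_well_ordered_copy i)"

definition unindex_vec :: "real ^ 'n::finite well_ordered_copy \<Rightarrow> real ^ 'n" where
  "unindex_vec x = (\<chi> i. x $ Abs_well_ordered_copy i)"

lemma reindex_unindex [simp]: "reindex_vec (unindex_vec x) = x" "unindex_vec (reindex_vec y) = y"
  by (simp_all add: reindex_vec_def unindex_vec_def vec_eq_iff
        Rep_well_ordered_copy_inverse Abs_well_ordered_copy_inverse)

lemma linear_reindex_vec: "linear reindex_vec" "linear unindex_vec"
  by (auto simp: linear_iff reindex_vec_def unindex_vec_def vec_eq_iff)

lemma inner_reindex_vec [simp]: "reindex_vec x \<bullet> reindex_vec y = x \<bullet> y"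
  unfolding inner_vec_def reindex_vec_def
  by (simp add: sum.reindex_bij_betw[OF bij_Rep_well_ordered_copy, of "\<lambda>i. x $ i * y $ i"])

lemma inner_unindex_vec [simp]: "unindex_vec x \<bullet> unindex_vec y = x \<bullet> y"
  using inner_reindex_vec[of "unindex_vec x" "unindex_vec y"] by simp

lemma prod_Basis_vec: "(\<Prod>b\<in>Basis. x \<bullet> b) = (\<Prod>i\<in>UNIV. x $ i)" for x :: "real ^ 'n::finite"
proof -
  have B: "(Basis :: (real ^ 'n) set) = (\<lambda>i. axis i 1) ` UNIV"
    by (auto simp: Basis_vec_def)
  show ?thesis
    unfolding B by (subst prod.reindex) (auto simp: inner_axis inj_on_def axis_eq_axis)
qed

lemma measurable_linear_borel:
  fixes T :: "'a::euclidean_space \<Rightarrow> 'b::euclidean_space"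
  assumes "linear T" shows "T \<in> borel_measurable borel"
  using assms by (intro borel_measurable_continuous_onI linear_continuous_on)
    (simp add: linear_conv_bounded_linear)

lemma distr_lborel_reindex_vec: "distr lborel borel reindex_vec = (lborel :: (real ^ 'n::finite well_ordered_copy) measure)"
proof (rule lborel_eqI[symmetric])
  fix l u :: "real ^ 'n well_ordered_copy"
  assume lu: "\<And>b. b \<in> Basis \<Longrightarrow> l \<bullet> b \<le> u \<bullet> b"
  have lu': "l $ i \<le> u $ i" for i
    using lu[of "axis i 1"] by (simp add: inner_axis)
  have vim: "reindex_vec -` box l u = box (unindex_vec l) (unindex_vec u)"
  proof (rule set_eqI)
    fix x :: "real ^ 'n"
    have "(\<forall>i. l $ i < x $ Rep_well_ordered_copy i \<and> x $ Rep_well_ordered_copy i < u $ i)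
      \<longleftrightarrow> (\<forall>j. l $ Abs_well_ordered_copy j < x $ j \<and> x $ j < u $ Abs_well_ordered_copy j)"
      by (metis Rep_well_ordered_copy_inverse Abs_well_ordered_copy_inverse UNIV_I)
    then show "x \<in> reindex_vec -` box l u \<longleftrightarrow> x \<in> box (unindex_vec l) (unindex_vec u)"
      by (simp add: mem_box_cart reindex_vec_def unindex_vec_def)
  qed
  have "emeasure (distr lborel borel reindex_vec) (box l u) = emeasure lborel (box (unindex_vec l) (unindex_vec u))"
  proof -
    have "reindex_vec \<in> measurable lborel (borel :: (real ^ 'n well_ordered_copy) measure)"
      using measurable_linear_borel[OF linear_reindex_vec(1)] by simp
    from emeasure_distr[OF this, of "box l u"] show ?thesis
      by (simp add: vim)
  qed
  also have "\<dots> = (\<Prod>b\<in>Basis. (unindex_vec u - unindex_vec l) \<bullet> b)"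
    using lu' by (subst emeasure_lborel_box) (auto simp: Basis_vec_def inner_axis unindex_vec_def)
  also have "(\<Prod>b\<in>Basis. (unindex_vec u - unindex_vec l) \<bullet> b) = (\<Prod>b\<in>Basis. (u - l) \<bullet> b)"
    unfolding prod_Basis_vec unindex_vec_def
    by (subst prod.reindex_bij_betw[OF bij_Rep_well_ordered_copy, symmetric])
       (simp add: Rep_well_ordered_copy_inverse)
  finally show "emeasure (distr lborel borel reindex_vec) (box l u) = (\<Prod>b\<in>Basis. (u - l) \<bullet> b)" .
qed simp

lemma emeasure_reindex_vec:
  assumes "A \<in> sets borel"
  shows "emeasure lborel (reindex_vec -` A) = emeasure lborel A"
proof -
  have "reindex_vec \<in> measurable lborel borel"
    using measurable_linear_borel[OF linear_reindex_vec(1)] by simp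
  from emeasure_distr[OF this assms] show ?thesis
    by (simp add: distr_lborel_reindex_vec)
qed

text \<open>Conjugation with \<open>reindex_vec\<close> turns \<open>T\<close> into an orthogonal
  map over the well-ordered copy; boundedness of \<open>S\<close> provides the finite measure
  required there.\<close>

lemma emeasure_orthogonal_image:
  fixes T :: "real ^ 'n::finite \<Rightarrow> real ^ 'n"
  assumes T: "orthogonal_transformation T" and S: "S \<in> sets borel" "T ` S \<in> sets borel" "bounded S"
  shows "emeasure lborel (T ` S) = emeasure lborel S"
proof -
  define T' where "T' = reindex_vec \<circ> T \<circ> unindex_vec"
  have T': "orthogonal_transformation T'"
    using T linear_reindex_vec unfolding T'_def orthogonal_transformation_def
    by (auto intro!: linear_compose simp: o_assoc)
  have img: "unindex_vec -` A = reindex_vec ` A" for A :: "(real ^ 'n) set"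
    by (metis (no_types, lifting) bij_def bij_vimage_eq_inv_image inj_on_inverseI reindex_unindex surjI
       inv_unique_comp comp_def inv_equality)
  have un: "reindex_vec -` (unindex_vec -` A) = A" for A :: "(real ^ 'n) set"
    by auto
  have b: "unindex_vec -` A \<in> sets borel" if "A \<in> sets borel" for A :: "(real ^ 'n) set"
    using measurable_sets[OF measurable_linear_borel[OF linear_reindex_vec(2)] that] by simp
  have lm: "unindex_vec -` S \<in> lmeasurable"
  proof (rule bounded_set_imp_lmeasurable)
    show "bounded (unindex_vec -` S)"
      unfolding img using S(3) linear_reindex_vec(1) by (intro bounded_linear_image) (auto simp: linear_conv_bounded_linear)
    show "unindex_vec -` S \<in> sets lebesgue" using b[OF S(1)] by simp
  qed
  have eq: "T' ` (unindex_vec -` S) = unindex_vec -` (T ` S)"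
    by (auto simp: T'_def img image_image)
  have "emeasure lebesgue (T' ` (unindex_vec -` S)) = emeasure lebesgue (unindex_vec -` S)"
    using measure_orthogonal_image[OF T' lm] measurable_orthogonal_image[OF T' lm] lm
    by (simp add: emeasure_eq_measure2)
  then have "emeasure lborel (unindex_vec -` (T ` S)) = emeasure lborel (unindex_vec -` S)"
    using b[OF S(1)] b[OF S(2)] unfolding eq by simp
  then show ?thesis
    using emeasure_reindex_vec[OF b[OF S(1)]] emeasure_reindex_vec[OF b[OF S(2)]] by (simp add: un)
qed

section \<open>Orthogonal invariance of the normalized surface measure\<close>

definition open_cone :: "(real ^ 'n::finite) set \<Rightarrow> (real ^ 'n) set" where
  "open_cone A = {r *\<^sub>R x | r x. 0 < r \<and> r < 1 \<and> x \<in> A}"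

lemma sets_normalized_surface_measure:
  "sets normalized_surface_measure = sets (restrict_space borel (sphere 0 1))"
  by (simp add: normalized_surface_measure_def sets_sphere_surface_measure)

lemma space_normalized_surface_measure: "space normalized_surface_measure = sphere 0 1"
  by (simp add: normalized_surface_measure_def space_sphere_surface_measure)

lemma open_cone_eq_vimage:
  assumes "A \<subseteq> sphere 0 1"
  shows "open_cone A = sgn -` A \<inter> (ball 0 1 - {0})"
proof (intro equalityI subsetI)
  fix y assume y: "y \<in> sgn -` A \<inter> (ball 0 1 - {0})"
  then have "y = norm y *\<^sub>R sgn y" "0 < norm y" "norm y < 1" "sgn y \<in> A"
    by (auto simp: sgn_div_norm)
  then show "y \<in> open_cone A" unfolding open_cone_def by blast
next
  fix y assume "y \<in> open_cone A"
  then obtain r x where y: "y = r *\<^sub>R x" "0 < r" "r < 1" "x \<in> A" unfolding open_cone_def by blast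
  with assms have "norm x = 1" by auto
  with y show "y \<in> sgn -` A \<inter> (ball 0 1 - {0})" by (auto simp: sgn_div_norm)
qed

lemma open_cone_borel:
  fixes A :: "(real ^ 'n::finite) set"
  assumes "A \<in> sets borel" "A \<subseteq> sphere 0 1"
  shows "open_cone A \<in> sets borel"
proof -
  have "(sgn :: real ^ 'n \<Rightarrow> _) \<in> borel_measurable borel"
    unfolding sgn_div_norm by measurable
  then have "sgn -` A \<inter> space borel \<in> sets borel"
    using assms(1) by (rule measurable_sets)
  then show ?thesis
    using assms by (auto simp: open_cone_eq_vimage)
qed

text \<open>\<open>T\<close> commutes with positive scalings, so it maps the cone over the preimage
  of \<open>A\<close> onto the cone over \<open>A\<close>. The preimage form is the one that
  \<open>distr\<close> asks for.\<close>

lemma emeasure_open_cone_orthogonal_vimage: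
  fixes T :: "real ^ 'n::finite \<Rightarrow> real ^ 'n"
  assumes T: "orthogonal_transformation T" and A: "A \<in> sets borel" "A \<subseteq> sphere 0 1"
  shows "emeasure lborel (open_cone (T -` A)) = emeasure lborel (open_cone A)"
proof -
  have lin: "linear T" and nrm: "\<And>x. norm (T x) = norm x"
    using T by (auto simp: orthogonal_transformation)
  have "T \<in> borel_measurable borel"
    using lin by (rule measurable_linear_borel)
  then have TA: "T -` A \<in> sets borel"
    using A(1) measurable_sets[of T borel borel A] by simp
  have TA1: "T -` A \<subseteq> sphere 0 1" using A(2) nrm by auto
  have img: "T ` open_cone (T -` A) = open_cone A"
  proof (intro equalityI subsetI)
    fix y assume "y \<in> open_cone A"
    then obtain r x where y: "y = r *\<^sub>R x" "0 < r" "r < 1" "x \<in> A" unfolding open_cone_def by blast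
    obtain z where "x = T z" using T orthogonal_transformation_surj by blast
    then have "y = T (r *\<^sub>R z)" using y lin by (simp add: linear_cmul)
    with y \<open>x = T z\<close> show "y \<in> T ` open_cone (T -` A)"
      unfolding open_cone_def by blast
  next
    fix y assume "y \<in> T ` open_cone (T -` A)"
    then obtain r x where "y = T (r *\<^sub>R x)" "0 < r" "r < 1" "T x \<in> A"
      unfolding open_cone_def by blast
    then show "y \<in> open_cone A"
      using lin unfolding open_cone_def by (auto simp: linear_cmul)
  qed
  have "bounded (open_cone (T -` A))"
    by (rule bounded_subset[of "ball 0 1"]) (use TA1 in \<open>auto simp: open_cone_eq_vimage\<close>)
  then show ?thesis
    using emeasure_orthogonal_image[OF T open_cone_borel[OF TA TA1]] open_cone_borel[OF A] img by simp
qed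

lemma distr_normalized_surface_measure:
  fixes T :: "real ^ 'n::finite \<Rightarrow> real ^ 'n"
  assumes T: "orthogonal_transformation T"
  shows "T \<in> measurable normalized_surface_measure normalized_surface_measure"
    and "distr normalized_surface_measure normalized_surface_measure T = normalized_surface_measure"
proof -
  let ?\<sigma> = "normalized_surface_measure :: (real ^ 'n) measure"
  have lin: "linear T" and nrm: "\<And>x. norm (T x) = norm x"
    using T by (auto simp: orthogonal_transformation)
  have "T \<in> borel_measurable borel"
    using lin by (rule measurable_linear_borel)
  then have "T \<in> measurable (restrict_space borel (sphere 0 1)) (restrict_space borel (sphere 0 1))"
    by (intro measurable_restrict_space2 measurable_restrict_space1)
       (auto simp: space_restrict_space nrm)
  then show meas: "T \<in> measurable ?\<sigma> ?\<sigma>"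
    using measurable_cong_sets[OF sets_normalized_surface_measure sets_normalized_surface_measure] by blast
  show "distr ?\<sigma> ?\<sigma> T = ?\<sigma>"
  proof (rule measure_eqI)
    fix A assume "A \<in> sets (distr ?\<sigma> ?\<sigma> T)"
    then have A: "A \<in> sets ?\<sigma>" by simp
    then have A': "A \<in> sets borel" "A \<subseteq> sphere 0 1"
      by (auto simp: sets_normalized_surface_measure sets_restrict_space_iff)
    have TA: "T -` A \<in> sets borel" "T -` A \<subseteq> sphere 0 1"
      using A' nrm measurable_sets[OF \<open>T \<in> borel_measurable borel\<close> A'(1)] by auto
    have mem: "A \<in> sets sphere_surface_measure" "T -` A \<in> sets sphere_surface_measure"
      "sphere 0 1 \<in> sets (sphere_surface_measure :: (real^'n) measure)"
      using A' TA by (auto simp: sets_sphere_surface_measure sets_restrict_space_iff)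
    have "emeasure (distr ?\<sigma> ?\<sigma> T) A = emeasure ?\<sigma> (T -` A)"
      using emeasure_distr[OF meas A] TA(2) by (simp add: space_normalized_surface_measure Int_absorb2)
    also have "\<dots> = emeasure ?\<sigma> A"
      using mem emeasure_open_cone_orthogonal_vimage[OF T A']
        emeasure_sphere_surface_measure[OF A'] emeasure_sphere_surface_measure[OF TA]
      by (simp add: normalized_surface_measure_def Int_absorb1[OF A'(2)] Int_absorb1[OF TA(2)]
            open_cone_def)
    finally show "emeasure (distr ?\<sigma> ?\<sigma> T) A = emeasure ?\<sigma> A" .
  qed simp
qed

section \<open>Integration over the sphere and moments of linear forms\<close>

lemma prob_space_normalized_surface_measure:
  "emeasure normalized_surface_measure (space (normalized_surface_measure :: (real ^ 'n::finite) measure)) = 1"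
  by (simp add: space_normalized_surface_measure emeasure_normalized_surface_measure_sphere)

lemma measurable_normalized_surface_measure:
  assumes "f \<in> borel_measurable borel"
  shows "f \<in> borel_measurable normalized_surface_measure"
  using measurable_restrict_space1[OF assms, of "sphere 0 1"]
    measurable_cong_sets[OF sets_normalized_surface_measure refl] by blast

lemma integrable_normalized_surface_measure:
  fixes f :: "real ^ 'n::finite \<Rightarrow> real"
  assumes "continuous_on UNIV f"
  shows "integrable normalized_surface_measure f"
proof -
  interpret finite_measure "normalized_surface_measure :: (real ^ 'n) measure"
    by (rule finite_measureI) (simp add: prob_space_normalized_surface_measure)
  have "compact (f ` sphere 0 1)"
    by (rule compact_continuous_image) (use assms continuous_on_subset in auto)
  then obtain B where B: "\<And>x. x \<in> sphere 0 1 \<Longrightarrow> norm (f x) \<le> B"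
    by (meson compact_imp_bounded bounded_iff imageI)
  show ?thesis
  proof (rule integrable_const_bound[of _ B])
    show "AE x in normalized_surface_measure. norm (f x) \<le> B"
      by (rule AE_I2) (use B in \<open>simp add: space_normalized_surface_measure\<close>)
    show "f \<in> borel_measurable normalized_surface_measure"
      by (intro measurable_normalized_surface_measure borel_measurable_continuous_onI assms)
  qed
qed

lemma integral_normalized_surface_measure_orthogonal:
  fixes T :: "real ^ 'n::finite \<Rightarrow> real ^ 'n" and f :: "real ^ 'n \<Rightarrow> real"
  assumes T: "orthogonal_transformation T" and f: "f \<in> borel_measurable borel"
  shows "(LINT y|normalized_surface_measure. f (T y)) = (LINT y|normalized_surface_measure. f y)"
  using integral_distr[OF distr_normalized_surface_measure(1)[OF T] measurable_normalized_surface_measure[OF f]]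
  by (simp add: distr_normalized_surface_measure(2)[OF T])

lemma integral_normalized_surface_measure_cong:
  fixes f g :: "real ^ 'n::finite \<Rightarrow> real"
  assumes "\<And>y. norm y = 1 \<Longrightarrow> f y = g y"
  shows "(LINT y|normalized_surface_measure. f y) = (LINT y|normalized_surface_measure. g y)"
  by (rule Bochner_Integration.integral_cong) (use assms in \<open>auto simp: space_normalized_surface_measure\<close>)

lemma measure_normalized_surface_measure_space:
  "measure normalized_surface_measure (space (normalized_surface_measure :: (real ^ 'n::finite) measure)) = 1"
  by (simp add: Sigma_Algebra.measure_def prob_space_normalized_surface_measure)

text \<open>\<open>undefined\<close> merely fixes some coordinate axis; by
  \<open>integral_inner_power\<close> every unit vector yields the same moments.\<close>

definition sphere_moment :: "'n::finite itself \<Rightarrow> nat \<Rightarrow> real" where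
  "sphere_moment _ k = (LINT y|(normalized_surface_measure :: (real ^ 'n) measure). (y \<bullet> axis undefined 1) ^ k)"

text \<open>Some orthogonal map sends \<open>v\<close> to \<open>norm v\<close> times the chosen
  axis, and the surface measure is invariant under it.\<close>

lemma integral_inner_power:
  fixes v :: "real ^ 'n::finite"
  shows "(LINT y|normalized_surface_measure. (y \<bullet> v) ^ k) = norm v ^ k * sphere_moment TYPE('n) k"
proof -
  let ?e = "axis undefined 1 :: real ^ 'n"
  have "norm v = norm (norm v *\<^sub>R ?e)" by (simp add: norm_axis_1)
  then obtain T :: "real ^ 'n \<Rightarrow> real ^ 'n" where T: "orthogonal_transformation T" "T v = norm v *\<^sub>R ?e"
    by (rule orthogonal_transformation_exists)
  have eq: "y \<bullet> v = norm v * (T y \<bullet> ?e)" for y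
  proof -
    have "y \<bullet> v = T y \<bullet> T v" using T(1) by (simp add: orthogonal_transformation_def)
    then show ?thesis using T(2) by simp
  qed
  have m: "(\<lambda>y :: real ^ 'n. (y \<bullet> ?e) ^ k) \<in> borel_measurable borel"
    by measurable
  have "(LINT y|normalized_surface_measure. (y \<bullet> v) ^ k)
      = (LINT y|normalized_surface_measure. norm v ^ k * (T y \<bullet> ?e) ^ k)"
    by (simp add: eq power_mult_distrib)
  also have "\<dots> = norm v ^ k * (LINT y|normalized_surface_measure. (T y \<bullet> ?e) ^ k)"
    by simp
  also have "(LINT y|normalized_surface_measure. (T y \<bullet> ?e) ^ k) = sphere_moment TYPE('n) k"
    unfolding sphere_moment_def by (rule integral_normalized_surface_measure_orthogonal[OF T(1) m])
  finally show ?thesis .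
qed

lemma sphere_moment_odd:
  assumes "odd k" shows "sphere_moment TYPE('n::finite) k = 0"
proof -
  let ?e = "axis undefined 1 :: real ^ 'n"
  have T: "orthogonal_transformation (\<lambda>y :: real ^ 'n. - y)"
    by (simp add: orthogonal_transformation_def linear_iff)
  have m: "(\<lambda>y :: real ^ 'n. (y \<bullet> ?e) ^ k) \<in> borel_measurable borel"
    by measurable
  from integral_normalized_surface_measure_orthogonal[OF T m] assms
  show ?thesis by (simp add: sphere_moment_def)
qed

lemma sum_axis_power2: "(\<Sum>i\<in>UNIV. (y \<bullet> axis i 1)\<^sup>2) = (norm (y :: real ^ 'n::finite))\<^sup>2"
  unfolding power2_norm_eq_inner inner_axis by (simp add: inner_vec_def power2_eq_square)

lemma sphere_moment_2: "sphere_moment TYPE('n::finite) 2 = 1 / CARD('n)"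
proof -
  have "1 = (LINT y|(normalized_surface_measure :: (real ^ 'n) measure). (\<Sum>i\<in>UNIV. (y \<bullet> axis i 1)\<^sup>2))"
    by (subst integral_normalized_surface_measure_cong[where g = "\<lambda>_. 1"])
       (auto simp: sum_axis_power2 measure_normalized_surface_measure_space)
  also have "\<dots> = (\<Sum>i\<in>UNIV. LINT y|(normalized_surface_measure :: (real ^ 'n) measure). (y \<bullet> axis i 1)\<^sup>2)"
    by (intro Bochner_Integration.integral_sum integrable_normalized_surface_measure continuous_intros)
  also have "\<dots> = CARD('n) * sphere_moment TYPE('n) 2"
    by (simp add: integral_inner_power norm_axis_1)
  finally show ?thesis by (simp add: field_simps)
qed

text \<open>Polarization: twelve times the integrand is a combination of four fourth powers. As
  \<open>u + v\<close> and \<open>u - v\<close> have norm sqrt 2, these contribute 4 + 4 - 2 - 2 = 4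
  times the fourth moment.\<close>

lemma integral_inner_squares:
  fixes u v :: "real ^ 'n::finite"
  assumes "norm u = 1" "norm v = 1" "u \<bullet> v = 0"
  shows "(LINT y|normalized_surface_measure. (y \<bullet> u)\<^sup>2 * (y \<bullet> v)\<^sup>2) = sphere_moment TYPE('n) 4 / 3"
proof -
  let ?I = "\<lambda>f :: real ^ 'n \<Rightarrow> real. LINT y|normalized_surface_measure. f y"
  have nrm: "norm (u + v) ^ 4 = 4" "norm (u - v) ^ 4 = 4"
  proof -
    have "norm (u + v) ^ 2 = 2" "norm (u - v) ^ 2 = 2"
      using assms by (simp_all add: norm_eq_sqrt_inner inner_add inner_diff inner_commute)
    then have "(norm (u + v) ^ 2)^2 = 4" "(norm (u - v) ^ 2)^2 = 4" by simp_all
    then show "norm (u + v) ^ 4 = 4" "norm (u - v) ^ 4 = 4" by simp_all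
  qed
  have int: "integrable normalized_surface_measure (\<lambda>y. (y \<bullet> w) ^ 4)"
    "integrable normalized_surface_measure (\<lambda>y. (y \<bullet> w)^2 * (y \<bullet> w')^2)" for w w' :: "real ^ 'n"
    by (intro integrable_normalized_surface_measure continuous_intros)+
  have "(\<lambda>y. (y \<bullet> u)\<^sup>2 * (y \<bullet> v)\<^sup>2)
      = (\<lambda>y. ((y \<bullet> (u + v)) ^ 4 + (y \<bullet> (u - v)) ^ 4 - 2 * (y \<bullet> u) ^ 4 - 2 * (y \<bullet> v) ^ 4) / 12)"
    by (rule ext) (simp add: inner_add_right inner_diff_right, algebra)
  then have "?I (\<lambda>y. (y \<bullet> u)\<^sup>2 * (y \<bullet> v)\<^sup>2)
      = (?I (\<lambda>y. (y \<bullet> (u + v)) ^ 4) + ?I (\<lambda>y. (y \<bullet> (u - v)) ^ 4) - 2 * ?I (\<lambda>y. (y \<bullet> u) ^ 4) - 2 * ?I (\<lambda>y. (y \<bullet> v) ^ 4)) / 12"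
    using int by simp
  then show ?thesis
    by (simp add: integral_inner_power nrm assms)
qed

text \<open>Integrating the square of y_1^2 + ... + y_n^2 = 1 gives n terms with the full fourth
  moment and n (n - 1) terms with a third of it.\<close>

lemma sphere_moment_4: "sphere_moment TYPE('n::finite) 4 = 3 / (CARD('n) * (CARD('n) + 2))"
proof -
  let ?n = "real CARD('n)" and ?\<phi> = "sphere_moment TYPE('n) 4"
  have *: "(LINT y|(normalized_surface_measure :: (real ^ 'n) measure). (y \<bullet> axis i 1)\<^sup>2 * (y \<bullet> axis j 1)\<^sup>2)
      = (if i = j then ?\<phi> else ?\<phi> / 3)" for i j :: 'n
  proof (cases "i = j")
    case True
    have "(y \<bullet> axis j 1)\<^sup>2 * (y \<bullet> axis j 1)\<^sup>2 = (y \<bullet> axis j 1) ^ 4" for y :: "real ^ 'n"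
      by algebra
    with True show ?thesis by (simp add: integral_inner_power norm_axis_1)
  next
    case False
    then show ?thesis
      by (simp add: integral_inner_squares norm_axis_1 inner_axis_axis)
  qed
  have "1 = (LINT y|(normalized_surface_measure :: (real ^ 'n) measure).
      (\<Sum>i\<in>UNIV. \<Sum>j\<in>UNIV. (y \<bullet> axis i 1)\<^sup>2 * (y \<bullet> axis j 1)\<^sup>2))"
    by (subst integral_normalized_surface_measure_cong[where g = "\<lambda>_. 1"])
       (auto simp: sum_product[symmetric] sum_axis_power2 measure_normalized_surface_measure_space)
  also have "\<dots> = (\<Sum>i\<in>UNIV. \<Sum>j\<in>UNIV. LINT y|(normalized_surface_measure :: (real ^ 'n) measure).
      (y \<bullet> axis i 1)\<^sup>2 * (y \<bullet> axis j 1)\<^sup>2)"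
    by (subst Bochner_Integration.integral_sum | intro sum.cong refl integrable_normalized_surface_measure continuous_intros)+
  also have "\<dots> = (\<Sum>i\<in>(UNIV::'n set). \<Sum>j\<in>(UNIV::'n set). ?\<phi> / 3 + (if j = i then 2 * ?\<phi> / 3 else 0))"
    unfolding * by (intro sum.cong refl) auto
  also have "\<dots> = ?n * (?n * ?\<phi> / 3 + 2 * ?\<phi> / 3)"
    by (simp add: sum.distrib)
  also have "\<dots> = ?n * (?n + 2) * ?\<phi> / 3" by (simp add: field_simps)
  finally have "?n * (?n + 2) * ?\<phi> = 3" by simp
  moreover have "?n * (?n + 2) \<noteq> 0" by (simp add: add_eq_0_iff)
  ultimately show ?thesis by (simp add: field_simps)
qed

section \<open>Tight designs and equiangular lines\<close>

lemma polynomial_of_degree_le_monomial: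
  assumes "sum \<alpha> UNIV \<le> t"
  shows "polynomial_of_degree_le t (\<lambda>x :: real ^ 'n::finite. a * (\<Prod>i\<in>UNIV. (x $ i) ^ \<alpha> i))"
proof -
  have "(\<Sum>\<beta> | sum \<beta> UNIV \<le> t. (if \<beta> = \<alpha> then a else 0) * (\<Prod>i\<in>UNIV. (x $ i) ^ \<beta> i))
      = a * (\<Prod>i\<in>UNIV. (x $ i) ^ \<alpha> i)" for x :: "real ^ 'n"
    using assms sum.delta[OF finite_exponents_le[of t], of \<alpha> "\<lambda>\<beta>. a * (\<Prod>i\<in>UNIV. (x $ i) ^ \<beta> i)"]
    by (simp add: if_distrib[of "\<lambda>u. u * _"] cong: if_cong)
  then show ?thesis
    unfolding polynomial_of_degree_le_def by (intro exI[of _ "\<lambda>\<beta>. if \<beta> = \<alpha> then a else 0"]) simp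
qed

lemma polynomial_of_degree_le_add:
  assumes "polynomial_of_degree_le t f" "polynomial_of_degree_le t g"
  shows "polynomial_of_degree_le t (\<lambda>x :: real ^ 'n::finite. f x + g x)"
proof -
  from assms obtain c d where
    "f = (\<lambda>x. \<Sum>\<alpha> | sum \<alpha> UNIV \<le> t. c \<alpha> * (\<Prod>i\<in>UNIV. (x $ i) ^ \<alpha> i))"
    "g = (\<lambda>x. \<Sum>\<alpha> | sum \<alpha> UNIV \<le> t. d \<alpha> * (\<Prod>i\<in>UNIV. (x $ i) ^ \<alpha> i))"
    unfolding polynomial_of_degree_le_def by blast
  then show ?thesis
    unfolding polynomial_of_degree_le_def
    by (intro exI[of _ "\<lambda>\<alpha>. c \<alpha> + d \<alpha>"]) (simp add: sum.distrib[symmetric] algebra_simps)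
qed

lemma polynomial_of_degree_le_const: "polynomial_of_degree_le t (\<lambda>x :: real ^ 'n::finite. a)"
  using polynomial_of_degree_le_monomial[of "\<lambda>_. 0" t a] by simp

lemma polynomial_of_degree_le_sum:
  assumes "finite S" "\<And>s. s \<in> S \<Longrightarrow> polynomial_of_degree_le t (f s)"
  shows "polynomial_of_degree_le t (\<lambda>x :: real ^ 'n::finite. \<Sum>s\<in>S. f s x)"
  using assms
  by (induction S rule: finite_induct)
     (auto intro: polynomial_of_degree_le_const polynomial_of_degree_le_add)

lemma polynomial_of_degree_le_mult_coordinate:
  assumes "polynomial_of_degree_le t f"
  shows "polynomial_of_degree_le (Suc t) (\<lambda>x :: real ^ 'n::finite. a * x $ j * f x)"
proof -
  from assms obtain c where
    f: "f = (\<lambda>x. \<Sum>\<alpha> | sum \<alpha> UNIV \<le> t. c \<alpha> * (\<Prod>i\<in>UNIV. (x $ i) ^ \<alpha> i))"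
    unfolding polynomial_of_degree_le_def by blast
  have "polynomial_of_degree_le (Suc t) (\<lambda>x. \<Sum>\<alpha> | sum \<alpha> UNIV \<le> t.
      (a * c \<alpha>) * (\<Prod>i\<in>UNIV. (x $ i) ^ (\<alpha>(j := Suc (\<alpha> j))) i))"
  proof (intro polynomial_of_degree_le_sum finite_exponents_le polynomial_of_degree_le_monomial)
    fix \<alpha> :: "'n \<Rightarrow> nat" assume "\<alpha> \<in> {\<alpha>. sum \<alpha> UNIV \<le> t}"
    moreover have "sum (\<alpha>(j := Suc (\<alpha> j))) UNIV = Suc (sum \<alpha> UNIV)"
      by (simp add: sum.remove[of UNIV j])
    ultimately show "sum (\<alpha>(j := Suc (\<alpha> j))) UNIV \<le> Suc t" by simp
  qed
  moreover have "(\<Prod>i\<in>UNIV. (x $ i) ^ (\<alpha>(j := Suc (\<alpha> j))) i) = x $ j * (\<Prod>i\<in>UNIV. (x $ i) ^ \<alpha> i)"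
    for x :: "real ^ 'n" and \<alpha>
    by (simp add: prod.remove[of UNIV j])
  ultimately show ?thesis by (simp add: f sum_distrib_left mult_ac)
qed

lemma polynomial_of_degree_le_Suc:
  assumes "polynomial_of_degree_le t f"
  shows "polynomial_of_degree_le (Suc t) (f :: real ^ 'n::finite \<Rightarrow> real)"
proof -
  from assms obtain c where
    f: "f = (\<lambda>x. \<Sum>\<alpha> | sum \<alpha> UNIV \<le> t. c \<alpha> * (\<Prod>i\<in>UNIV. (x $ i) ^ \<alpha> i))"
    unfolding polynomial_of_degree_le_def by blast
  show ?thesis
    unfolding f
    by (intro polynomial_of_degree_le_sum finite_exponents_le polynomial_of_degree_le_monomial) simp
qed

lemma polynomial_of_degree_le_mono:
  assumes "polynomial_of_degree_le t f" "t \<le> t'"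
  shows "polynomial_of_degree_le t' (f :: real ^ 'n::finite \<Rightarrow> real)"
  using assms(2,1) by (induction t' rule: dec_induct) (auto intro: polynomial_of_degree_le_Suc)

lemma polynomial_of_degree_le_inner_power:
  "polynomial_of_degree_le k (\<lambda>y :: real ^ 'n::finite. (y \<bullet> v) ^ k)"
proof (induction k)
  case (Suc k)
  have "polynomial_of_degree_le (Suc k) (\<lambda>y :: real ^ 'n. \<Sum>i\<in>UNIV. v $ i * y $ i * (y \<bullet> v) ^ k)"
    by (intro polynomial_of_degree_le_sum polynomial_of_degree_le_mult_coordinate Suc) simp
  then show ?case
    by (simp add: inner_vec_def sum_distrib_right mult_ac)
qed (simp add: polynomial_of_degree_le_const)

lemma spherical_design_power_sum:
  fixes D :: "(real ^ 'n::finite) set"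
  assumes "spherical_design t D" "k \<le> t"
  shows "(\<Sum>y\<in>D. (y \<bullet> v) ^ k) = card D * norm v ^ k * sphere_moment TYPE('n) k"
proof -
  have "1 / real (card D) * (\<Sum>y\<in>D. (y \<bullet> v) ^ k) = norm v ^ k * sphere_moment TYPE('n) k"
    using assms polynomial_of_degree_le_mono[OF polynomial_of_degree_le_inner_power assms(2), of v]
    unfolding spherical_design_def integral_inner_power[symmetric] by blast
  moreover have "card D > 0"
    using assms by (auto simp: spherical_design_def card_gt_0_iff)
  ultimately show ?thesis by (simp add: field_simps)
qed

section \<open>Inner products and antipodality of tight designs\<close>

context
  fixes D :: "(real ^ 'n::finite) set" and n c :: real
  assumes tight: "tight_spherical_5_design D"
  defines "n \<equiv> real CARD('n)" and "c \<equiv> 1 / (n + 2)"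
begin

lemma tight_design_power_sums:
  "(\<Sum>y\<in>D. (y \<bullet> v)\<^sup>2) = (n + 1) * norm v ^ 2"
  "(\<Sum>y\<in>D. (y \<bullet> v) ^ 4) = 3 * (n + 1) * c * norm v ^ 4"
  "(\<Sum>y\<in>D. y \<bullet> v) = 0"
  "(\<Sum>y\<in>D. (y \<bullet> v) ^ 3) = 0"
  "(\<Sum>y\<in>D. (y \<bullet> v) ^ 5) = 0"
proof -
  have sd: "spherical_design 5 D" and card: "real (card D) = n * (n + 1)"
    using tight by (auto simp: tight_spherical_5_design_def n_def algebra_simps)
  have n: "n > 0" by (simp add: n_def)
  show "(\<Sum>y\<in>D. (y \<bullet> v)\<^sup>2) = (n + 1) * norm v ^ 2"
    using spherical_design_power_sum[OF sd, of 2 v] n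
    by (simp add: sphere_moment_2 card flip: n_def)
  show "(\<Sum>y\<in>D. (y \<bullet> v) ^ 4) = 3 * (n + 1) * c * norm v ^ 4"
  proof -
    have "n * (n + 1) * (3 / (n * (n + 2))) = 3 * (n + 1) * c"
      using n by (simp add: c_def divide_simps)
    moreover have moment: "sphere_moment TYPE('n) 4 = 3 / (n * (n + 2))"
      by (simp add: sphere_moment_4 n_def algebra_simps)
    moreover have "(\<Sum>y\<in>D. (y \<bullet> v) ^ 4) = (n * (n + 1) * (3 / (n * (n + 2)))) * norm v ^ 4"
    proof -
      have "(4 :: nat) \<le> 5" by simp
      from spherical_design_power_sum[OF sd this, of v] show ?thesis
        unfolding card moment by (simp only: mult_ac)
    qed
    ultimately show ?thesis by simp
  qed
  show "(\<Sum>y\<in>D. y \<bullet> v) = 0" "(\<Sum>y\<in>D. (y \<bullet> v) ^ 3) = 0" "(\<Sum>y\<in>D. (y \<bullet> v) ^ 5) = 0"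
    using spherical_design_power_sum[OF sd, of 1 v] spherical_design_power_sum[OF sd, of 3 v]
      spherical_design_power_sum[OF sd, of 5 v]
    by (simp_all add: sphere_moment_odd)
qed

lemma tight_design_basic:
  "finite D" "D \<noteq> {}" "real (card D) = n * (n + 1)" "n > 0" "c > 0" "c < 1" "x \<in> D \<Longrightarrow> norm x = 1"
  using tight
  by (auto simp: tight_spherical_5_design_def spherical_design_def n_def c_def divide_simps algebra_simps
      dest: subsetD)

text \<open>Equality in the linear programming bound, with test function \<open>(1 + u) (u\<^sup>2 - 1/(n+2))\<^sup>2\<close>.\<close>

lemma tight_design_inner:
  assumes x: "x \<in> D" and y: "y \<in> D" and "x \<noteq> y"
  shows "y \<bullet> x = - 1 \<or> (y \<bullet> x)\<^sup>2 = c"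
proof -
  define f where "f u = (1 + u) * (u\<^sup>2 - c)\<^sup>2" for u :: real
  have nx: "norm x = 1" using tight_design_basic(7)[OF x] .
  have f: "f u = u ^ 5 + u ^ 4 - 2 * c * u ^ 3 - 2 * c * u\<^sup>2 + c\<^sup>2 * u + c\<^sup>2" for u
    unfolding f_def by algebra
  have nonneg: "f (z \<bullet> x) \<ge> 0" if "z \<in> D" for z
  proof -
    have "\<bar>z \<bullet> x\<bar> \<le> 1"
      using Cauchy_Schwarz_ineq2[of z x] nx tight_design_basic(7)[OF that] by simp
    then show ?thesis by (simp add: f_def)
  qed
  \<comment> \<open>The moments give 2 (1 - c)^2 for the whole sum. This is \<open>f 1\<close>, so
    the term at \<open>x\<close> exhausts it and the other nonnegative terms vanish.\<close>
  have "(\<Sum>z\<in>D. f (z \<bullet> x)) = 3 * (n + 1) * c - 2 * c * (n + 1) + n * (n + 1) * c\<^sup>2"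
    unfolding f sum.distrib sum_subtractf sum_distrib_left[symmetric]
    by (simp add: tight_design_power_sums nx tight_design_basic(3))
  also have "\<dots> = 2 * (1 - c)\<^sup>2"
  proof -
    have "n * c = 1 - 2 * c" using tight_design_basic(4) by (simp add: c_def field_simps)
    then show ?thesis by algebra
  qed
  also have "\<dots> = f (x \<bullet> x)"
    using nx by (simp add: f_def dot_square_norm)
  finally have "(\<Sum>z\<in>D - {x}. f (z \<bullet> x)) = 0"
    using x tight_design_basic(1) by (simp add: sum_diff1)
  then have "f (y \<bullet> x) = 0"
    using nonneg y \<open>x \<noteq> y\<close> tight_design_basic(1) by (subst (asm) sum_nonneg_eq_0_iff) auto
  then show ?thesis by (auto simp: f_def)
qed

text \<open>If \<open>- x\<close> were missing, every other point would have an inner product u with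
  u^2 = c, where u^3 - c u vanishes. This odd polynomial sums to 0 over \<open>D\<close>, yet
  \<open>x\<close> itself contributes 1 - c > 0.\<close>

lemma tight_design_antipodal:
  assumes x: "x \<in> D" shows "- x \<in> D"
proof (rule ccontr)
  assume nD: "- x \<notin> D"
  have nx: "norm x = 1" using tight_design_basic(7)[OF x] .
  have inner: "(y \<bullet> x)\<^sup>2 = c" if y: "y \<in> D - {x}" for y
  proof (rule ccontr)
    assume "(y \<bullet> x)\<^sup>2 \<noteq> c"
    with tight_design_inner[OF x, of y] y have m1: "y \<bullet> x = - 1" by auto
    have "norm y = 1" using y tight_design_basic(7) by auto
    moreover have "(y + x) \<bullet> (y + x) = y \<bullet> y + 2 * (y \<bullet> x) + x \<bullet> x"
      by (simp add: inner_add inner_commute)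
    ultimately have "(y + x) \<bullet> (y + x) = 0"
      using m1 nx by (simp add: dot_square_norm)
    then have "y = - x" by (simp add: eq_neg_iff_add_eq_0)
    with y nD show False by auto
  qed
  have "(\<Sum>y\<in>D. (y \<bullet> x) ^ 3 - c * (y \<bullet> x)) = 0"
    by (simp add: sum_subtractf sum_distrib_left[symmetric] tight_design_power_sums)
  also have "(\<Sum>y\<in>D. (y \<bullet> x) ^ 3 - c * (y \<bullet> x))
      = (1 - c) + (\<Sum>y\<in>D - {x}. (y \<bullet> x) ^ 3 - c * (y \<bullet> x))"
    using x tight_design_basic(1) nx by (subst sum.remove[of D x]) (auto simp: dot_square_norm)
  also have "(\<Sum>y\<in>D - {x}. (y \<bullet> x) ^ 3 - c * (y \<bullet> x)) = 0"
    using inner by (intro sum.neutral) (auto simp: power3_eq_cube power2_eq_square)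
  finally show False using tight_design_basic(6) by simp
qed

end

text \<open>\<open>SOME y. y \<in> {x, - x}\<close> depends only on the set, which is the same for
  \<open>x\<close> and \<open>- x\<close>, so it selects one point of each pair; the two points
  differ because 0 is excluded.\<close>

lemma obtain_half_of_antipodal_set:
  fixes D :: "'a::real_vector set"
  assumes "\<And>x. x \<in> D \<Longrightarrow> - x \<in> D" "0 \<notin> D"
  obtains H where "D = H \<union> uminus ` H" "H \<inter> uminus ` H = {}"
proof
  let ?H = "{x \<in> D. (SOME y. y \<in> {x, - x}) = x}"
  have *: "(SOME y. y \<in> {x, - x}) \<in> {x, - x}" for x :: 'a
    by (rule someI[of _ x]) simp
  have sw: "{- x, - (- x)} = {x, - x}" for x :: 'a by auto
  show "D = ?H \<union> uminus ` ?H"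
  proof (intro equalityI subsetI)
    fix x assume x: "x \<in> D"
    consider "(SOME y. y \<in> {x, - x}) = x" | "(SOME y. y \<in> {x, - x}) = - x"
      using *[of x] by blast
    then show "x \<in> ?H \<union> uminus ` ?H"
    proof cases
      case 1 with x show ?thesis by auto
    next
      case 2
      then have "(SOME y. y \<in> {- x, - (- x)}) = - x" unfolding sw .
      then have "- x \<in> ?H" using assms(1)[OF x] by blast
      then have "- (- x) \<in> uminus ` ?H" by (rule imageI)
      then show ?thesis by simp
    qed
  qed (use assms in auto)
  show "?H \<inter> uminus ` ?H = {}"
  proof (rule ccontr)
    assume "?H \<inter> uminus ` ?H \<noteq> {}"
    then obtain x where x: "x \<in> D" "(SOME y. y \<in> {- x, x}) = - x" "(SOME y. y \<in> {x, - x}) = x"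
      by auto
    have "{- x, x} = {x, - x}" by auto
    with x have "x = - x" by simp
    then have "2 *\<^sub>R x = 0" by (metis add.right_inverse scaleR_2)
    with x(1) assms(2) show False by simp
  qed
qed

text \<open>One point is kept per line and scaled by sqrt t, so that the cosines 1 / t and - 1 / t
  become the integers 1 and - 1. The power sums over the design are halved and multiplied by t and
  t^2, with n + 1 = t^2 - 1.\<close>

lemma tight_design_equiangular_lines:
  fixes D :: "(real ^ 'n::finite) set" and t :: real
  assumes tight: "tight_spherical_5_design D" and t: "t > 0" "real CARD('n) + 2 = t\<^sup>2"
  obtains H :: "(real ^ 'n) set" where
    "finite H" "2 * card H = CARD('n) * (CARD('n) + 1)"
    "\<And>x. x \<in> H \<Longrightarrow> x \<bullet> x = t"
    "\<And>x y. x \<in> H \<Longrightarrow> y \<in> H \<Longrightarrow> x \<noteq> y \<Longrightarrow> x \<bullet> y = 1 \<or> x \<bullet> y = - 1"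
    "\<And>v. (\<Sum>x\<in>H. (x \<bullet> v)\<^sup>2) = (t\<^sup>2 - 1) * t / 2 * (v \<bullet> v)"
    "\<And>v. (\<Sum>x\<in>H. (x \<bullet> v) ^ 4) = 3 * (t\<^sup>2 - 1) / 2 * (v \<bullet> v)\<^sup>2"
proof -
  note basic = tight_design_basic[OF tight]
  note ant = tight_design_antipodal[OF tight]
  have "0 \<notin> D" using basic(7)[of 0] by auto
  with ant obtain H0 where H0: "D = H0 \<union> uminus ` H0" "H0 \<inter> uminus ` H0 = {}"
    using obtain_half_of_antipodal_set by blast
  have fin: "finite H0" using basic(1) H0(1) by simp
  have sumD: "(\<Sum>y\<in>D. f y) = 2 * (\<Sum>y\<in>H0. f y)" if "\<And>y. f (- y) = f y" for f :: "real ^ 'n \<Rightarrow> real"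
  proof -
    have "(\<Sum>y\<in>uminus ` H0. f y) = (\<Sum>y\<in>H0. f y)"
      by (subst sum.reindex) (auto simp: that)
    then show ?thesis
      using H0(2) fin unfolding H0(1) by (subst sum.union_disjoint) auto
  qed
  let ?s = "\<lambda>x :: real ^ 'n. sqrt t *\<^sub>R x"
  have inj: "inj_on ?s H0" using t by (auto simp: inj_on_def)
  have c: "1 / (real CARD('n) + 2) = 1 / t\<^sup>2" using t by simp
  have pw: "sqrt t ^ 2 = t" "sqrt t ^ 4 = t\<^sup>2"
  proof -
    show *: "sqrt t ^ 2 = t" using t by simp
    have "sqrt t ^ 4 = (sqrt t ^ 2)\<^sup>2" by (simp flip: power_mult)
    with * show "sqrt t ^ 4 = t\<^sup>2" by simp
  qed
  have norm4: "norm v ^ 4 = (v \<bullet> v)\<^sup>2" for v :: "real ^ 'n"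
  proof -
    have "norm v ^ 4 = (norm v ^ 2)\<^sup>2" by (simp flip: power_mult)
    then show ?thesis by (simp add: power2_norm_eq_inner)
  qed
  show ?thesis
  proof (rule that[of "?s ` H0"])
    show "finite (?s ` H0)" using fin by simp
    have "real (card D) = 2 * real (card H0)" using sumD[of "\<lambda>_. 1"] by simp
    then have "card D = 2 * card H0" by linarith
    then show "2 * card (?s ` H0) = CARD('n) * (CARD('n) + 1)"
      using tight by (simp add: card_image[OF inj] tight_spherical_5_design_def)
    show "x \<bullet> x = t" if "x \<in> ?s ` H0" for x
    proof -
      from that obtain y where "y \<in> H0" "x = ?s y" by blast
      then show ?thesis using basic(7)[of y] H0(1) t by (auto simp: dot_square_norm)
    qed
    show "x \<bullet> y = 1 \<or> x \<bullet> y = - 1" if "x \<in> ?s ` H0" "y \<in> ?s ` H0" "x \<noteq> y" for x y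
    proof -
      from that obtain u v where uv: "u \<in> H0" "v \<in> H0" "x = ?s u" "y = ?s v" "u \<noteq> v" by blast
      have uvD: "u \<in> D" "v \<in> D" using uv H0(1) by auto
      \<comment> \<open>The value - 1 would make the points antipodal, and \<open>H0\<close>
        contains no antipodal pair.\<close>
      have "u \<bullet> v \<noteq> - 1"
      proof
        assume "u \<bullet> v = - 1"
        moreover have "(u + v) \<bullet> (u + v) = u \<bullet> u + 2 * (u \<bullet> v) + v \<bullet> v"
          by (simp add: inner_add inner_commute)
        ultimately have "(u + v) \<bullet> (u + v) = 0"
          using basic(7)[OF uvD(1)] basic(7)[OF uvD(2)] by (simp add: dot_square_norm)
        then have "u = - v" by (simp add: eq_neg_iff_add_eq_0)
        with uv H0(2) show False by auto
      qed
      with tight_design_inner[OF tight uvD(2,1)] uv(5) have "(u \<bullet> v)\<^sup>2 = 1 / t\<^sup>2" using c by auto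
      moreover have "(x \<bullet> y)\<^sup>2 = t\<^sup>2 * (u \<bullet> v)\<^sup>2"
        using uv t by (simp add: power_mult_distrib flip: power2_eq_square)
      ultimately have "(x \<bullet> y)\<^sup>2 = 1" using t by simp
      then show ?thesis by (simp add: power2_eq_1_iff)
    qed
    show "(\<Sum>x\<in>?s ` H0. (x \<bullet> v)\<^sup>2) = (t\<^sup>2 - 1) * t / 2 * (v \<bullet> v)" for v
    proof -
      have "(\<Sum>x\<in>?s ` H0. (x \<bullet> v)\<^sup>2) = t * (\<Sum>x\<in>H0. (x \<bullet> v)\<^sup>2)"
        by (simp add: sum.reindex[OF inj] power_mult_distrib pw sum_distrib_left)
      also have "2 * \<dots> = t * (\<Sum>x\<in>D. (x \<bullet> v)\<^sup>2)"
        by (subst sumD) auto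
      also have "\<dots> = t * (t\<^sup>2 - 1) * (v \<bullet> v)"
        unfolding tight_design_power_sums(1)[OF tight] t(2)[symmetric] by (simp add: power2_norm_eq_inner)
      finally show ?thesis by (simp add: field_simps)
    qed
    show "(\<Sum>x\<in>?s ` H0. (x \<bullet> v) ^ 4) = 3 * (t\<^sup>2 - 1) / 2 * (v \<bullet> v)\<^sup>2" for v
    proof -
      have "(\<Sum>x\<in>?s ` H0. (x \<bullet> v) ^ 4) = t\<^sup>2 * (\<Sum>x\<in>H0. (x \<bullet> v) ^ 4)"
        by (simp add: sum.reindex[OF inj] power_mult_distrib pw sum_distrib_left)
      also have "2 * \<dots> = t\<^sup>2 * (\<Sum>x\<in>D. (x \<bullet> v) ^ 4)"
        by (subst sumD) auto
      also have "\<dots> = 3 * (real CARD('n) + 1) * (v \<bullet> v)\<^sup>2"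
        unfolding tight_design_power_sums(2)[OF tight] norm4 c using t by simp
      also have "real CARD('n) + 1 = t\<^sup>2 - 1" using t by simp
      finally show ?thesis by (simp add: field_simps)
    qed
  qed
qed

section \<open>Localizations of the integers and lattices\<close>

text \<open>The localization of the integers at p, placed inside the reals because it is applied to
  inner products. Fractions need not be reduced.\<close>

definition p_integral :: "int \<Rightarrow> real set" where
  "p_integral p = {of_int a / of_int b | a b. \<not> p dvd b}"

lemma p_integralI: "\<not> p dvd b \<Longrightarrow> r = of_int a / of_int b \<Longrightarrow> r \<in> p_integral p"
  unfolding p_integral_def by blast

lemma p_integralE:
  assumes "r \<in> p_integral p"
  obtains a b where "\<not> p dvd b" "b \<noteq> 0" "r * of_int b = of_int a"
proof -
  from assms obtain a b where *: "r = of_int a / of_int b" "\<not> p dvd b"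
    unfolding p_integral_def by blast
  then have "b \<noteq> 0" by auto
  with * show thesis by (intro that[of b a]) auto
qed

lemma p_integral_Rats: "r \<in> p_integral p \<Longrightarrow> r \<in> \<rat>"
  unfolding p_integral_def by auto

locale prime_int =
  fixes p :: int
  assumes prime: "prime p"
begin

lemma p_integral_of_int [simp]: "of_int a \<in> p_integral p"
  using prime not_prime_unit by (intro p_integralI[of p 1 _ a]) auto

lemma p_integral_0 [simp]: "0 \<in> p_integral p" and p_integral_1 [simp]: "1 \<in> p_integral p"
  using p_integral_of_int[of 0] p_integral_of_int[of 1] by simp_all

lemma p_integral_Ints: "r \<in> \<int> \<Longrightarrow> r \<in> p_integral p"
  by (elim Ints_cases) simp

lemma p_integral_add: "r \<in> p_integral p \<Longrightarrow> s \<in> p_integral p \<Longrightarrow> r + s \<in> p_integral p"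
proof -
  assume "r \<in> p_integral p" "s \<in> p_integral p"
  then obtain a b c d where *: "\<not> p dvd b" "b \<noteq> 0" "r * of_int b = of_int a"
    "\<not> p dvd d" "d \<noteq> 0" "s * of_int d = of_int c"
    by (metis p_integralE)
  then have "\<not> p dvd b * d" using prime prime_dvd_mult_iff by blast
  moreover have "r + s = of_int (a * d + c * b) / of_int (b * d)"
    using * by (simp add: field_simps flip: *(3) *(6))
  ultimately show ?thesis by (rule p_integralI)
qed

lemma p_integral_mult: "r \<in> p_integral p \<Longrightarrow> s \<in> p_integral p \<Longrightarrow> r * s \<in> p_integral p"
proof -
  assume "r \<in> p_integral p" "s \<in> p_integral p"
  then obtain a b c d where *: "\<not> p dvd b" "b \<noteq> 0" "r * of_int b = of_int a"
    "\<not> p dvd d" "d \<noteq> 0" "s * of_int d = of_int c"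
    by (metis p_integralE)
  then have "\<not> p dvd b * d" using prime prime_dvd_mult_iff by blast
  moreover have "r * s = of_int (a * c) / of_int (b * d)"
    using * by (simp add: field_simps flip: *(3) *(6))
  ultimately show ?thesis by (rule p_integralI)
qed

lemma p_integral_uminus: "r \<in> p_integral p \<Longrightarrow> - r \<in> p_integral p"
  using p_integral_mult[of "of_int (- 1)" r] p_integral_of_int[of "- 1"] by simp

lemma p_integral_diff: "r \<in> p_integral p \<Longrightarrow> s \<in> p_integral p \<Longrightarrow> r - s \<in> p_integral p"
  using p_integral_add[OF _ p_integral_uminus, of r s] by simp

lemma p_integral_power: "r \<in> p_integral p \<Longrightarrow> r ^ k \<in> p_integral p"
  by (induction k) (auto intro: p_integral_mult)

lemma p_integral_sum: "(\<And>i. i \<in> S \<Longrightarrow> f i \<in> p_integral p) \<Longrightarrow> sum f S \<in> p_integral p"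
  by (induction S rule: infinite_finite_induct) (auto intro: p_integral_add)

lemmas p_integral_intros = p_integral_0 p_integral_1 p_integral_of_int p_integral_add
  p_integral_mult p_integral_uminus p_integral_diff p_integral_power p_integral_sum

text \<open>Valuation ring: in lowest terms \<open>p\<close> divides at most one of numerator and
  denominator.\<close>

lemma p_integral_or_inverse:
  assumes "r \<in> \<rat>" shows "r \<in> p_integral p \<or> inverse r \<in> p_integral p"
proof -
  obtain a b where ab: "r = of_int a / of_int b" "coprime a b" "b > 0"
    using Rats_cases'[OF assms] by metis
  show ?thesis
  proof (cases "p dvd b")
    case True
    then have "\<not> p dvd a"
      using ab(2) prime by (meson coprime_common_divisor not_prime_unit)
    moreover have "inverse r = of_int b / of_int a" using ab by simp
    ultimately show ?thesis by (blast intro: p_integralI)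
  next
    case False
    with ab show ?thesis by (blast intro: p_integralI)
  qed
qed

text \<open>The way back from the localization to divisibility between integers.\<close>

lemma dvd_if_p_integral:
  assumes "of_int k / of_int (p ^ j) \<in> p_integral p" shows "p ^ j dvd k"
proof -
  from assms obtain a b where *: "\<not> p dvd b" "of_int k / of_int (p ^ j) * of_int b = (of_int a :: real)"
    by (metis p_integralE)
  have "p \<noteq> 0" using prime by auto
  then have "of_int k * of_int b = (of_int a * of_int (p ^ j) :: real)"
    using * by (simp add: field_simps)
  then have "k * b = a * p ^ j" by (metis of_int_eq_iff of_int_mult)
  then have "p ^ j dvd k * b" by simp
  moreover have "coprime (p ^ j) b"
    using * prime by (simp add: prime_imp_coprime)
  ultimately show ?thesis using coprime_dvd_mult_left_iff by blast
qed

text \<open>The localization is a local ring; that \<open>r / p\<close> is not integral says that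
  \<open>r\<close> lies outside the maximal ideal.\<close>

lemma p_integral_unit:
  assumes "r \<in> p_integral p" "r / of_int p \<notin> p_integral p" shows "inverse r \<in> p_integral p"
proof -
  from assms(1) obtain a b where ab: "\<not> p dvd b" "b \<noteq> 0" "r * of_int b = of_int a"
    by (metis p_integralE)
  have "\<not> p dvd a"
  proof
    assume "p dvd a"
    then obtain c where "a = p * c" by blast
    then have "r / of_int p = of_int c / of_int b"
      using ab prime by (simp add: field_simps)
    with ab assms(2) show False by (blast intro: p_integralI)
  qed
  moreover have "inverse r = of_int b / of_int a"
    by (metis ab(2,3) inverse_divide nonzero_mult_div_cancel_right of_int_eq_0_iff)
  ultimately show ?thesis by (rule p_integralI)
qed

lemma not_p_integral_inverse: "inverse (of_int p) \<notin> p_integral p"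
proof
  assume "inverse (of_int p) \<in> p_integral p"
  then have "p dvd 1" using dvd_if_p_integral[of 1 1] by (simp add: inverse_eq_divide)
  then show False using prime not_prime_unit by blast
qed

text \<open>Used to turn coordinates from the localization into integers at the cost of a
  unit.\<close>

lemma p_integral_common_denominator:
  assumes "finite A" "A \<subseteq> p_integral p"
  shows "\<exists>N. \<not> p dvd N \<and> (\<forall>r\<in>A. of_int N * r \<in> \<int>)"
  using assms
proof (induction A rule: finite_induct)
  case empty
  show ?case using prime not_prime_unit by (intro exI[of _ 1]) auto
next
  case (insert r A)
  then obtain N where N: "\<not> p dvd N" "\<forall>r\<in>A. of_int N * r \<in> \<int>" by auto
  obtain a b where ab: "\<not> p dvd b" "r * of_int b = of_int a"
    using insert.prems by (metis p_integralE insertI1 subsetD)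
  show ?case
  proof (intro exI[of _ "N * b"] conjI ballI)
    show "\<not> p dvd N * b" using N ab prime prime_dvd_mult_iff by blast
    fix s assume "s \<in> insert r A"
    then consider "s = r" | "s \<in> A" by blast
    then show "of_int (N * b) * s \<in> \<int>"
    proof cases
      case 1
      have "of_int (N * b) * s = of_int N * (r * of_int b)" using 1 by simp
      then have "of_int (N * b) * s = of_int (N * a)" unfolding ab(2) by simp
      then show ?thesis by (metis Ints_of_int)
    next
      case 2
      then have "of_int b * (of_int N * s) \<in> \<int>" using N by simp
      then show ?thesis by (simp add: mult_ac)
    qed
  qed
qed

text \<open>The submodule generated by \<open>S\<close> over the localization, grown by one multiple
  of a generator at a time so that properties of lattice vectors follow by induction.\<close>

inductive_set lspan :: "'a::real_inner set \<Rightarrow> 'a set" for S where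
  lspan_zero [simp]: "0 \<in> lspan S"
| lspan_step: "y \<in> lspan S \<Longrightarrow> x \<in> S \<Longrightarrow> c \<in> p_integral p \<Longrightarrow> y + c *\<^sub>R x \<in> lspan S"

lemma lspan_base: "x \<in> S \<Longrightarrow> x \<in> lspan S"
  using lspan_step[OF lspan_zero, of x S 1] by simp

lemma lspan_add: "y \<in> lspan S \<Longrightarrow> x \<in> lspan S \<Longrightarrow> x + y \<in> lspan S"
  by (induction y rule: lspan.induct) (auto simp: add.assoc[symmetric] intro: lspan_step)

lemma lspan_scale:
  assumes "y \<in> lspan S" "c \<in> p_integral p" shows "c *\<^sub>R y \<in> lspan S"
  using assms(1) by induction (auto simp: scaleR_add_right intro!: lspan_step p_integral_mult assms(2))

lemma lspan_diff: "y \<in> lspan S \<Longrightarrow> x \<in> lspan S \<Longrightarrow> x - y \<in> lspan S"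
  using lspan_add[OF lspan_scale, of y S "- 1" x] p_integral_of_int[of "- 1"] by simp

lemma lspan_mono:
  assumes "y \<in> lspan S" "S \<subseteq> lspan T" shows "y \<in> lspan T"
  using assms(1)
proof induction
  case (lspan_step y x c)
  then show ?case using lspan_add[OF lspan_scale] assms(2) by (metis subsetD)
qed simp

text \<open>With \<open>c\<close> a pivot, divisibility by the pivot passes from the generators to
  the whole lattice.\<close>

lemma lspan_inner:
  assumes "y \<in> lspan S" "\<And>x. x \<in> S \<Longrightarrow> (x \<bullet> v) / c \<in> p_integral p"
  shows "(y \<bullet> v) / c \<in> p_integral p"
  using assms(1)
proof induction
  case (lspan_step y x d)
  have "((y + d *\<^sub>R x) \<bullet> v) / c = (y \<bullet> v) / c + d * ((x \<bullet> v) / c)"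
    by (simp add: inner_add add_divide_distrib)
  then show ?case
    using p_integral_add[OF lspan_step.IH p_integral_mult[OF lspan_step.hyps(3) assms(2)[OF lspan_step.hyps(2)]]]
    by simp
qed simp

lemma lspan_inner_integral:
  assumes "y \<in> lspan S" "z \<in> lspan T" "\<And>x x'. x \<in> S \<Longrightarrow> x' \<in> T \<Longrightarrow> x \<bullet> x' \<in> p_integral p"
  shows "y \<bullet> z \<in> p_integral p"
proof -
  have "z \<bullet> x \<in> p_integral p" if "x \<in> S" for x
    using lspan_inner[OF assms(2), of x 1] assms(3)[OF that] by (simp add: inner_commute)
  then show ?thesis
    using lspan_inner[OF assms(1), of z 1] by (simp add: inner_commute)
qed

end

text \<open>The constants come from t = 2 m + 1 and M = m (m + 1): as t^2 = 4 M + 1, one has n = t^2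
  - 2 = 4 M - 1, n (n + 1) / 2 = 2 M (4 M - 1), (t^2 - 1) t / 2 = 2 M t and 3 (t^2 - 1) / 2 = 6
  M.\<close>

locale tight_equiangular_lines =
  fixes H :: "(real ^ 'n::finite) set" and m :: int
  assumes finite_H: "finite H"
    and m_pos: "m > 0"
    and dimension: "int CARD('n) = 4 * (m * (m + 1)) - 1"
    and card_H: "int (card H) = 2 * (m * (m + 1)) * (4 * (m * (m + 1)) - 1)"
    and norm_H: "x \<in> H \<Longrightarrow> x \<bullet> x = of_int (2 * m + 1)"
    and inner_H: "x \<in> H \<Longrightarrow> y \<in> H \<Longrightarrow> x \<noteq> y \<Longrightarrow> x \<bullet> y = 1 \<or> x \<bullet> y = - 1"
    and sum_power2: "(\<Sum>x\<in>H. (x \<bullet> v)\<^sup>2) = of_int (2 * (m * (m + 1)) * (2 * m + 1)) * (v \<bullet> v)"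
    and sum_power4: "(\<Sum>x\<in>H. (x \<bullet> v) ^ 4) = of_int (6 * (m * (m + 1))) * (v \<bullet> v)\<^sup>2"
begin

definition t :: int where "t = 2 * m + 1"
definition M :: int where "M = m * (m + 1)"

lemma t_square: "t\<^sup>2 = 4 * M + 1" by (simp add: t_def M_def power2_eq_square algebra_simps)
lemma t_pos: "t > 0" and M_pos: "M > 0" using m_pos by (auto simp: t_def M_def)

lemmas t_M_defs = t_def[symmetric] M_def[symmetric]

lemma sum_inner2: "(\<Sum>x\<in>H. (x \<bullet> u) * (x \<bullet> v)) = 2 * of_int M * of_int t * (u \<bullet> v)"
proof -
  have "4 * (\<Sum>x\<in>H. (x \<bullet> u) * (x \<bullet> v)) = (\<Sum>x\<in>H. (x \<bullet> (u + v))\<^sup>2) - (\<Sum>x\<in>H. (x \<bullet> (u - v))\<^sup>2)"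
    unfolding sum_distrib_left sum_subtractf[symmetric]
    by (intro sum.cong refl) (simp add: inner_add_right inner_diff_right, algebra)
  also have "\<dots> = 4 * (2 * of_int M * of_int t * (u \<bullet> v))"
    unfolding sum_power2 t_M_defs
    by (simp add: inner_add inner_diff inner_commute[of v u] algebra_simps)
  finally show ?thesis by simp
qed

text \<open>Polarization: the fourth powers of u +- v +- w +- z, weighted by the product of the
  three signs, leave only the monomial u v w z, with coefficient 4! from each of 8 terms, hence
  192.\<close>

lemma sum_inner4:
  "(\<Sum>x\<in>H. (x \<bullet> u) * (x \<bullet> v) * (x \<bullet> w) * (x \<bullet> z)) =
     2 * of_int M * ((u \<bullet> v) * (w \<bullet> z) + (u \<bullet> w) * (v \<bullet> z) + (u \<bullet> z) * (v \<bullet> w))"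
proof -
  define F where "F v = (\<Sum>x\<in>H. (x \<bullet> v) ^ 4)" for v
  have F: "F v = 6 * of_int M * (v \<bullet> v)\<^sup>2" for v
    by (simp add: F_def sum_power4 t_M_defs)
  have "192 * (\<Sum>x\<in>H. (x \<bullet> u) * (x \<bullet> v) * (x \<bullet> w) * (x \<bullet> z)) =
      F (u + v + w + z) - F (u - v + w + z) - F (u + v - w + z) - F (u + v + w - z)
      + F (u - v - w + z) + F (u - v + w - z) + F (u + v - w - z) - F (u - v - w - z)"
    unfolding F_def sum_distrib_left sum_subtractf[symmetric] sum.distrib[symmetric]
    by (intro sum.cong refl) (simp add: inner_add_right inner_diff_right, algebra)
  also have "\<dots> = 192 * (2 * of_int M * ((u \<bullet> v) * (w \<bullet> z) + (u \<bullet> w) * (v \<bullet> z) + (u \<bullet> z) * (v \<bullet> w)))"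
    unfolding F inner_add_left inner_diff_left inner_add_right inner_diff_right
      inner_commute[of v u] inner_commute[of w u] inner_commute[of z u]
      inner_commute[of w v] inner_commute[of z v] inner_commute[of z w]
    by algebra
  finally show ?thesis by simp
qed

lemma H_total: "(\<And>x. x \<in> H \<Longrightarrow> x \<bullet> v = 0) \<Longrightarrow> v = 0"
  using sum_inner2[of v v] M_pos t_pos by simp

lemma inner_H_Ints: "x \<in> H \<Longrightarrow> y \<in> H \<Longrightarrow> x \<bullet> y \<in> \<int>"
  using norm_H[of x] inner_H[of x y] by (cases "x = y") auto

text \<open>The second moment expresses \<open>u \<bullet> v\<close> through inner products with the
  lines. This is what links bases built at different primes.\<close>

lemma inner_Rats:
  assumes "\<And>x. x \<in> H \<Longrightarrow> x \<bullet> u \<in> \<rat>" "\<And>x. x \<in> H \<Longrightarrow> x \<bullet> v \<in> \<rat>"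
  shows "u \<bullet> v \<in> \<rat>"
proof -
  have "u \<bullet> v = (\<Sum>x\<in>H. (x \<bullet> u) * (x \<bullet> v)) / (2 * of_int M * of_int t)"
    using M_pos t_pos by (simp add: sum_inner2)
  also have "\<dots> \<in> \<rat>"
    using assms finite_H by (intro Rats_divide Rats_mult Rats_sum) auto
  finally show ?thesis .
qed

lemma H_nonempty: "H \<noteq> {}"
proof
  assume "H = {}"
  then have "2 * (m * (m + 1)) * (4 * (m * (m + 1)) - 1) = 0" using card_H by simp
  moreover have "m * (m + 1) > 0" using m_pos by simp
  ultimately show False by auto
qed

end

section \<open>Orthogonal bases at odd primes\<close>

lemma det_gram:
  fixes b b' :: "'n::finite \<Rightarrow> real ^ 'n"
  shows "det (\<chi> i j. b i \<bullet> b' j) = det (\<chi> i. b i) * det (\<chi> i. b' i)"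
proof -
  have "(\<chi> i j. b i \<bullet> b' j) = (\<chi> i. b i) ** transpose (\<chi> i. b' i)"
    by (simp add: vec_eq_iff matrix_matrix_mult_def transpose_def inner_vec_def)
  then show ?thesis by (simp add: det_mul)
qed

lemma det_Rats:
  fixes A :: "real ^ 'n ^ 'n::finite"
  assumes "\<And>i j. A $ i $ j \<in> \<rat>" shows "det A \<in> \<rat>"
  unfolding det_def using assms by (intro Rats_sum Rats_mult Rats_prod) auto

text \<open>For an orthogonal family the product of the norms is the square of a determinant. Both
  products together give the square of the determinant of the mutual inner products, which is
  rational.\<close>

lemma orthogonal_bases_square_class:
  fixes b b' :: "'n::finite \<Rightarrow> real ^ 'n"
  assumes "\<And>i j. i \<noteq> j \<Longrightarrow> b i \<bullet> b j = 0" "\<And>i j. i \<noteq> j \<Longrightarrow> b' i \<bullet> b' j = 0"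
    and "\<And>i j. b i \<bullet> b' j \<in> \<rat>"
  obtains q where "q \<in> \<rat>" "(\<Prod>i\<in>UNIV. b i \<bullet> b i) * (\<Prod>i\<in>UNIV. b' i \<bullet> b' i) = q\<^sup>2"
proof
  show "det (\<chi> i j. b i \<bullet> b' j) \<in> \<rat>" using assms(3) by (intro det_Rats) simp
  have *: "(\<Prod>i\<in>UNIV. c i \<bullet> c i) = (det (\<chi> i. c i))\<^sup>2"
    if "\<And>i j. i \<noteq> j \<Longrightarrow> c i \<bullet> c j = 0" for c :: "'n \<Rightarrow> real ^ 'n"
    using det_diagonal[of "\<chi> i j. c i \<bullet> c j"] that by (simp add: det_gram power2_eq_square)
  show "(\<Prod>i\<in>UNIV. b i \<bullet> b i) * (\<Prod>i\<in>UNIV. b' i \<bullet> b' i) = (det (\<chi> i j. b i \<bullet> b' j))\<^sup>2"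
    using *[of b] *[of b'] assms(1,2) by (simp add: det_gram power_mult_distrib)
qed

context prime_int
begin

text \<open>Divisibility in a valuation ring is total, so a finite set has an element that divides
  all others.\<close>

lemma ex_p_minimal:
  assumes "finite A" "A \<noteq> {}" "A \<subseteq> \<rat>" "0 \<notin> A"
  shows "\<exists>a\<in>A. \<forall>b\<in>A. b / a \<in> p_integral p"
  using assms
proof (induction A rule: finite_ne_induct)
  case (singleton x)
  then show ?case by auto
next
  case (insert x A)
  then obtain a where a: "a \<in> A" "\<forall>b\<in>A. b / a \<in> p_integral p" by auto
  have "x / a \<in> \<rat>" using a insert.prems by (intro Rats_divide) auto
  then consider "x / a \<in> p_integral p" | "a / x \<in> p_integral p"
    using p_integral_or_inverse by (metis inverse_divide)
  then show ?case
  proof cases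
    case 1 with a show ?thesis by auto
  next
    case 2
    have "b / x \<in> p_integral p" if "b \<in> A" for b
    proof -
      have "a \<noteq> 0" using a insert.prems by auto
      then have "b / x = (b / a) * (a / x)" by simp
      then show ?thesis using 2 a that by (metis p_integral_mult)
    qed
    moreover have "x / x \<in> p_integral p" by (cases "x = 0") auto
    ultimately show ?thesis by auto
  qed
qed

end

section \<open>Splitting off orthogonal summands at a prime\<close>

locale tight_lines_prime = tight_equiangular_lines H m + prime_int p
  for H :: "(real ^ 'n::finite) set" and m p :: int
begin

text \<open>\<open>B\<close> collects what has been split off; \<open>R\<close> generates the rest,
  the image of the lattice under projection away from \<open>B\<close>. \<open>R\<close> must stay
  in the lattice, whereas \<open>B\<close> only has rational inner products with \<open>H\<close>:
  the second vector of a block in \<open>even_pivot\<close> can lie outside the lattice.\<close>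

definition splitting :: "(real ^ 'n) set \<Rightarrow> (real ^ 'n) set \<Rightarrow> bool" where
  "splitting B R \<longleftrightarrow> finite B \<and> 0 \<notin> B \<and> pairwise orthogonal B \<and>
     finite R \<and> R \<subseteq> lspan H \<and> (\<forall>r\<in>R. \<forall>b\<in>B. r \<bullet> b = 0) \<and>
     (\<forall>x\<in>H. \<exists>r\<in>lspan R. x - r \<in> span B) \<and> (\<forall>b\<in>B. \<forall>x\<in>H. x \<bullet> b \<in> \<rat>)"

lemma lspan_H_inner: "y \<in> lspan H \<Longrightarrow> z \<in> lspan H \<Longrightarrow> y \<bullet> z \<in> p_integral p"
  using lspan_inner_integral inner_H_Ints p_integral_Ints by blast

lemma lspan_H_inner_Rats: "y \<in> lspan H \<Longrightarrow> z \<in> lspan H \<Longrightarrow> y \<bullet> z \<in> \<rat>"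
  using lspan_H_inner p_integral_Rats by blast

lemma splitting_initial: "splitting {} H"
  using finite_H by (auto simp: splitting_def pairwise_def intro: lspan_base bexI[of _ "_ :: real ^ 'n"])

lemma splitting_card:
  assumes "splitting B R" shows "card B \<le> CARD('n)"
  using assms pairwise_orthogonal_independent[of B] independent_bound[of B]
  by (auto simp: splitting_def)

text \<open>A vector orthogonal to \<open>B\<close> does not distinguish a line from its projection,
  so divisibility need only be checked on \<open>R\<close>.\<close>

lemma splitting_inner:
  assumes "splitting B R" "x \<in> H" "\<And>b. b \<in> B \<Longrightarrow> b \<bullet> v = 0"
    and "\<And>r. r \<in> R \<Longrightarrow> (r \<bullet> v) / c \<in> p_integral p"
  shows "(x \<bullet> v) / c \<in> p_integral p"
proof -
  from assms obtain r where r: "r \<in> lspan R" "x - r \<in> span B"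
    by (auto simp: splitting_def)
  have "(x - r) \<bullet> v = 0"
    using r(2) assms(3) by (induction rule: span_induct_alt) (auto simp: inner_add)
  then have "x \<bullet> v = r \<bullet> v" by (simp add: inner_diff)
  with lspan_inner[OF r(1), of v c] assms(4) show ?thesis by simp
qed

text \<open>\<open>f\<close> projects \<open>R\<close> away from \<open>P\<close>. That
  \<open>f r\<close> stays in the lattice is the integrality condition; the coefficients along
  \<open>P\<close> may be arbitrary reals.\<close>

lemma splitting_step:
  assumes s: "splitting B R" and P: "finite P" "0 \<notin> P" "pairwise orthogonal P"
    and PB: "\<And>u b. u \<in> P \<Longrightarrow> b \<in> B \<Longrightarrow> u \<bullet> b = 0" and PQ: "\<And>u x. u \<in> P \<Longrightarrow> x \<in> H \<Longrightarrow> x \<bullet> u \<in> \<rat>"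
    and f: "\<And>r. r \<in> R \<Longrightarrow> f r \<in> lspan H" "\<And>r. r \<in> R \<Longrightarrow> r - f r \<in> span P"
      "\<And>r u. r \<in> R \<Longrightarrow> u \<in> P \<Longrightarrow> f r \<bullet> u = 0"
  shows "splitting (B \<union> P) (f ` R)" "card (B \<union> P) = card B + card P"
proof -
  have span_P_B: "w \<bullet> b = 0" if "w \<in> span P" "b \<in> B" for w b
    using that by (induction rule: span_induct_alt) (auto simp: inner_add PB)
  have fB: "f r \<bullet> b = 0" if "r \<in> R" "b \<in> B" for r b
    using span_P_B[OF f(2)[OF that(1)] that(2)] s that by (auto simp: splitting_def inner_diff)
  have lsp: "\<exists>r'\<in>lspan (f ` R). r - r' \<in> span P" if "r \<in> lspan R" for r
    using that
  proof induction
    case lspan_zero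
    show ?case by (intro bexI[of _ 0]) (auto simp: span_zero)
  next
    case (lspan_step y x c)
    then obtain y' where y': "y' \<in> lspan (f ` R)" "y - y' \<in> span P" by blast
    show ?case
    proof (intro bexI)
      show "y' + c *\<^sub>R f x \<in> lspan (f ` R)"
        using y' lspan_step by (intro lspan.lspan_step) auto
      have "(y - y') + c *\<^sub>R (x - f x) \<in> span P"
        using y' lspan_step f(2) by (intro span_add span_scale) auto
      then show "y + c *\<^sub>R x - (y' + c *\<^sub>R f x) \<in> span P"
        by (simp add: algebra_simps)
    qed
  qed
  have gen: "\<exists>r\<in>lspan (f ` R). x - r \<in> span (B \<union> P)" if x: "x \<in> H" for x
  proof -
    from s x obtain r where r: "r \<in> lspan R" "x - r \<in> span B" by (auto simp: splitting_def)
    from lsp[OF r(1)] obtain r' where r': "r' \<in> lspan (f ` R)" "r - r' \<in> span P" by blast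
    have "(x - r) + (r - r') \<in> span (B \<union> P)"
      using r r' span_mono[of B "B \<union> P"] span_mono[of P "B \<union> P"] by (intro span_add) auto
    with r' show ?thesis by auto
  qed
  show "splitting (B \<union> P) (f ` R)"
  proof -
    have "pairwise orthogonal (B \<union> P)"
      using s P(3) PB unfolding splitting_def pairwise_def orthogonal_def
      by (metis Un_iff inner_commute)
    moreover have "finite (f ` R)" "f ` R \<subseteq> lspan H" "finite (B \<union> P)" "0 \<notin> B \<union> P"
      using s P f(1) by (auto simp: splitting_def)
    moreover have "\<forall>r\<in>f ` R. \<forall>b\<in>B \<union> P. r \<bullet> b = 0" using fB f(3) by blast
    moreover have "\<forall>b\<in>B \<union> P. \<forall>x\<in>H. x \<bullet> b \<in> \<rat>" using s PQ unfolding splitting_def by blast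
    ultimately show ?thesis using gen unfolding splitting_def by blast
  qed
  have "B \<inter> P = {}"
  proof (rule ccontr)
    assume "B \<inter> P \<noteq> {}"
    then obtain u where "u \<in> B" "u \<in> P" by blast
    with PB[of u u] P(2) show False by auto
  qed
  then show "card (B \<union> P) = card B + card P"
    using s P by (intro card_Un_disjoint) (auto simp: splitting_def)
qed

text \<open>If nothing remains, every line lies in the span of \<open>B\<close>, and no nonzero
  vector is orthogonal to all lines.\<close>

lemma splitting_complete:
  assumes s: "splitting B R" and R: "R \<subseteq> {0}" shows "card B = CARD('n)"
proof (rule ccontr)
  assume "card B \<noteq> CARD('n)"
  with splitting_card[OF s] have "card B < CARD('n)" by simp
  then have "dim B < DIM(real ^ 'n)"
    using dim_le_card[of B B] s by (auto simp: splitting_def span_superset)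
  then obtain v where v: "v \<noteq> 0" "\<And>w. w \<in> span B \<Longrightarrow> orthogonal v w"
    using orthogonal_to_subspace_exists by blast
  have "r = 0" if "r \<in> lspan R" for r
    using that R by induction auto
  then have "x \<in> span B" if "x \<in> H" for x
    using s that unfolding splitting_def by (metis diff_zero)
  then have "x \<bullet> v = 0" if "x \<in> H" for x
    using v(2) that unfolding orthogonal_def by (metis inner_commute)
  then show False using H_total v(1) by blast
qed

text \<open>Orthogonal projection to \<open>b\<close> has coefficients integral at \<open>p\<close>,
  so \<open>b\<close> generates a rank one orthogonal summand of the lattice.\<close>

definition p_split :: "real ^ 'n \<Rightarrow> bool" where
  "p_split b \<longleftrightarrow> b \<in> lspan H \<and> (\<forall>x\<in>H. (x \<bullet> b) / (b \<bullet> b) \<in> p_integral p)"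

text \<open>Let \<open>a = l \<bullet> k\<close> divide all inner products of \<open>R\<close>. If
  neither \<open>l\<close> nor \<open>k\<close> has norm \<open>a\<close> up to a unit, then
  \<open>l + k\<close> does: modulo \<open>p * a\<close> its norm is 2 a, and 2 is a unit at an odd
  prime.\<close>

lemma odd_pivot:
  assumes "p \<noteq> 2" and s: "splitting B R" and R: "\<not> R \<subseteq> {0}"
  obtains b where "b \<in> lspan R" "b \<noteq> 0" "\<And>r. r \<in> R \<Longrightarrow> (r \<bullet> b) / (b \<bullet> b) \<in> p_integral p"
proof -
  note pivot = that
  have RH: "R \<subseteq> lspan H" and fR: "finite R" using s by (auto simp: splitting_def)
  define A where "A = {r \<bullet> r' | r r'. r \<in> R \<and> r' \<in> R} - {0}"
  have "A = (\<lambda>(r, r'). r \<bullet> r') ` (R \<times> R) - {0}" by (auto simp: A_def)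
  then have "finite A" using fR by simp
  moreover from R obtain r where "r \<in> R" "r \<noteq> 0" by auto
  then have "r \<bullet> r \<in> A" by (auto simp: A_def)
  then have "A \<noteq> {}" by blast
  moreover have "A \<subseteq> \<rat>" using RH lspan_H_inner_Rats by (auto simp: A_def)
  ultimately obtain a where a: "a \<in> A" "\<forall>b\<in>A. b / a \<in> p_integral p"
    using ex_p_minimal[of A] by (auto simp: A_def)
  then obtain l k where lk: "l \<in> R" "k \<in> R" "a = l \<bullet> k" "a \<noteq> 0" by (auto simp: A_def)
  have min: "(r \<bullet> r') / a \<in> p_integral p" if "r \<in> R" "r' \<in> R" for r r'
    using a(2) that by (cases "r \<bullet> r' = 0") (auto simp: A_def)
  have *: thesis if b: "b \<in> lspan R" "(b \<bullet> b) / a / of_int p \<notin> p_integral p" for b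
  proof (rule pivot)
    show "b \<in> lspan R" by fact
    have rb: "(r \<bullet> b) / a \<in> p_integral p" if "r \<in> R" for r
      using lspan_inner[OF b(1), of r a] min that by (auto simp: inner_commute)
    then have "(b \<bullet> b) / a \<in> p_integral p"
      using lspan_inner[OF b(1), of b a] by auto
    from p_integral_unit[OF this b(2)] have inv: "a / (b \<bullet> b) \<in> p_integral p"
      by simp
    show "b \<noteq> 0" using b(2) by auto
    show "(r \<bullet> b) / (b \<bullet> b) \<in> p_integral p" if "r \<in> R" for r
      using p_integral_mult[OF rb[OF that] inv] lk(4) by simp
  qed
  show thesis
  proof (cases "(l \<bullet> l) / a / of_int p \<in> p_integral p \<and> (k \<bullet> k) / a / of_int p \<in> p_integral p")
    case False
    then show ?thesis using * lspan_base lk by blast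
  next
    case True
    have "((l + k) \<bullet> (l + k)) / a / of_int p \<notin> p_integral p"
    proof
      assume "((l + k) \<bullet> (l + k)) / a / of_int p \<in> p_integral p"
      then have "((l + k) \<bullet> (l + k)) / a / of_int p - (l \<bullet> l) / a / of_int p - (k \<bullet> k) / a / of_int p
          \<in> p_integral p"
        using True by (intro p_integral_diff) auto
      also have "((l + k) \<bullet> (l + k)) / a / of_int p - (l \<bullet> l) / a / of_int p - (k \<bullet> k) / a / of_int p
          = of_int 2 / of_int (p ^ 1)"
        using lk prime by (simp add: inner_add inner_commute[of k l] field_simps)
      finally have "p ^ 1 dvd 2" by (rule dvd_if_p_integral)
      then have "p = 2"
        using prime by (simp add: primes_dvd_imp_eq)
      with assms(1) show False by simp
    qed
    then show ?thesis using * lspan_base lspan_add lk by blast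
  qed
qed

text \<open>Gram-Schmidt over the localization: the norm of the pivot divides its inner products
  with \<open>R\<close>, so projecting away from it stays in the lattice.\<close>

lemma odd_splitting_exists:
  assumes "p \<noteq> 2"
  shows "splitting B R \<Longrightarrow> (\<forall>b\<in>B. p_split b) \<Longrightarrow>
    \<exists>B' R'. splitting B' R' \<and> R' \<subseteq> {0} \<and> (\<forall>b\<in>B'. p_split b)"
proof (induction "CARD('n) - card B" arbitrary: B R rule: less_induct)
  case less
  show ?case
  proof (cases "R \<subseteq> {0}")
    case True
    with less.prems show ?thesis by blast
  next
    case False
    from odd_pivot[OF assms less.prems(1) this] obtain b where
      b: "b \<in> lspan R" "b \<noteq> 0" "\<And>r. r \<in> R \<Longrightarrow> (r \<bullet> b) / (b \<bullet> b) \<in> p_integral p" by blast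
    have RH: "R \<subseteq> lspan H" and RB: "\<And>r c. r \<in> R \<Longrightarrow> c \<in> B \<Longrightarrow> r \<bullet> c = 0"
      using less.prems(1) by (auto simp: splitting_def)
    have bH: "b \<in> lspan H" using lspan_mono[OF b(1) RH] .
    have bB: "b \<bullet> c = 0" if "c \<in> B" for c
      using b(1) by induction (auto simp: inner_add RB[OF _ that])
    define f where "f r = r - ((r \<bullet> b) / (b \<bullet> b)) *\<^sub>R b" for r
    have "x \<bullet> b \<in> \<rat>" if "x \<in> H" for x
      using lspan_H_inner_Rats lspan_base that bH by blast
    moreover have "f r \<in> lspan H" if "r \<in> R" for r
      unfolding f_def using b(3)[OF that] bH RH that by (intro lspan_diff lspan_scale) auto
    moreover have "r - f r \<in> span {b}" for r by (simp add: f_def span_base span_scale)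
    moreover have "f r \<bullet> b = 0" for r using b(2) by (simp add: f_def inner_diff)
    ultimately have *: "splitting (B \<union> {b}) (f ` R)" "card (B \<union> {b}) = card B + card {b}"
      using splitting_step[OF less.prems(1), of "{b}" f] b(2) bB by (simp_all add: pairwise_def)
    have ps: "p_split b"
      unfolding p_split_def using bH splitting_inner[OF less.prems(1), of _ b "b \<bullet> b"] b(3) bB
      by (auto simp: inner_commute)
    show ?thesis
    proof (rule less.hyps[OF _ *(1)])
      show "CARD('n) - card (B \<union> {b}) < CARD('n) - card B"
        using splitting_card[OF *(1)] *(2) by simp
      show "\<forall>b\<in>B \<union> {b}. p_split b" using less.prems(2) ps by blast
    qed
  qed
qed

text \<open>The prime does not enter, so bases obtained at different primes can be compared by
  \<open>orthogonal_basis_square_class\<close>.\<close>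

definition orthogonal_basis :: "('n \<Rightarrow> real ^ 'n) \<Rightarrow> bool" where
  "orthogonal_basis b \<longleftrightarrow> (\<forall>i j. i \<noteq> j \<longrightarrow> b i \<bullet> b j = 0) \<and> (\<forall>i. b i \<noteq> 0) \<and> (\<forall>i. \<forall>x\<in>H. x \<bullet> b i \<in> \<rat>)"

lemma splitting_orthogonal_basis:
  assumes s: "splitting B R" and R: "R \<subseteq> {0}"
  obtains b where "orthogonal_basis b" "bij_betw b UNIV B"
proof -
  have "finite B" using s by (simp add: splitting_def)
  then obtain b where b: "bij_betw b (UNIV :: 'n set) B"
    using finite_same_card_bij[of "UNIV :: 'n set" B] splitting_complete[OF s R] by auto
  then have "b i \<in> B" "i \<noteq> j \<Longrightarrow> b i \<noteq> b j" for i j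
    by (auto simp: bij_betw_def inj_on_def)
  moreover from this(1) have "b i \<noteq> 0" for i
    using s unfolding splitting_def by metis
  ultimately have "orthogonal_basis b"
    using s by (auto simp: orthogonal_basis_def splitting_def pairwise_def orthogonal_def)
  then show thesis using b by (rule that)
qed

text \<open>An orthogonal basis of the lattice generated by \<open>H\<close> over the localization at an odd prime,
  rescaled by units so that all coordinates of the lines are integers.\<close>

lemma odd_orthogonal_basis:
  assumes "p \<noteq> 2"
  obtains b where "orthogonal_basis b"
    "\<And>i. b i \<bullet> b i \<in> p_integral p" "\<And>i x. x \<in> H \<Longrightarrow> (x \<bullet> b i) / (b i \<bullet> b i) \<in> \<int>"
proof -
  from odd_splitting_exists[OF assms splitting_initial] obtain B R where
    "splitting B R" "R \<subseteq> {0}" "\<forall>b\<in>B. p_split b" by auto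
  then obtain b where b: "orthogonal_basis b" "bij_betw b UNIV B"
    using splitting_orthogonal_basis by metis
  have ps: "p_split (b i)" for i using b(2) \<open>\<forall>b\<in>B. p_split b\<close> by (auto simp: bij_betw_def)
  have "\<exists>N. \<not> p dvd N \<and> (\<forall>r\<in>(\<lambda>x. (x \<bullet> b i) / (b i \<bullet> b i)) ` H. of_int N * r \<in> \<int>)" for i
    using ps[of i] finite_H by (intro p_integral_common_denominator) (auto simp: p_split_def)
  then obtain N where N: "\<And>i. \<not> p dvd N i" "\<And>i x. x \<in> H \<Longrightarrow> of_int (N i) * ((x \<bullet> b i) / (b i \<bullet> b i)) \<in> \<int>"
    by (metis image_eqI)
  \<comment> \<open>Dividing \<open>b i\<close> by \<open>N i\<close> multiplies the coordinates
    along it by \<open>N i\<close>, which clears their denominators; \<open>N i\<close> is a unit at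
    \<open>p\<close>, so the norms stay integral.\<close>
  define c where "c i = inverse (of_int (N i)) *\<^sub>R b i" for i
  have N0: "N i \<noteq> 0" for i using N(1)[of i] by auto
  have Ninv: "inverse (of_int (N i)) \<in> p_integral p" for i
    by (rule p_integralI[OF N(1)[of i], of _ 1]) (simp add: inverse_eq_divide)
  show thesis
  proof (rule that)
    show "orthogonal_basis c"
      using b(1) N0 by (auto simp: orthogonal_basis_def c_def)
    show "c i \<bullet> c i \<in> p_integral p" for i
      using lspan_H_inner[of "b i" "b i"] ps[of i] Ninv[of i]
      by (auto simp: c_def p_split_def intro: p_integral_mult)
    show "(x \<bullet> c i) / (c i \<bullet> c i) \<in> \<int>" if "x \<in> H" for i x
      using N(2)[OF that, of i] N0[of i] by (simp add: c_def field_simps)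
  qed
qed

end

section \<open>The prime 2\<close>

lemma prod_two_consecutive_even: "2 dvd (i :: int) * (i + 1)"
  by simp

lemma dvd_24_four_consecutive: "24 dvd (j - 1) * j * (j + 1) * (j + 2)" for j :: int
proof -
  have "8 dvd (j - 1) * j * (j + 1) * (j + 2)"
  proof (cases "even j")
    case True
    then obtain i where i: "j = 2 * i" by blast
    obtain k where k: "i * (i + 1) = 2 * k" using prod_two_consecutive_even[of i] by blast
    have "(j - 1) * j * (j + 1) * (j + 2) = 4 * (i * (i + 1)) * ((2 * i - 1) * (2 * i + 1))"
      unfolding i by algebra
    then show ?thesis unfolding k by simp
  next
    case False
    then obtain i where i: "j = 2 * i + 1" using oddE by blast
    obtain k where k: "i * (i + 1) = 2 * k" using prod_two_consecutive_even[of i] by blast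
    have "(j - 1) * j * (j + 1) * (j + 2) = 4 * (i * (i + 1)) * ((2 * i + 1) * (2 * i + 3))"
      unfolding i by algebra
    then show ?thesis unfolding k by simp
  qed
  moreover have "3 dvd (j - 1) * j * (j + 1) * (j + 2)"
  proof -
    have "3 dvd j - 1 \<or> 3 dvd j \<or> 3 dvd j + 1" by presburger
    then show ?thesis by (metis dvd_mult dvd_mult2)
  qed
  moreover have "8 dvd X \<Longrightarrow> 3 dvd X \<Longrightarrow> 24 dvd X" for X :: int
    by presburger
  ultimately show ?thesis by blast
qed

text \<open>With k = 2 j + 1 the factors are 4 j (j + 1) and 4 (j - 1) (j + 2), and 16 * 24 =
  384.\<close>

lemma dvd_384_odd: "odd k \<Longrightarrow> 384 dvd (k\<^sup>2 - 1) * (k\<^sup>2 - 9)" for k :: int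
proof -
  assume "odd k"
  then obtain j where j: "k = 2 * j + 1" using oddE by blast
  obtain i where i: "(j - 1) * j * (j + 1) * (j + 2) = 24 * i"
    using dvd_24_four_consecutive[of j] by blast
  have "(k\<^sup>2 - 1) * (k\<^sup>2 - 9) = 16 * ((j - 1) * j * (j + 1) * (j + 2))"
    unfolding j by algebra
  then show ?thesis unfolding i by simp
qed

text \<open>Applied at 2 with exponent 5, it makes 32 / M integral when 64 does not divide
  M.\<close>

lemma (in prime_int) p_integral_power_divide:
  assumes "\<not> p ^ Suc j dvd k" shows "of_int (p ^ j) / of_int k \<in> p_integral p"
proof (rule ccontr)
  assume n: "of_int (p ^ j) / of_int k \<notin> p_integral p"
  have "of_int (p ^ j) / (of_int k :: real) \<in> \<rat>" by simp
  from p_integral_or_inverse[OF this] n have "of_int k / of_int (p ^ j) \<in> p_integral p" by simp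
  then obtain c where c: "k = p ^ j * c" using dvd_if_p_integral by blast
  have "\<not> p dvd c" using assms c by (auto simp: mult_ac)
  then have "1 / of_int c \<in> p_integral p" by (rule p_integralI[of _ _ _ 1]) simp
  with n c prime show False by simp
qed

section \<open>Even norms in the complement of a line, and the splitting at 2\<close>

locale tight_lines_two = tight_lines_prime H m 2 for H :: "(real ^ 'n::finite) set" and m :: int +
  assumes even_m: "even m" and not_64_dvd: "\<not> 64 dvd m * (m + 1)"
begin

lemma half_not_integral: "1 / 2 \<notin> p_integral 2" "3 / 2 \<notin> p_integral 2" "9 / 2 \<notin> p_integral 2"
  using dvd_if_p_integral[of 1 1] dvd_if_p_integral[of 3 1] dvd_if_p_integral[of 9 1] by auto

lemma p_integral_parity: "r \<in> p_integral 2 \<Longrightarrow> r / 2 \<in> p_integral 2 \<or> (r - 1) / 2 \<in> p_integral 2"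
proof -
  assume "r \<in> p_integral 2"
  then obtain a b where ab: "odd b" "b \<noteq> 0" "r * of_int b = of_int a"
    by (metis p_integralE)
  show ?thesis
  proof (cases "even a")
    case True
    then obtain c where "a = 2 * c" by blast
    then have "r / 2 = of_int c / of_int b" using ab by (simp add: field_simps)
    then show ?thesis using p_integralI[OF ab(1)] by blast
  next
    case False
    then have "even (a - b)" using ab(1) by simp
    then obtain c where "a - b = 2 * c" by blast
    then have "a = 2 * c + b" by simp
    then have "(r - 1) / 2 = of_int c / of_int b" using ab by (simp add: field_simps)
    then show ?thesis using p_integralI[OF ab(1)] by blast
  qed
qed

lemma inner_odd: "x \<in> H \<Longrightarrow> y \<in> H \<Longrightarrow> \<exists>k. odd k \<and> x \<bullet> y = of_int k"
  using norm_H[of x] inner_H[of x y]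
  by (cases "x = y") (auto intro: exI[of _ "2 * m + 1"] exI[of _ 1] exI[of _ "- 1"])

text \<open>The vector \<open>2 a + x1\<close> has odd inner products \<open>k\<close> with all lines, and
  \<open>(k\<^sup>2 - 1) (k\<^sup>2 - 9)\<close> is divisible by 384.\<close>

lemma twice_norm_integral:
  assumes a: "\<And>x. x \<in> H \<Longrightarrow> x \<bullet> a \<in> \<int>" and x1: "x1 \<in> H" "x1 \<bullet> a = 0"
  shows "2 * (a \<bullet> a) \<in> p_integral 2"
proof -
  define c where "c = 2 *\<^sub>R a + x1"
  define g where "g = c \<bullet> c"
  have g: "g = 4 * (a \<bullet> a) + of_int t"
    using x1 norm_H[OF x1(1)] by (simp add: g_def c_def t_def inner_add inner_commute)
  have "\<exists>k. odd k \<and> x \<bullet> c = of_int k" if x: "x \<in> H" for x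
  proof -
    obtain j where j: "x \<bullet> a = of_int j" using a[OF x] Ints_cases by blast
    obtain i where i: "odd i" "x \<bullet> x1 = of_int i" using inner_odd[OF x x1(1)] by blast
    have "x \<bullet> c = of_int (2 * j + i)" by (simp add: c_def inner_add_right j i)
    with i show ?thesis by (intro exI[of _ "2 * j + i"]) simp
  qed
  then obtain k where k: "\<And>x. x \<in> H \<Longrightarrow> odd (k x)" "\<And>x. x \<in> H \<Longrightarrow> x \<bullet> c = of_int (k x)"
    by metis
  have "384 dvd (\<Sum>x\<in>H. ((k x)\<^sup>2 - 1) * ((k x)\<^sup>2 - 9))"
    using k(1) by (intro dvd_sum dvd_384_odd)
  then obtain z where z: "(\<Sum>x\<in>H. ((k x)\<^sup>2 - 1) * ((k x)\<^sup>2 - 9)) = 384 * z" by blast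
  have "384 * of_int z = (\<Sum>x\<in>H. ((x \<bullet> c)\<^sup>2 - 1) * ((x \<bullet> c)\<^sup>2 - 9))"
  proof -
    have "384 * of_int z = (of_int (\<Sum>x\<in>H. ((k x)\<^sup>2 - 1) * ((k x)\<^sup>2 - 9)) :: real)" unfolding z by simp
    also have "\<dots> = (\<Sum>x\<in>H. ((x \<bullet> c)\<^sup>2 - 1) * ((x \<bullet> c)\<^sup>2 - 9))"
      unfolding of_int_sum by (intro sum.cong refl) (simp add: k(2))
    finally show ?thesis .
  qed
  also have "\<dots> = (\<Sum>x\<in>H. (x \<bullet> c) ^ 4) - 10 * (\<Sum>x\<in>H. (x \<bullet> c)\<^sup>2) + 9 * of_int (int (card H))"
  proof -
    have "((x \<bullet> c)\<^sup>2 - 1) * ((x \<bullet> c)\<^sup>2 - 9) = (x \<bullet> c) ^ 4 - 10 * (x \<bullet> c)\<^sup>2 + 9" for x :: "real ^ 'n"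
      by algebra
    then show ?thesis by (simp add: sum.distrib sum_subtractf sum_distrib_left)
  qed
  also have "\<dots> = of_int M * (6 * g\<^sup>2 - 20 * of_int t * g + 18 * (4 * of_int M - 1))"
    unfolding sum_power2 sum_power4 card_H t_M_defs g_def[symmetric] by (simp add: algebra_simps)
  finally have "of_int M * (3 * g\<^sup>2 - 10 * of_int t * g + 9 * (4 * of_int M - 1)) = 192 * of_int z"
    by (simp add: algebra_simps)
  \<comment> \<open>192 = 2 * 2^5 * 3: since 32 / M is integral at 2, the left side is even.\<close>
  then have E: "3 * g\<^sup>2 - 10 * of_int t * g + 9 * (4 * of_int M - 1) = 2 * (of_int (2 ^ 5) / of_int M * of_int (3 * z))"
    using M_pos by (simp add: field_simps)
  define w where "w = of_int (2 ^ 5) / of_int M * (of_int (3 * z) :: real)"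
  have w: "w \<in> p_integral 2"
    unfolding w_def using not_64_dvd
    by (intro p_integral_mult p_integral_power_divide p_integral_of_int) (simp add: M_def)
  note E = E[folded w_def]
  have gR: "g \<in> \<rat>"
    unfolding g_def by (rule inner_Rats) (use k(2) in auto)
  \<comment> \<open>Otherwise g = 1 / (2 h) with \<open>h\<close> integral, and the equation times 4
    h^2 leaves 3 against even terms.\<close>
  have g_int: "g \<in> p_integral 2"
  proof (rule ccontr)
    assume n: "g \<notin> p_integral 2"
    then have "inverse g \<in> p_integral 2" using p_integral_or_inverse[OF gR] by blast
    moreover from n have "inverse (inverse g) \<notin> p_integral 2" by simp
    ultimately have h: "inverse g / of_int 2 \<in> p_integral 2" using p_integral_unit by blast
    define h where "h = inverse g / of_int 2"
    have "g \<noteq> 0" using n by auto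
    then have hg: "2 * h * g = 1" by (simp add: h_def)
    have e1: "4 * h\<^sup>2 * (3 * g\<^sup>2 - 10 * of_int t * g + 9 * (4 * of_int M - 1)) = 4 * h\<^sup>2 * (2 * w)"
      by (simp only: E)
    have e2: "4 * h\<^sup>2 * (3 * g\<^sup>2 - 10 * of_int t * g + 9 * (4 * of_int M - 1))
      = 3 * (2 * h * g)\<^sup>2 - 20 * of_int t * h * (2 * h * g) + 36 * h\<^sup>2 * (4 * of_int M - 1)"
      by algebra
    from trans[OF e1[symmetric] e2, unfolded hg] have "3 / 2 = of_int (10 * t) * h - of_int (18 * (4 * M - 1)) * h\<^sup>2 + of_int 4 * h\<^sup>2 * w"
      by (simp add: algebra_simps)
    also have "\<dots> \<in> p_integral 2"
      using h w by (intro p_integral_intros) (auto simp: h_def)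
    finally show False using half_not_integral by blast
  qed
  \<comment> \<open>An even \<open>g\<close> would leave the odd constant 9 against even
    terms.\<close>
  have "\<not> g / 2 \<in> p_integral 2"
  proof
    assume "g / 2 \<in> p_integral 2"
    moreover have "9 / 2 = of_int 3 * g * (g / 2) - of_int (5 * t) * g + of_int (18 * M) - w"
      using E by (simp add: power2_eq_square field_simps)
    ultimately have "9 / 2 \<in> p_integral 2"
      using g_int w by (metis p_integral_of_int p_integral_mult p_integral_add p_integral_diff)
    then show False using half_not_integral by blast
  qed
  then have "(g - 1) / 2 \<in> p_integral 2" using p_integral_parity[OF g_int] by blast
  then have "(g - 1) / 2 - of_int m \<in> p_integral 2" by (intro p_integral_intros)
  also have "(g - 1) / 2 - of_int m = 2 * (a \<bullet> a)"
    by (simp add: g t_def field_simps)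
  finally show ?thesis .
qed

text \<open>For y = sum c_x x the witness \<open>e\<close> is the sum of the c_x. As inner products
  of lines are odd and t = 1 mod 4, every (y,z) agrees with e mod 2 and (y,y) with e^2 mod 4.
  Orthogonality to a line makes e even.\<close>

lemma quarter_norm_integral:
  assumes "y \<in> lspan H" "x1 \<in> H" "x1 \<bullet> y = 0"
  shows "(y \<bullet> y) / 4 \<in> p_integral 2"
proof -
  from assms(1) have "\<exists>e\<in>p_integral 2. (\<forall>z\<in>H. (y \<bullet> z - e) / 2 \<in> p_integral 2) \<and> (y \<bullet> y - e\<^sup>2) / 4 \<in> p_integral 2"
  proof induction
    case lspan_zero
    show ?case by (intro bexI[of _ 0]) auto
  next
    case (lspan_step y x c)
    then obtain e where e: "e \<in> p_integral 2" "\<And>z. z \<in> H \<Longrightarrow> (y \<bullet> z - e) / 2 \<in> p_integral 2"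
      "(y \<bullet> y - e\<^sup>2) / 4 \<in> p_integral 2" by blast
    show ?case
    proof (intro bexI[of _ "e + c"] conjI ballI)
      fix z assume z: "z \<in> H"
      obtain k where k: "odd k" "x \<bullet> z = of_int k" using inner_odd lspan_step.hyps z by blast
      then obtain i where i: "k = 2 * i + 1" using oddE by blast
      have "((y + c *\<^sub>R x) \<bullet> z - (e + c)) / 2 = (y \<bullet> z - e) / 2 + c * of_int i"
        by (simp add: inner_add k i field_simps)
      then show "((y + c *\<^sub>R x) \<bullet> z - (e + c)) / 2 \<in> p_integral 2"
        using e(2)[OF z] lspan_step.hyps(3) by (simp only:) (intro p_integral_intros)
    next
      obtain i where i: "m = 2 * i" using even_m by blast
      have "((y + c *\<^sub>R x) \<bullet> (y + c *\<^sub>R x) - (e + c)\<^sup>2) / 4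
          = (y \<bullet> y - e\<^sup>2) / 4 + c * ((y \<bullet> x - e) / 2) + c\<^sup>2 * of_int i"
        using norm_H[OF lspan_step.hyps(2)]
        by (simp add: inner_add inner_commute[of x y] i field_simps power2_eq_square)
      then show "((y + c *\<^sub>R x) \<bullet> (y + c *\<^sub>R x) - (e + c)\<^sup>2) / 4 \<in> p_integral 2"
        using e(2)[OF lspan_step.hyps(2)] e(3) lspan_step.hyps(3)
        by (simp only:) (intro p_integral_intros)
    qed (use e lspan_step.hyps in \<open>auto intro: p_integral_intros\<close>)
  qed
  then obtain e where e: "e \<in> p_integral 2" "\<And>z. z \<in> H \<Longrightarrow> (y \<bullet> z - e) / 2 \<in> p_integral 2"
    "(y \<bullet> y - e\<^sup>2) / 4 \<in> p_integral 2" by blast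
  from e(2)[OF assms(2)] assms(3) have "- e / 2 \<in> p_integral 2" by (simp add: inner_commute)
  then have "(y \<bullet> y - e\<^sup>2) / 4 + (- e / 2)\<^sup>2 \<in> p_integral 2"
    using e(3) by (intro p_integral_intros)
  then show ?thesis by (simp add: power2_eq_square field_simps)
qed

text \<open>Two bounds are combined. Up to a unit \<open>y / c\<close> lies in the dual lattice, so
  2 (y,y) / c^2 is integral by \<open>twice_norm_integral\<close>; this suffices if 4 divides
  \<open>c\<close>. Otherwise 2 / c is integral, and so is (y,y) / 4 by
  \<open>quarter_norm_integral\<close>.\<close>

lemma even_norm:
  assumes y: "y \<in> lspan H" and x1: "x1 \<in> H" "x1 \<bullet> y = 0" and c: "c \<noteq> 0" "c \<in> \<rat>"
    and div: "\<And>x. x \<in> H \<Longrightarrow> (x \<bullet> y) / c \<in> p_integral 2"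
  shows "(y \<bullet> y) / c / 2 \<in> p_integral 2"
proof -
  have "\<exists>N. \<not> 2 dvd N \<and> (\<forall>r\<in>(\<lambda>x. (x \<bullet> y) / c) ` H. of_int N * r \<in> \<int>)"
    using div finite_H by (intro p_integral_common_denominator) auto
  then obtain N where N: "odd N" "\<And>x. x \<in> H \<Longrightarrow> of_int N * ((x \<bullet> y) / c) \<in> \<int>" by auto
  define a where "a = (of_int N / c) *\<^sub>R y"
  have "2 * (a \<bullet> a) \<in> p_integral 2"
    using N(2) x1 by (intro twice_norm_integral[of a x1]) (auto simp: a_def)
  moreover have "1 / of_int N \<in> p_integral 2"
    using p_integralI[of 2 N "1 / of_int N" 1] N(1) by simp
  ultimately have "2 * (a \<bullet> a) * (1 / of_int N)\<^sup>2 \<in> p_integral 2"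
    by (rule p_integral_mult[OF _ p_integral_power])
  moreover have "2 * (a \<bullet> a) * (1 / of_int N)\<^sup>2 = 2 * (y \<bullet> y) / c\<^sup>2"
    using N(1) by (auto simp: a_def power2_eq_square)
  ultimately have n2: "2 * (y \<bullet> y) / c\<^sup>2 \<in> p_integral 2" by simp
  have n4: "(y \<bullet> y) / 4 \<in> p_integral 2" using quarter_norm_integral[OF y x1] .
  show ?thesis
  proof (cases "c / 4 \<in> p_integral 2")
    case True
    have "(y \<bullet> y) / c / 2 = (2 * (y \<bullet> y) / c\<^sup>2) * (c / 4)"
      using c by (simp add: power2_eq_square)
    with p_integral_mult[OF n2 True] show ?thesis by simp
  next
    case False
    have "c / 4 \<in> \<rat>" using c by simp
    from p_integral_or_inverse[OF this] False have "4 / c \<in> p_integral 2" by simp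
    moreover have "inverse (4 / c) \<notin> p_integral 2" using False by simp
    ultimately have "4 / c / of_int 2 \<in> p_integral 2" using p_integral_unit by blast
    then have "((y \<bullet> y) / 4) * (4 / c / of_int 2) \<in> p_integral 2"
      using n4 by (rule p_integral_mult[rotated])
    then show ?thesis by (simp add: mult_ac)
  qed
qed

text \<open>The square class of a product of \<open>j\<close> block determinants: up to a square
  each block contributes - (1 - 4 \<alpha> \<beta>), and the factors 1 + 4 u are closed under
  multiplication.\<close>

definition block_form :: "real \<Rightarrow> nat \<Rightarrow> bool" where
  "block_form d j \<longleftrightarrow> (\<exists>q\<in>\<rat>. q \<noteq> 0 \<and> (\<exists>u\<in>p_integral 2. d = (- 1) ^ j * q\<^sup>2 * (1 + 4 * u)))"

lemma block_formI:
  "q \<in> \<rat> \<Longrightarrow> q \<noteq> 0 \<Longrightarrow> u \<in> p_integral 2 \<Longrightarrow> d = (- 1) ^ j * q\<^sup>2 * (1 + 4 * u) \<Longrightarrow> block_form d j"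
  unfolding block_form_def by blast

text \<open>No single vector splits off here: \<open>even_norm\<close> with \<open>c\<close> its own
  norm would make 1 / 2 integral. But if \<open>a = l \<bullet> k\<close> divides all inner products
  of \<open>R\<close>, then 2 a divides the norms, and \<open>l\<close>, \<open>k\<close> have Gram
  matrix a (2 \<alpha>, 1; 1, 2 \<beta>). Its determinant is - a^2 times the unit 1 - 4 \<alpha>
  \<beta>, so the plane splits off.\<close>

lemma even_pivot:
  assumes s: "splitting B R" and R: "\<not> R \<subseteq> {0}" and x1: "x1 \<in> H" "x1 \<in> B"
    and form: "block_form (\<Prod>b\<in>B. b \<bullet> b) j"
  shows "\<exists>B' R'. splitting B' R' \<and> B \<subseteq> B' \<and> card B' = card B + 2 \<and> block_form (\<Prod>b\<in>B'. b \<bullet> b) (Suc j)"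
proof -
  have RH: "R \<subseteq> lspan H" and fR: "finite R" and RB: "\<And>r b. r \<in> R \<Longrightarrow> b \<in> B \<Longrightarrow> r \<bullet> b = 0"
    and fB: "finite B"
    using s by (auto simp: splitting_def)
  define A where "A = {r \<bullet> r' | r r'. r \<in> R \<and> r' \<in> R} - {0}"
  have "A = (\<lambda>(r, r'). r \<bullet> r') ` (R \<times> R) - {0}" by (auto simp: A_def)
  then have "finite A" using fR by simp
  moreover from R obtain r where "r \<in> R" "r \<noteq> 0" by auto
  then have "r \<bullet> r \<in> A" by (auto simp: A_def)
  then have "A \<noteq> {}" by blast
  moreover have "A \<subseteq> \<rat>" using RH lspan_H_inner_Rats by (auto simp: A_def)
  ultimately obtain a where a: "a \<in> A" "\<forall>b\<in>A. b / a \<in> p_integral 2"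
    using ex_p_minimal[of A] by (auto simp: A_def)
  then obtain l k where lk: "l \<in> R" "k \<in> R" "a = l \<bullet> k" "a \<noteq> 0" by (auto simp: A_def)
  have aR: "a \<in> \<rat>" using lk RH lspan_H_inner_Rats by blast
  have min: "(r \<bullet> r') / a \<in> p_integral 2" if "r \<in> R" "r' \<in> R" for r r'
    using a(2) that by (cases "r \<bullet> r' = 0") (auto simp: A_def)
  have even: "(r \<bullet> r) / a / 2 \<in> p_integral 2" if r: "r \<in> R" for r
  proof (rule even_norm[of r x1])
    show "(x \<bullet> r) / a \<in> p_integral 2" if "x \<in> H" for x
      using splitting_inner[OF s that, of r a] RB[OF r] min[OF _ r] by (simp add: inner_commute)
    show "x1 \<bullet> r = 0" using RB[OF r x1(2)] by (simp add: inner_commute)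
  qed (use r RH x1 lk aR in auto)
  define \<alpha> where "\<alpha> = (l \<bullet> l) / a / 2"
  define \<beta> where "\<beta> = (k \<bullet> k) / a / 2"
  have ll: "l \<bullet> l = 2 * a * \<alpha>" and kk: "k \<bullet> k = 2 * a * \<beta>" using lk by (auto simp: \<alpha>_def \<beta>_def)
  have \<alpha>: "\<alpha> \<in> p_integral 2" and \<beta>: "\<beta> \<in> p_integral 2" using even lk by (auto simp: \<alpha>_def \<beta>_def)
  define e where "e = 1 - 4 * \<alpha> * \<beta>"
  have e: "e \<in> p_integral 2" using \<alpha> \<beta> p_integral_of_int[of 4] unfolding e_def by (intro p_integral_intros) auto
  have einv: "1 / e \<in> p_integral 2"
  proof -
    have "e / of_int 2 \<notin> p_integral 2"
    proof
      assume "e / of_int 2 \<in> p_integral 2"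
      then have "e / of_int 2 + of_int 2 * \<alpha> * \<beta> \<in> p_integral 2"
        using \<alpha> \<beta> by (intro p_integral_intros)
      also have "e / of_int 2 + of_int 2 * \<alpha> * \<beta> = 1 / 2" by (simp add: e_def field_simps)
      finally show False using half_not_integral by blast
    qed
    from p_integral_unit[OF e this] show ?thesis by (simp add: inverse_eq_divide)
  qed
  have e0: "e \<noteq> 0"
  proof
    assume "e = 0"
    then have "of_int 2 * \<alpha> * \<beta> = 1 / 2" by (simp add: e_def)
    moreover have "of_int 2 * \<alpha> * \<beta> \<in> p_integral 2" using \<alpha> \<beta> by (intro p_integral_intros)
    ultimately have "1 / 2 \<in> p_integral 2" by (simp only:)
    then show False using half_not_integral(1) by contradiction
  qed
  have l0: "l \<noteq> 0" using lk by auto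
  \<comment> \<open>Gram-Schmidt inside the block; \<open>k'\<close> may leave the lattice, which
    \<open>splitting\<close> permits.\<close>
  define k' where "k' = k - (a / (l \<bullet> l)) *\<^sub>R l"
  have k'l: "k' \<bullet> l = 0" using l0 lk(3) by (simp add: k'_def inner_diff inner_commute)
  have det: "(l \<bullet> l) * (k' \<bullet> k') = - (a\<^sup>2 * e)"
  proof -
    have "(l \<bullet> l) * (k' \<bullet> k') = (l \<bullet> l) * (k \<bullet> k) - a\<^sup>2"
      using l0 lk(3) by (simp add: k'_def inner_diff inner_commute[of k l] field_simps power2_eq_square)
    then show ?thesis unfolding ll kk e_def by algebra
  qed
  have k'0: "k' \<noteq> 0" using det e0 lk(4) by auto
  \<comment> \<open>Cramer's rule for the projection of \<open>r\<close> to the plane of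
    \<open>l\<close> and \<open>k\<close>; the denominator is the unit \<open>e\<close>.\<close>
  define \<rho> where "\<rho> r = ((r \<bullet> k) / a - 2 * \<beta> * ((r \<bullet> l) / a)) / e" for r
  define \<mu> where "\<mu> r = ((r \<bullet> l) / a - 2 * \<alpha> * ((r \<bullet> k) / a)) / e" for r
  define f where "f r = r - \<rho> r *\<^sub>R l - \<mu> r *\<^sub>R k" for r
  have fl: "f r \<bullet> l = 0" for r
  proof -
    have "f r \<bullet> l = r \<bullet> l - \<rho> r * (2 * a * \<alpha>) - \<mu> r * a"
      using lk(3) by (simp add: f_def inner_diff ll inner_commute[of k l])
    also have "\<dots> = ((r \<bullet> l) * e - (r \<bullet> l) * (1 - 4 * \<alpha> * \<beta>)) / e"
      using e0 lk(4) by (simp add: \<rho>_def \<mu>_def field_simps)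
    finally show ?thesis by (simp add: e_def)
  qed
  have fk: "f r \<bullet> k = 0" for r
  proof -
    have "f r \<bullet> k = r \<bullet> k - \<rho> r * a - \<mu> r * (2 * a * \<beta>)"
      using lk(3) by (simp add: f_def inner_diff kk)
    also have "\<dots> = ((r \<bullet> k) * e - (r \<bullet> k) * (1 - 4 * \<alpha> * \<beta>)) / e"
      using e0 lk(4) by (simp add: \<rho>_def \<mu>_def field_simps)
    finally show ?thesis by (simp add: e_def)
  qed
  let ?P = "{l, k'}"
  have lk': "l \<noteq> k'" using k'l l0 by auto
  have rat: "x \<bullet> l \<in> \<rat>" "x \<bullet> k \<in> \<rat>" "l \<bullet> l \<in> \<rat>" if "x \<in> H" for x
    using lspan_H_inner_Rats lspan_base that lk RH by blast+
  have "x \<bullet> u \<in> \<rat>" if "u \<in> ?P" "x \<in> H" for u x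
    using rat[OF that(2)] that(1) aR by (auto simp: k'_def inner_diff_right)
  moreover have "f r \<in> lspan H" if "r \<in> R" for r
  proof -
    have "\<rho> r = ((r \<bullet> k) / a - of_int 2 * \<beta> * ((r \<bullet> l) / a)) * (1 / e)"
      "\<mu> r = ((r \<bullet> l) / a - of_int 2 * \<alpha> * ((r \<bullet> k) / a)) * (1 / e)"
      by (simp_all add: \<rho>_def \<mu>_def)
    moreover have "((r \<bullet> k) / a - of_int 2 * \<beta> * ((r \<bullet> l) / a)) * (1 / e) \<in> p_integral 2"
      "((r \<bullet> l) / a - of_int 2 * \<alpha> * ((r \<bullet> k) / a)) * (1 / e) \<in> p_integral 2"
      by (rule p_integral_mult p_integral_diff p_integral_of_int min[OF that lk(1)] min[OF that lk(2)] \<alpha> \<beta> einv)+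
    ultimately have "\<rho> r \<in> p_integral 2" "\<mu> r \<in> p_integral 2" by simp_all
    then show ?thesis
      unfolding f_def using RH lk that by (intro lspan_diff lspan_scale) auto
  qed
  moreover have "r - f r \<in> span ?P" for r
  proof -
    have "r - f r = (\<rho> r + \<mu> r * (a / (l \<bullet> l))) *\<^sub>R l + \<mu> r *\<^sub>R k'"
      by (simp add: f_def k'_def algebra_simps)
    also have "\<dots> \<in> span ?P"
      by (intro span_add span_scale span_base) auto
    finally show ?thesis .
  qed
  moreover have "f r \<bullet> u = 0" if "u \<in> ?P" for r u
    using that fl[of r] fk[of r] by (auto simp: k'_def inner_diff_right)
  moreover have "u \<bullet> b = 0" if "u \<in> ?P" "b \<in> B" for u b
    using that RB[OF lk(1)] RB[OF lk(2)] by (auto simp: k'_def inner_diff_left)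
  moreover have "pairwise orthogonal ?P" "finite ?P" "0 \<notin> ?P"
    using l0 k'0 k'l by (auto simp: pairwise_def orthogonal_def inner_commute)
  ultimately have *: "splitting (B \<union> ?P) (f ` R)" "card (B \<union> ?P) = card B + card ?P"
    using splitting_step[OF s, of ?P f] by blast+
  have "B \<inter> ?P = {}"
    using card_Un_Int[of B ?P] *(2) fB by simp
  then have "(\<Prod>b\<in>B \<union> ?P. b \<bullet> b) = (\<Prod>b\<in>B. b \<bullet> b) * ((l \<bullet> l) * (k' \<bullet> k'))"
    using fB lk' by (subst prod.union_disjoint) auto
  moreover obtain q u where qu: "q \<in> \<rat>" "q \<noteq> 0" "u \<in> p_integral 2"
    "(\<Prod>b\<in>B. b \<bullet> b) = (- 1) ^ j * q\<^sup>2 * (1 + 4 * u)"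
    using form by (auto simp: block_form_def)
  ultimately have "(\<Prod>b\<in>B \<union> ?P. b \<bullet> b)
      = (- 1) ^ Suc j * (q * a)\<^sup>2 * (1 + 4 * (u - \<alpha> * \<beta> - of_int 4 * u * \<alpha> * \<beta>))"
    unfolding det e_def by (simp add: power_mult_distrib algebra_simps)
  moreover have "u - \<alpha> * \<beta> - of_int 4 * u * \<alpha> * \<beta> \<in> p_integral 2"
    using qu(3) \<alpha> \<beta> by (intro p_integral_intros)
  moreover have "q * a \<in> \<rat>" "q * a \<noteq> 0" using qu aR lk(4) by auto
  ultimately have "block_form (\<Prod>b\<in>B \<union> ?P. b \<bullet> b) (Suc j)"
    by (intro block_formI)
  with * lk' show ?thesis by (intro exI[of _ "B \<union> ?P"] exI[of _ "f ` R"]) auto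
qed

lemma even_splitting_exists:
  assumes x1: "x1 \<in> H"
  shows "splitting B R \<Longrightarrow> x1 \<in> B \<Longrightarrow> card B = 1 + 2 * j \<Longrightarrow> block_form (\<Prod>b\<in>B. b \<bullet> b) j \<Longrightarrow>
    \<exists>B' R' j'. splitting B' R' \<and> R' \<subseteq> {0} \<and> card B' = 1 + 2 * j' \<and> block_form (\<Prod>b\<in>B'. b \<bullet> b) j'"
proof (induction "CARD('n) - card B" arbitrary: B R j rule: less_induct)
  case less
  show ?case
  proof (cases "R \<subseteq> {0}")
    case True
    with less.prems show ?thesis by blast
  next
    case False
    from even_pivot[OF less.prems(1) this x1 less.prems(2,4)] obtain B' R' where
      B': "splitting B' R'" "B \<subseteq> B'" "card B' = card B + 2" "block_form (\<Prod>b\<in>B'. b \<bullet> b) (Suc j)"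
      by blast
    show ?thesis
      using splitting_card[OF B'(1)] B' less.prems
      by (intro less.hyps[OF _ B'(1) _ _ B'(4)]) auto
  qed
qed

text \<open>The first summand is a line, of norm t = 1 mod 4. Then 1 + 2 j = 4 M - 1 makes the
  number of blocks j = 2 M - 1 odd, which is the origin of the minus sign.\<close>

lemma two_adic_orthogonal_basis:
  obtains b q u where "orthogonal_basis b" "q \<in> \<rat>" "q \<noteq> 0" "u \<in> p_integral 2"
    "(\<Prod>i\<in>UNIV. b i \<bullet> b i) = - (q\<^sup>2 * (1 + 4 * u))"
proof -
  obtain x1 where x1: "x1 \<in> H" using H_nonempty by blast
  have n1: "x1 \<bullet> x1 = of_int t" using norm_H[OF x1] by (simp add: t_def)
  have odd_t: "odd t" by (simp add: t_def)
  have tinv: "1 / of_int t \<in> p_integral 2"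
    using p_integralI[of 2 t "1 / of_int t" 1] odd_t by simp
  define f where "f r = r - ((r \<bullet> x1) * (1 / of_int t)) *\<^sub>R x1" for r
  have t0: "of_int t \<noteq> (0 :: real)" using t_pos by simp
  have x10: "x1 \<noteq> 0" using n1 t0 by auto
  have "x \<bullet> x1 \<in> \<rat>" if "x \<in> H" for x
    using lspan_H_inner_Rats lspan_base that x1 by blast
  moreover have "f r \<in> lspan H" if "r \<in> H" for r
    unfolding f_def using that x1 tinv lspan_H_inner
    by (intro lspan_diff lspan_scale p_integral_mult) (auto intro: lspan_base)
  moreover have "r - f r \<in> span {x1}" for r by (simp add: f_def span_base span_scale)
  moreover have "f r \<bullet> x1 = 0" for r using t0 by (simp add: f_def inner_diff n1)
  ultimately have s: "splitting ({} \<union> {x1}) (f ` H)"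
    using splitting_step(1)[OF splitting_initial, of "{x1}" f] x10 by (simp add: pairwise_def)
  obtain i where i: "m = 2 * i" using even_m by blast
  have "(\<Prod>b\<in>{x1}. b \<bullet> b) = (- 1) ^ 0 * 1\<^sup>2 * (1 + 4 * of_int i)"
    using norm_H[OF x1] i by simp
  then have "block_form (\<Prod>b\<in>{x1}. b \<bullet> b) 0"
    by (rule block_formI[OF Rats_1 zero_neq_one[symmetric] p_integral_of_int])
  with even_splitting_exists[OF x1, of "{x1}" "f ` H" 0] s obtain B R j where
    B: "splitting B R" "R \<subseteq> {0}" "card B = 1 + 2 * j" "block_form (\<Prod>b\<in>B. b \<bullet> b) j" by auto
  have "int (1 + 2 * j) = 4 * M - 1"
    using splitting_complete[OF B(1,2)] B(3) dimension by (simp add: M_def)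
  then have "odd j" by presburger
  then obtain q u where qu: "q \<in> \<rat>" "q \<noteq> 0" "u \<in> p_integral 2"
    "(\<Prod>b\<in>B. b \<bullet> b) = - (q\<^sup>2 * (1 + 4 * u))"
    using B(4) by (auto simp: block_form_def)
  obtain b where b: "orthogonal_basis b" "bij_betw b UNIV B"
    using splitting_orthogonal_basis[OF B(1,2)] by metis
  show thesis
    using that[OF b(1) qu(1-3)] qu(4) prod.reindex_bij_betw[OF b(2), of "\<lambda>v. v \<bullet> v"] by simp
qed

end

section \<open>The primes 3 and larger\<close>

context tight_lines_prime
begin

lemma orthogonal_basis_total:
  assumes b: "orthogonal_basis b" and v: "\<And>i. b i \<bullet> v = 0" shows "v = 0"
proof (rule ccontr)
  assume "v \<noteq> 0"
  have "inj b"
    using b unfolding orthogonal_basis_def inj_on_def by (metis inner_eq_zero_iff)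
  moreover have "v \<notin> range b"
  proof
    assume "v \<in> range b"
    then obtain i where "v = b i" by blast
    with v[of i] \<open>v \<noteq> 0\<close> show False by simp
  qed
  ultimately have "card (insert v (range b)) = CARD('n) + 1"
    by (simp add: card_image)
  moreover have "independent (insert v (range b))"
  proof (rule pairwise_orthogonal_independent)
    have "v \<bullet> b i = 0" for i using v[of i] by (simp add: inner_commute)
    moreover have "b i \<bullet> b j = 0" if "b i \<noteq> b j" for i j
      using b that unfolding orthogonal_basis_def by metis
    ultimately show "pairwise orthogonal (insert v (range b))"
      using v unfolding pairwise_def orthogonal_def by auto
    show "0 \<notin> insert v (range b)"
      using b \<open>v \<noteq> 0\<close> unfolding orthogonal_basis_def by auto
  qed
  ultimately show False using independent_bound[of "insert v (range b)"] by simp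
qed

lemma orthogonal_basis_expansion:
  assumes b: "orthogonal_basis b"
  shows "x = (\<Sum>i\<in>UNIV. ((x \<bullet> b i) / (b i \<bullet> b i)) *\<^sub>R b i)"
proof -
  have "x - (\<Sum>i\<in>UNIV. ((x \<bullet> b i) / (b i \<bullet> b i)) *\<^sub>R b i) = 0"
  proof (rule orthogonal_basis_total[OF b])
    fix j
    have "(\<Sum>i\<in>UNIV. ((x \<bullet> b i) / (b i \<bullet> b i)) * (b j \<bullet> b i)) = x \<bullet> b j"
      using b by (subst sum.remove[of _ j]) (auto simp: orthogonal_basis_def intro!: sum.neutral)
    then show "b j \<bullet> (x - (\<Sum>i\<in>UNIV. ((x \<bullet> b i) / (b i \<bullet> b i)) *\<^sub>R b i)) = 0"
      by (simp add: inner_diff_right inner_sum_right inner_commute)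
  qed
  then show ?thesis by simp
qed

lemma orthogonal_basis_inner:
  assumes b: "orthogonal_basis b"
  shows "x \<bullet> y = (\<Sum>i\<in>UNIV. (x \<bullet> b i) / (b i \<bullet> b i) * ((y \<bullet> b i) / (b i \<bullet> b i)) * (b i \<bullet> b i))"
proof -
  have nz: "b i \<bullet> b i \<noteq> 0" for i using b by (simp add: orthogonal_basis_def)
  have "x \<bullet> y = (\<Sum>i\<in>UNIV. (x \<bullet> b i) / (b i \<bullet> b i) * (y \<bullet> b i))"
  proof -
    have "x \<bullet> y = (\<Sum>i\<in>UNIV. ((x \<bullet> b i) / (b i \<bullet> b i)) *\<^sub>R b i) \<bullet> y"
      using orthogonal_basis_expansion[OF b, of x] by (rule arg_cong)
    also have "\<dots> = (\<Sum>i\<in>UNIV. (x \<bullet> b i) / (b i \<bullet> b i) * (b i \<bullet> y))"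
      by (simp add: inner_sum_left)
    finally show ?thesis by (simp only: inner_commute)
  qed
  then show ?thesis using nz by simp
qed

end

locale tight_lines_odd = tight_lines_prime H m p for H :: "(real ^ 'n::finite) set" and m p :: int +
  fixes b :: "'n \<Rightarrow> real ^ 'n" and a :: "'n \<Rightarrow> real" and \<xi> :: "real ^ 'n \<Rightarrow> 'n \<Rightarrow> int"
  assumes basis: "orthogonal_basis b"
    and a: "a i = b i \<bullet> b i" "a i \<in> p_integral p"
    and \<xi>: "x \<in> H \<Longrightarrow> of_int (\<xi> x i) = (x \<bullet> b i) / a i"
begin

lemma a_pos: "a i > 0" and a_nonzero [simp]: "a i \<noteq> 0"
  using basis by (auto simp: orthogonal_basis_def a)

lemma inner_b: "x \<in> H \<Longrightarrow> x \<bullet> b i = of_int (\<xi> x i) * a i"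
  using \<xi>[of x i] a_nonzero[of i] by (simp add: field_simps)

lemma b_orthogonal: "b i \<bullet> b j = (if i = j then a i else 0)"
  using basis by (auto simp: orthogonal_basis_def a)

lemma inner_H_expansion:
  "x \<in> H \<Longrightarrow> y \<in> H \<Longrightarrow> x \<bullet> y = (\<Sum>i\<in>UNIV. of_int (\<xi> x i) * of_int (\<xi> y i) * a i)"
  by (simp add: orthogonal_basis_inner[OF basis, of x y] \<xi> a(1))

text \<open>The fourth moment at basis vectors; on the right only indices that match in pairs
  survive.\<close>

lemma sum_coordinates4:
  "of_int (\<Sum>x\<in>H. \<xi> x i * \<xi> x j * \<xi> x k * \<xi> x l) * (a i * a j * a k * a l) =
     2 * of_int M * ((b i \<bullet> b j) * (b k \<bullet> b l) + (b i \<bullet> b k) * (b j \<bullet> b l) + (b i \<bullet> b l) * (b j \<bullet> b k))"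
proof -
  have "of_int (\<Sum>x\<in>H. \<xi> x i * \<xi> x j * \<xi> x k * \<xi> x l) * (a i * a j * a k * a l)
      = (\<Sum>x\<in>H. (x \<bullet> b i) * (x \<bullet> b j) * (x \<bullet> b k) * (x \<bullet> b l))"
    unfolding of_int_sum sum_distrib_right by (intro sum.cong refl) (simp add: inner_b mult_ac)
  then show ?thesis by (simp only: sum_inner4)
qed

lemma sum_coordinate_power4: "of_int (\<Sum>x\<in>H. \<xi> x i ^ 4) * (a i)\<^sup>2 = 6 * of_int M"
proof -
  have "of_int (\<Sum>x\<in>H. \<xi> x i * \<xi> x i * \<xi> x i * \<xi> x i) * (a i)\<^sup>2 * (a i)\<^sup>2 = 6 * of_int M * (a i)\<^sup>2"
    using sum_coordinates4[of i i i i] by (simp add: b_orthogonal power2_eq_square mult_ac)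
  moreover have "\<xi> x i * \<xi> x i * \<xi> x i * \<xi> x i = \<xi> x i ^ 4" for x by algebra
  ultimately show ?thesis using a_nonzero[of i] by simp
qed

text \<open>In \<open>sum_coordinate_power4\<close> a nonunit \<open>a i\<close> contributes a
  factor p^2, so p^2 divides 6 M, and 6 is prime to p.\<close>

lemma a_unit:
  assumes "p \<noteq> 2" "p \<noteq> 3" "\<not> p\<^sup>2 dvd M" shows "inverse (a i) \<in> p_integral p"
proof (rule ccontr)
  assume "inverse (a i) \<notin> p_integral p"
  with p_integral_unit[OF a(2)] have z: "a i / of_int p \<in> p_integral p" by blast
  have p0: "of_int p \<noteq> (0 :: real)" using prime by auto
  have "of_int (6 * M) / of_int (p ^ 2) = of_int (\<Sum>x\<in>H. \<xi> x i ^ 4) * (a i / of_int p)\<^sup>2"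
    using sum_coordinate_power4[of i] p0 by (simp add: field_simps)
  also have "\<dots> \<in> p_integral p" using z by (intro p_integral_intros)
  finally have "p ^ 2 dvd 6 * M" by (rule dvd_if_p_integral)
  moreover have "coprime (p ^ 2) 6"
  proof -
    have "\<not> p dvd 2 * 3"
    proof
      assume "p dvd 2 * 3"
      then have "p dvd 2 \<or> p dvd 3" using prime_dvd_mult_iff[OF prime, of 2 3] by blast
      then show False using prime assms(1,2) by (auto simp: primes_dvd_imp_eq)
    qed
    then show ?thesis using prime prime_imp_coprime[of p 6] by simp
  qed
  ultimately have "p\<^sup>2 dvd M" using coprime_dvd_mult_right_iff by blast
  with assms(3) show False by simp
qed

end

section \<open>The lattice and its dual at 3\<close>

locale tight_lines_three = tight_lines_odd H m 3 b a \<xi>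
  for H :: "(real ^ 'n::finite) set" and m :: int and b a \<xi> +
  fixes M' :: int
  assumes m_mod_3: "3 dvd m" and M': "m * (m + 1) = 3 * M'" "\<not> 3 dvd M'"
begin

lemma M_eq: "M = 3 * M'" using M' by (simp add: M_def)

definition cong3 :: "real \<Rightarrow> real \<Rightarrow> bool" where "cong3 r s \<longleftrightarrow> (r - s) / 3 \<in> p_integral 3"

lemma cong3_refl [simp]: "cong3 r r" by (simp add: cong3_def)

lemma cong3_sym: "cong3 r s \<Longrightarrow> cong3 s r"
  using p_integral_uminus[of "(r - s) / 3"] by (simp add: cong3_def minus_divide_left)

lemma cong3_trans: "cong3 r s \<Longrightarrow> cong3 s u \<Longrightarrow> cong3 r u"
  using p_integral_add[of "(r - s) / 3" "(s - u) / 3"] by (simp add: cong3_def diff_divide_distrib)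

lemma cong3_add: "cong3 r s \<Longrightarrow> cong3 r' s' \<Longrightarrow> cong3 (r + r') (s + s')"
proof -
  assume "cong3 r s" "cong3 r' s'"
  then have "(r - s) / 3 + (r' - s') / 3 \<in> p_integral 3"
    unfolding cong3_def by (rule p_integral_add)
  moreover have "(r - s) / 3 + (r' - s') / 3 = (r + r' - (s + s')) / 3"
    by (simp only: add_divide_distrib diff_divide_distrib)
  ultimately show ?thesis by (simp only: cong3_def)
qed

lemma cong3_mult:
  assumes "cong3 r s" "cong3 r' s'" "r \<in> p_integral 3" "s' \<in> p_integral 3"
  shows "cong3 (r * r') (s * s')"
proof -
  have "(r * r' - s * s') / 3 = r * ((r' - s') / 3) + s' * ((r - s) / 3)" by (simp add: field_simps)
  also have "\<dots> \<in> p_integral 3"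
    using assms unfolding cong3_def by (intro p_integral_add p_integral_mult)
  finally show ?thesis by (simp add: cong3_def)
qed

lemma cong3_sum: "(\<And>i. i \<in> S \<Longrightarrow> cong3 (f i) (g i)) \<Longrightarrow> cong3 (sum f S) (sum g S)"
  by (induction S rule: infinite_finite_induct) (auto intro: cong3_add)

lemma cong3_of_int: "cong3 (of_int i) (of_int j) \<longleftrightarrow> 3 dvd i - j"
proof
  assume "cong3 (of_int i) (of_int j)"
  then have "of_int (i - j) / of_int (3 ^ 1) \<in> p_integral 3" by (simp add: cong3_def)
  then show "3 dvd i - j" using dvd_if_p_integral[of "i - j" 1] by simp
next
  assume "3 dvd i - j"
  then obtain k where "i - j = 3 * k" by blast
  then have "(of_int i - of_int j) / 3 = (of_int k :: real)" by (simp flip: of_int_diff)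
  then show "cong3 (of_int i) (of_int j)" by (simp add: cong3_def)
qed

lemma cong3_int_exists:
  assumes "r \<in> p_integral 3" obtains k where "cong3 r (of_int k)"
proof -
  from assms obtain c d where cd: "\<not> 3 dvd d" "d \<noteq> 0" "r * of_int d = of_int c"
    by (metis p_integralE)
  \<comment> \<open>Modulo 3 a unit \<open>d\<close> is its own inverse, so c / d is represented by
    the integer c d.\<close>
  have "3 dvd c - (c * d) * d"
  proof -
    have "3 dvd d - 1 \<or> 3 dvd d + 1" using cd(1) by presburger
    moreover have "d * d - 1 = (d - 1) * (d + 1)" by algebra
    ultimately have "3 dvd d * d - 1" by (metis dvd_mult dvd_mult2)
    then obtain k where "d * d - 1 = 3 * k" by blast
    then have "c - (c * d) * d = 3 * (- c * k)" by algebra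
    then show ?thesis by simp
  qed
  then obtain k where k: "c - (c * d) * d = 3 * k" by blast
  have "(r - of_int (c * d)) / 3 = of_int k / of_int d"
  proof -
    have "(r - of_int (c * d)) * of_int d = of_int (c - (c * d) * d)"
      using cd(3) by (simp add: algebra_simps)
    then show ?thesis unfolding k using cd(2) by (simp add: field_simps)
  qed
  then show thesis
    using p_integralI[OF cd(1)] by (intro that[of "c * d"]) (auto simp: cong3_def)
qed

lemma twice_M'_unit: "inverse (of_int (2 * M')) \<in> p_integral 3"
proof -
  have "\<not> 3 dvd 2 * M'" using M'(2) by presburger
  then show ?thesis by (rule p_integralI[of _ _ _ 1]) (simp add: inverse_eq_divide)
qed

text \<open>Fermat: \<open>k\<^sup>4 \<equiv> k\<^sup>2\<close> modulo 3, so the second and fourth moments of a dual vector agree modulo 3.\<close>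

lemma dual_norm:
  assumes v: "\<And>x. x \<in> H \<Longrightarrow> x \<bullet> v \<in> \<int>" and w: "w = 3 * (v \<bullet> v)" "w \<in> p_integral 3"
  shows "cong3 (w * (w - 1)) 0"
proof -
  have "\<exists>k. x \<bullet> v = of_int k" if "x \<in> H" for x
    by (rule Ints_cases[OF v[OF that]]) blast
  then obtain k where k: "\<And>x. x \<in> H \<Longrightarrow> x \<bullet> v = of_int (k x)"
    by metis
  have "3 dvd (\<Sum>x\<in>H. k x ^ 4 - (k x)\<^sup>2)"
  proof (rule dvd_sum)
    fix x
    have "3 dvd k x - 1 \<or> 3 dvd k x \<or> 3 dvd k x + 1" by presburger
    moreover have "k x ^ 4 - (k x)\<^sup>2 = (k x - 1) * (k x) * (k x + 1) * k x" by algebra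
    ultimately show "3 dvd k x ^ 4 - (k x)\<^sup>2"
      by (elim disjE) (simp_all only: dvd_mult dvd_mult2)
  qed
  then obtain z where z: "(\<Sum>x\<in>H. k x ^ 4 - (k x)\<^sup>2) = 3 * z" by blast
  have "3 * of_int z = (of_int (\<Sum>x\<in>H. k x ^ 4 - (k x)\<^sup>2) :: real)" unfolding z by simp
  also have "\<dots> = (\<Sum>x\<in>H. (x \<bullet> v) ^ 4) - (\<Sum>x\<in>H. (x \<bullet> v)\<^sup>2)"
    unfolding sum_subtractf[symmetric] of_int_sum by (intro sum.cong refl) (simp add: k)
  \<comment> \<open>The moments are 6 M (v,v)^2 = 2 M' w^2 and 2 M t (v,v) = 2 M' t w.\<close>
  also have "\<dots> = of_int (2 * M') * w\<^sup>2 - of_int (2 * M') * of_int t * w"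
    unfolding sum_power2 sum_power4 t_M_defs M_eq w(1) by (simp add: power2_eq_square)
  finally have e: "of_int (2 * M') * (w\<^sup>2 - of_int t * w) = 3 * of_int z" by (simp add: algebra_simps)
  define I :: real where "I = inverse (of_int (2 * M'))"
  have "2 * M' \<noteq> 0" using M'(2) by auto
  then have I: "of_int (2 * M') * I = 1" unfolding I_def by (intro right_inverse) simp
  \<comment> \<open>As 3 divides m, t = 1 mod 3, so w^2 - t w may be replaced by w (w - 1).\<close>
  obtain i where i: "m = 3 * i" using m_mod_3 by blast
  have "of_int t = 1 + 2 * (of_int m :: real)" by (simp add: t_def)
  moreover have "of_int m = 3 * (of_int i :: real)" by (simp add: i)
  ultimately have ti: "of_int t = 1 + 6 * (of_int i :: real)" by simp
  have "w\<^sup>2 - of_int t * w = (of_int (2 * M') * I) * (w\<^sup>2 - of_int t * w)" unfolding I by simp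
  also have "\<dots> = I * (of_int (2 * M') * (w\<^sup>2 - of_int t * w))" by (simp only: mult_ac)
  also have "\<dots> = I * (3 * of_int z)" by (simp only: e)
  finally have "w\<^sup>2 - of_int t * w = I * (3 * of_int z)" .
  then have "(w * (w - 1) - 0) / 3 = of_int z * I + of_int (2 * i) * w"
    by (simp add: ti power2_eq_square algebra_simps)
  also have "\<dots> \<in> p_integral 3"
    using twice_M'_unit w(2) unfolding I_def by (intro p_integral_intros)
  finally show ?thesis by (simp add: cong3_def)
qed

lemma dual_basis_Ints: "x \<in> H \<Longrightarrow> x \<bullet> ((1 / a i) *\<^sub>R b i) \<in> \<int>"
  by (simp add: inner_b)

text \<open>The fourth moment gives S z^2 = 2 M' with M' prime to 3, so \<open>z\<close> is a unit.
  The dual vector \<open>b i\<close> divided by \<open>a i\<close> has norm 1 / (3 z), and for a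
  unit \<open>dual_norm\<close> leaves only 1 / z = 1 mod 3.\<close>

lemma nonunit_coefficient:
  assumes "inverse (a i) \<notin> p_integral 3"
  obtains z where "a i = 3 * z" "z \<in> p_integral 3" "inverse z \<in> p_integral 3" "cong3 z 1" "cong3 (inverse z) 1"
proof
  define z where "z = a i / 3"
  show ai: "a i = 3 * z" by (simp add: z_def)
  have z0: "z \<noteq> 0" using a_nonzero[of i] by (simp add: z_def)
  show z: "z \<in> p_integral 3"
    using assms p_integral_unit[OF a(2), of i] by (auto simp: z_def)
  define S where "S = (\<Sum>x\<in>H. \<xi> x i ^ 4)"
  have "of_int S * z\<^sup>2 = of_int (2 * M')"
    using sum_coordinate_power4[of i] unfolding S_def[symmetric] ai M_eq by simp
  moreover have "2 * M' \<noteq> 0" using M'(2) by auto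
  ultimately have "inverse z = of_int S * z * inverse (of_int (2 * M'))"
    using z0 by (simp add: field_simps power2_eq_square)
  then show zi: "inverse z \<in> p_integral 3"
    using z twice_M'_unit by (metis p_integral_mult p_integral_of_int)
  have "inverse z = 3 * (((1 / a i) *\<^sub>R b i) \<bullet> ((1 / a i) *\<^sub>R b i))"
    using z0 by (simp add: b_orthogonal ai field_simps)
  from dual_norm[OF dual_basis_Ints this zi] have *: "cong3 (inverse z * (inverse z - 1)) 0" .
  then have "cong3 (z * (inverse z * (inverse z - 1))) (z * 0)"
    using z by (intro cong3_mult) auto
  moreover have "z * (inverse z * (inverse z - 1)) = inverse z - 1"
    using z0 by (simp flip: mult.assoc)
  ultimately have "cong3 (inverse z - 1) 0" by simp
  then show c: "cong3 (inverse z) 1" by (simp add: cong3_def)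
  have "cong3 (z * inverse z) (z * 1)" using c z by (intro cong3_mult) auto
  then show "cong3 z 1" using z0 cong3_sym by simp
qed

text \<open>The sum of the two dual vectors would have w = 1 + 1 mod 3, but then w (w - 1) = 2 is
  not 0 mod 3.\<close>

lemma nonunit_unique:
  assumes "inverse (a i) \<notin> p_integral 3" "inverse (a j) \<notin> p_integral 3" shows "i = j"
proof (rule ccontr)
  assume ij: "i \<noteq> j"
  obtain y where y: "a i = 3 * y" "inverse y \<in> p_integral 3" "cong3 (inverse y) 1"
    using nonunit_coefficient[OF assms(1)] by metis
  obtain z where z: "a j = 3 * z" "inverse z \<in> p_integral 3" "cong3 (inverse z) 1"
    using nonunit_coefficient[OF assms(2)] by metis
  have nz: "y \<noteq> 0" "z \<noteq> 0" using a_nonzero[of i] a_nonzero[of j] y(1) z(1) by auto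
  let ?v = "(1 / a i) *\<^sub>R b i + (1 / a j) *\<^sub>R b j"
  define w where "w = inverse y + inverse z"
  have w: "w \<in> p_integral 3" using y z unfolding w_def by (intro p_integral_add)
  have "w = 3 * (?v \<bullet> ?v)"
    using ij nz by (simp add: w_def inner_add b_orthogonal y(1) z(1) field_simps)
  then have *: "cong3 (w * (w - 1)) 0"
    using w dual_basis_Ints by (intro dual_norm[of ?v]) (simp_all add: inner_add_right del: inner_scaleR_right)
  have w2: "cong3 w (1 + 1)" using y z unfolding w_def by (intro cong3_add)
  then have "cong3 (w - 1) 1" by (simp add: cong3_def)
  with w2 w have "cong3 (w * (w - 1)) ((1 + 1) * 1)" by (intro cong3_mult) auto
  with * have "cong3 (of_int 0) (of_int 2)" using cong3_sym cong3_trans by (metis mult.right_neutral of_int_0 of_int_numeral one_add_one)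
  then show False unfolding cong3_of_int by simp
qed

text \<open>Both sides are the squared length of the tensor sum c_x x (x) x: on the left from
  (x,y)^2, which is 1 off the diagonal and t^2 = 4 M + 1 on it, on the right in coordinates.\<close>

lemma key_identity:
  fixes c :: "real ^ 'n \<Rightarrow> int"
  shows "4 * of_int M * (\<Sum>x\<in>H. (of_int (c x))\<^sup>2) + (\<Sum>x\<in>H. of_int (c x))\<^sup>2 =
    (\<Sum>i\<in>UNIV. \<Sum>j\<in>UNIV. a i * a j * (of_int (\<Sum>x\<in>H. c x * \<xi> x i * \<xi> x j))\<^sup>2)" (is "?L = ?R")
proof -
  have sq: "(x \<bullet> y)\<^sup>2 = 1 + (if y = x then 4 * of_int M else 0)" if "x \<in> H" "y \<in> H" for x y
  proof (cases "x = y")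
    case True
    then have "(x \<bullet> y)\<^sup>2 = of_int (t\<^sup>2)" using norm_H[OF that(1)] by (simp add: t_def)
    then show ?thesis using True by (simp add: t_square)
  next
    case False
    then show ?thesis using inner_H[OF that False] by auto
  qed
  have "?L = (\<Sum>x\<in>H. \<Sum>y\<in>H. of_int (c x) * of_int (c y) * (x \<bullet> y)\<^sup>2)"
  proof -
    have "(\<Sum>x\<in>H. \<Sum>y\<in>H. of_int (c x) * of_int (c y) * (x \<bullet> y)\<^sup>2)
        = (\<Sum>x\<in>H. \<Sum>y\<in>H. of_int (c x) * of_int (c y)
            + (if y = x then of_int (c x) * of_int (c y) * 4 * of_int M else 0))"
      by (intro sum.cong refl) (auto simp: sq algebra_simps)
    also have "\<dots> = (\<Sum>x\<in>H. of_int (c x))\<^sup>2 + (\<Sum>x\<in>H. of_int (c x) * of_int (c x) * 4 * of_int M)"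
      using finite_H by (simp add: sum.distrib power2_eq_square sum_product)
    finally show ?thesis
      by (simp add: power2_eq_square sum_distrib_left mult_ac)
  qed
  also have "\<dots> = (\<Sum>x\<in>H. \<Sum>y\<in>H. \<Sum>i\<in>UNIV. \<Sum>j\<in>UNIV.
      (a i * a j) * ((of_int (c x * \<xi> x i * \<xi> x j)) * (of_int (c y * \<xi> y i * \<xi> y j))))"
  proof (intro sum.cong refl)
    fix x y assume "x \<in> H" "y \<in> H"
    show "of_int (c x) * of_int (c y) * (x \<bullet> y)\<^sup>2 = (\<Sum>i\<in>UNIV. \<Sum>j\<in>UNIV.
      (a i * a j) * ((of_int (c x * \<xi> x i * \<xi> x j)) * (of_int (c y * \<xi> y i * \<xi> y j))))"
      unfolding inner_H_expansion[OF \<open>x \<in> H\<close> \<open>y \<in> H\<close>] power2_eq_square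
      unfolding sum_product unfolding sum_distrib_left
      by (intro sum.cong refl) simp
  qed
  also have "\<dots> = (\<Sum>x\<in>H. \<Sum>i\<in>UNIV. \<Sum>y\<in>H. \<Sum>j\<in>UNIV.
      (a i * a j) * ((of_int (c x * \<xi> x i * \<xi> x j)) * (of_int (c y * \<xi> y i * \<xi> y j))))"
    by (intro sum.cong refl sum.swap)
  also have "\<dots> = (\<Sum>i\<in>UNIV. \<Sum>x\<in>H. \<Sum>y\<in>H. \<Sum>j\<in>UNIV.
      (a i * a j) * ((of_int (c x * \<xi> x i * \<xi> x j)) * (of_int (c y * \<xi> y i * \<xi> y j))))"
    by (rule sum.swap)
  also have "\<dots> = (\<Sum>i\<in>UNIV. \<Sum>x\<in>H. \<Sum>j\<in>UNIV. \<Sum>y\<in>H.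
      (a i * a j) * ((of_int (c x * \<xi> x i * \<xi> x j)) * (of_int (c y * \<xi> y i * \<xi> y j))))"
    by (intro sum.cong refl sum.swap)
  also have "\<dots> = (\<Sum>i\<in>UNIV. \<Sum>j\<in>UNIV. \<Sum>x\<in>H. \<Sum>y\<in>H.
      (a i * a j) * ((of_int (c x * \<xi> x i * \<xi> x j)) * (of_int (c y * \<xi> y i * \<xi> y j))))"
    by (intro sum.cong refl sum.swap)
  also have "\<dots> = ?R"
    by (intro sum.cong refl, simp only: of_int_sum power2_eq_square, simp only: sum_product,
        simp only: sum_distrib_left)
  finally show ?thesis .
qed

end

section \<open>Gauss sums over the field with three elements\<close>

lemma three_eq_zero: "(3 :: 3) = 0" by simp

lemma cases_3:
  fixes z :: 3 obtains "z = 0" | "z = 1" | "z = - 1"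
proof -
  have "(2 :: 3) = - 1" by simp
  then show thesis using exhaust_3[of z] three_eq_zero that by metis
qed

lemma UNIV_3': "(UNIV :: 3 set) = {0, 1, - 1}"
  using cases_3 by (auto intro: set_eqI)

lemma neq_3 [simp]: "(0 :: 3) \<noteq> 1" "(1 :: 3) \<noteq> - 1" "(- 1 :: 3) \<noteq> 1" "(- 1 :: 3) \<noteq> 0"
  by simp_all

lemma square_3: "(z :: 3) \<noteq> 0 \<Longrightarrow> z * z = 1"
  by (cases z rule: cases_3) auto

definition \<omega> :: complex where "\<omega> = Complex (- 1 / 2) (sqrt 3 / 2)"

lemma \<omega>_square: "\<omega>\<^sup>2 = - 1 - \<omega>"
  by (simp add: \<omega>_def complex_eq_iff power2_eq_square)

text \<open>The additive character of the field with three elements that sends 1 to the primitive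
  cube root of unity \<open>\<omega>\<close>.\<close>

definition \<chi>3 :: "3 \<Rightarrow> complex" where
  "\<chi>3 z = (if z = 0 then 1 else if z = 1 then \<omega> else \<omega>\<^sup>2)"

lemma \<chi>3_simps [simp]: "\<chi>3 0 = 1" "\<chi>3 1 = \<omega>" "\<chi>3 (- 1) = - 1 - \<omega>"
  by (simp_all add: \<chi>3_def \<omega>_square)

lemma \<chi>3_add: "\<chi>3 (y + z) = \<chi>3 y * \<chi>3 z"
proof -
  have "(2 :: 3) = - 1" "(- 2 :: 3) = 1" by simp_all
  then have e: "\<chi>3 2 = - 1 - \<omega>" "\<chi>3 (- 2) = \<omega>" using \<chi>3_simps by metis+
  have o: "\<omega> * \<omega> = - 1 - \<omega>" using \<omega>_square by (simp add: power2_eq_square)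
  show ?thesis
    by (cases y rule: cases_3; cases z rule: cases_3) (simp_all add: e o algebra_simps)
qed

lemma \<chi>3_sum: "\<chi>3 (sum f S) = (\<Prod>i\<in>S. \<chi>3 (f i))"
  by (induction S rule: infinite_finite_induct) (auto simp: \<chi>3_add)

lemma sum_UNIV_3: "(\<Sum>v\<in>(UNIV :: 3 set). f v) = f 0 + f 1 + f (- 1)"
  by (simp add: UNIV_3' add.assoc)

lemma sum_\<chi>3: "(\<Sum>v\<in>UNIV. \<chi>3 (v * h)) = (if h = 0 then 3 else 0)"
  by (cases h rule: cases_3) (auto simp: sum_UNIV_3)

lemma sum_functions_prod:
  fixes f :: "'a::finite \<Rightarrow> 'b::finite \<Rightarrow> 'c::comm_semiring_1"
  shows "(\<Sum>c\<in>UNIV. \<Prod>x\<in>UNIV. f x (c x)) = (\<Prod>x\<in>UNIV. \<Sum>v\<in>UNIV. f x v)"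
  by (subst prod_sum_PiE) (simp_all add: PiE_UNIV_domain)

text \<open>Orthogonality of characters, one factor for each argument of \<open>c\<close>.\<close>

lemma sum_\<chi>3_linear:
  fixes h :: "'a::finite \<Rightarrow> 3"
  shows "(\<Sum>c\<in>UNIV. \<chi>3 (\<Sum>x\<in>UNIV. c x * h x)) = (if \<forall>x. h x = 0 then 3 ^ CARD('a) else 0)"
proof -
  have "(\<Sum>c\<in>UNIV. \<chi>3 (\<Sum>x\<in>UNIV. c x * h x)) = (\<Prod>x\<in>(UNIV :: 'a set). if h x = 0 then 3 else 0)"
    unfolding \<chi>3_sum sum_functions_prod[of "\<lambda>x v. \<chi>3 (v * h x)"] sum_\<chi>3 ..
  also have "\<dots> = (if \<forall>x. h x = 0 then 3 ^ CARD('a) else 0)"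
  proof (cases "\<forall>x. h x = 0")
    case False
    then obtain x where "h x \<noteq> 0" by blast
    then have "(\<Prod>x\<in>(UNIV :: 'a set). if h x = 0 then 3 else 0) = (0 :: complex)"
      by (intro prod_zero) auto
    with False show ?thesis by simp
  qed simp
  finally show ?thesis .
qed

text \<open>The quadratic Gauss sum; at nonzero \<open>a\<close> its sign records whether
  \<open>a\<close> is a square.\<close>

definition gauss3 :: "3 \<Rightarrow> complex" where
  "gauss3 a = (\<Sum>v\<in>UNIV. \<chi>3 (a * v * v))"

lemma gauss3_simps: "gauss3 0 = 3" "gauss3 1 = \<i> * sqrt 3" "gauss3 (- 1) = - (\<i> * sqrt 3)"
  by (simp_all add: gauss3_def sum_UNIV_3 \<omega>_def complex_eq_iff)

lemma sum_\<chi>3_quadratic: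
  fixes a :: "'a::finite \<Rightarrow> 3"
  shows "(\<Sum>c\<in>UNIV. \<chi>3 (\<Sum>x\<in>UNIV. a x * c x * c x)) = (\<Prod>x\<in>UNIV. gauss3 (a x))"
  unfolding \<chi>3_sum sum_functions_prod[of "\<lambda>x v. \<chi>3 (a x * v * v)"] gauss3_def ..

lemma sum_shift:
  fixes d :: "'a \<Rightarrow> 'b::group_add" and F :: "('a \<Rightarrow> 'b) \<Rightarrow> 'c::comm_monoid_add"
  assumes "\<And>c. c \<in> S \<Longrightarrow> (\<lambda>x. c x + d x) \<in> S" "\<And>c. c \<in> S \<Longrightarrow> (\<lambda>x. c x - d x) \<in> S"
  shows "(\<Sum>c\<in>S. F (\<lambda>x. c x + d x)) = (\<Sum>c\<in>S. F c)"
  by (rule sum.reindex_bij_witness[of _ "\<lambda>c x. c x - d x" "\<lambda>c x. c x + d x"]) (auto simp: assms)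

text \<open>Both averages run over translates: the first over the isotropic space of quadratic functions
  \<open>\<Sum>i j. A i j \<xi> i \<xi> j\<close>, which restricts the sum to its orthogonal complement \<open>C\<close>, the second over
  the linear functions times \<open>\<kappa>\<close>, which makes \<open>\<Sum>x. c x \<xi> x i \<kappa> x\<close> equidistributed on \<open>C\<close>.\<close>

lemma gauss_sum_reduction:
  fixes \<xi> :: "'h::finite \<Rightarrow> 'k::finite \<Rightarrow> 3" and \<kappa> :: "'h \<Rightarrow> 3" and a e :: "'k \<Rightarrow> 3" and \<mu> :: 3
  assumes \<mu>: "\<mu> \<noteq> 0"
    and iso: "\<And>i j k l. (\<Sum>x\<in>UNIV. \<xi> x i * \<xi> x j * \<xi> x k * \<xi> x l) = 0"
    and orth: "\<And>i j k. (\<Sum>x\<in>UNIV. \<xi> x i * \<xi> x j * \<xi> x k * \<kappa> x) = 0"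
    and diag: "\<And>i j. (\<Sum>x\<in>UNIV. \<xi> x i * \<xi> x j * \<kappa> x * \<kappa> x) = (if i = j then e i else 0)"
    and e: "\<And>i. a i \<noteq> 0 \<Longrightarrow> e i \<noteq> 0"
    and key: "\<And>c. (\<And>i j. (\<Sum>x\<in>UNIV. c x * \<xi> x i * \<xi> x j) = 0) \<Longrightarrow>
      \<mu> * (\<Sum>x\<in>UNIV. c x * c x) =
      - (\<Sum>i\<in>UNIV. a i * (\<Sum>x\<in>UNIV. c x * \<xi> x i * \<kappa> x) * (\<Sum>x\<in>UNIV. c x * \<xi> x i * \<kappa> x))"
  shows "\<exists>N > 0. 3 ^ CARD('k) * gauss3 \<mu> ^ CARD('h) = of_nat N * (\<Prod>i\<in>UNIV. gauss3 (- a i))"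
proof -
  define \<phi> where "\<phi> c i j = (\<Sum>x\<in>UNIV. c x * \<xi> x i * \<xi> x j)" for c i j
  define \<eta> where "\<eta> c i = (\<Sum>x\<in>UNIV. c x * \<xi> x i * \<kappa> x)" for c i
  define C where "C = {c. \<forall>i j. \<phi> c i j = 0}"
  define q where "q A x = (\<Sum>p\<in>UNIV. A p * \<xi> x (fst p) * \<xi> x (snd p))" for A :: "'k \<times> 'k \<Rightarrow> 3" and x
  define Q where "Q c = \<mu> * (\<Sum>x\<in>UNIV. c x * c x)" for c :: "'h \<Rightarrow> 3"
  define F where "F w = \<chi>3 (\<Sum>i\<in>UNIV. - a i * w i * w i)" for w :: "'k \<Rightarrow> 3"
  have fin: "finite S" for S :: "('h \<Rightarrow> 3) set" by (rule finite_subset[OF subset_UNIV]) simp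
  \<comment> \<open>The functions \<open>q A\<close> form a totally isotropic space, so shifting by
    them changes \<open>Q\<close> only by a term linear in \<open>A\<close>.\<close>
  have qq: "(\<Sum>x\<in>UNIV. q A x * q A x) = 0" for A
  proof -
    have "(\<Sum>x\<in>UNIV. q A x * q A x) = (\<Sum>x\<in>UNIV. \<Sum>p\<in>UNIV. \<Sum>r\<in>UNIV.
        A p * A r * (\<xi> x (fst p) * \<xi> x (snd p) * \<xi> x (fst r) * \<xi> x (snd r)))"
      unfolding q_def sum_product by (intro sum.cong refl) (simp only: mult_ac)
    also have "\<dots> = (\<Sum>p\<in>UNIV. \<Sum>x\<in>UNIV. \<Sum>r\<in>UNIV.
        A p * A r * (\<xi> x (fst p) * \<xi> x (snd p) * \<xi> x (fst r) * \<xi> x (snd r)))"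
      by (rule sum.swap)
    also have "\<dots> = (\<Sum>p\<in>UNIV. \<Sum>r\<in>UNIV. \<Sum>x\<in>UNIV.
        A p * A r * (\<xi> x (fst p) * \<xi> x (snd p) * \<xi> x (fst r) * \<xi> x (snd r)))"
      by (intro sum.cong refl sum.swap)
    also have "\<dots> = 0" unfolding sum_distrib_left[symmetric] iso by simp
    finally show ?thesis .
  qed
  have cq: "(\<Sum>x\<in>UNIV. c x * q A x) = (\<Sum>p\<in>UNIV. A p * \<phi> c (fst p) (snd p))" for c A
  proof -
    have "(\<Sum>x\<in>UNIV. c x * q A x) = (\<Sum>x\<in>UNIV. \<Sum>p\<in>UNIV. A p * (c x * \<xi> x (fst p) * \<xi> x (snd p)))"
      unfolding q_def sum_distrib_left by (intro sum.cong refl) (simp only: mult_ac)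
    also have "\<dots> = (\<Sum>p\<in>UNIV. \<Sum>x\<in>UNIV. A p * (c x * \<xi> x (fst p) * \<xi> x (snd p)))"
      by (rule sum.swap)
    finally show ?thesis by (simp only: \<phi>_def sum_distrib_left)
  qed
  have Q_shift: "Q (\<lambda>x. c x + q A x) = Q c + (\<Sum>p\<in>UNIV. A p * (2 * \<mu> * \<phi> c (fst p) (snd p)))" for c A
  proof -
    have "Q (\<lambda>x. c x + q A x) = \<mu> * ((\<Sum>x\<in>UNIV. c x * c x) + 2 * (\<Sum>x\<in>UNIV. c x * q A x) + (\<Sum>x\<in>UNIV. q A x * q A x))"
      unfolding Q_def by (simp only: sum_distrib_left sum.distrib[symmetric]) (simp only: algebra_simps mult_2)
    then show ?thesis unfolding qq cq by (simp add: Q_def sum_distrib_left algebra_simps)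
  qed
  have two: "2 * \<mu> \<noteq> 0" using \<mu> by (cases \<mu> rule: cases_3) auto
  have two': "2 * \<mu> * z = 0 \<longleftrightarrow> z = 0" for z
    using two by (cases "2 * \<mu>" rule: cases_3) auto
  \<comment> \<open>Averaging over all \<open>A\<close> sums a linear character in \<open>A\<close>,
    which gives 0 unless every \<open>\<phi> c i j\<close> vanishes, that is, unless
    \<open>c \<in> C\<close>.\<close>
  have S1: "3 ^ CARD('k \<times> 'k) * (\<Sum>c\<in>UNIV. \<chi>3 (Q c)) = 3 ^ CARD('k \<times> 'k) * (\<Sum>c\<in>C. \<chi>3 (Q c))"
  proof -
    have "3 ^ CARD('k \<times> 'k) * (\<Sum>c\<in>UNIV. \<chi>3 (Q c))
        = (\<Sum>A\<in>(UNIV :: ('k \<times> 'k \<Rightarrow> 3) set). \<Sum>c\<in>UNIV. \<chi>3 (Q (\<lambda>x. c x + q A x)))"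
      by (subst sum_shift) (simp_all add: card_fun)
    also have "\<dots> = (\<Sum>c\<in>UNIV. \<Sum>A\<in>(UNIV :: ('k \<times> 'k \<Rightarrow> 3) set). \<chi>3 (Q (\<lambda>x. c x + q A x)))"
      by (rule sum.swap)
    also have "\<dots> = (\<Sum>c\<in>UNIV. \<chi>3 (Q c) * (if \<forall>p. 2 * \<mu> * \<phi> c (fst p) (snd p) = 0 then 3 ^ CARD('k \<times> 'k) else 0))"
      unfolding Q_shift \<chi>3_add sum_distrib_left[symmetric] sum_\<chi>3_linear ..
    also have "\<dots> = (\<Sum>c\<in>UNIV. if c \<in> C then 3 ^ CARD('k \<times> 'k) * \<chi>3 (Q c) else 0)"
      by (intro sum.cong refl) (auto simp: two' C_def)
    also have "\<dots> = (\<Sum>c\<in>C. 3 ^ CARD('k \<times> 'k) * \<chi>3 (Q c))"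
      by (simp add: sum.If_cases fin)
    finally show ?thesis by (simp only: sum_distrib_left)
  qed
  have "(\<Sum>c\<in>UNIV. \<chi>3 (Q c)) = gauss3 \<mu> ^ CARD('h)"
    using sum_\<chi>3_quadratic[of "\<lambda>_ :: 'h. \<mu>"] by (simp add: Q_def sum_distrib_left mult_ac)
  then have S2: "gauss3 \<mu> ^ CARD('h) = (\<Sum>c\<in>C. \<chi>3 (Q c))"
    using S1 by simp
  have QF: "\<chi>3 (Q c) = F (\<eta> c)" if "c \<in> C" for c
  proof -
    have "Q c = - (\<Sum>i\<in>UNIV. a i * \<eta> c i * \<eta> c i)"
      unfolding Q_def \<eta>_def by (rule key) (use that in \<open>simp add: C_def \<phi>_def\<close>)
    then show ?thesis by (simp add: F_def sum_negf)
  qed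
  \<comment> \<open>The weight \<open>e i\<close> makes \<open>\<eta> (d w) i\<close> equal to
    \<open>w i * (e i * e i)\<close>, and nonzero elements have square 1. Where
    \<open>e i = 0\<close> also \<open>a i = 0\<close>, and \<open>F\<close> does not see that
    coordinate.\<close>
  define d where "d w x = (\<Sum>i\<in>UNIV. (w i * e i) * \<xi> x i * \<kappa> x)" for w :: "'k \<Rightarrow> 3" and x
  have \<phi>d: "\<phi> (d w) i j = 0" for w i j
  proof -
    have "\<phi> (d w) i j = (\<Sum>x\<in>UNIV. \<Sum>k\<in>UNIV. (w k * e k) * (\<xi> x k * \<xi> x i * \<xi> x j * \<kappa> x))"
      unfolding \<phi>_def d_def sum_distrib_right by (intro sum.cong refl) (simp only: mult_ac)
    also have "\<dots> = (\<Sum>k\<in>UNIV. \<Sum>x\<in>UNIV. (w k * e k) * (\<xi> x k * \<xi> x i * \<xi> x j * \<kappa> x))"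
      by (rule sum.swap)
    also have "\<dots> = 0" unfolding sum_distrib_left[symmetric] orth by simp
    finally show ?thesis .
  qed
  have \<eta>d: "\<eta> (d w) i = w i * (e i * e i)" for w i
  proof -
    have "\<eta> (d w) i = (\<Sum>x\<in>UNIV. \<Sum>k\<in>UNIV. (w k * e k) * (\<xi> x k * \<xi> x i * \<kappa> x * \<kappa> x))"
      unfolding \<eta>_def d_def sum_distrib_right by (intro sum.cong refl) (simp only: mult_ac)
    also have "\<dots> = (\<Sum>k\<in>UNIV. \<Sum>x\<in>UNIV. (w k * e k) * (\<xi> x k * \<xi> x i * \<kappa> x * \<kappa> x))"
      by (rule sum.swap)
    also have "\<dots> = (\<Sum>k\<in>UNIV. if k = i then w k * e k * e k else 0)"
      unfolding sum_distrib_left[symmetric] diag by (intro sum.cong refl) auto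
    finally show ?thesis by (simp add: mult_ac)
  qed
  have lin: "\<phi> (\<lambda>x. c x + d x) i j = \<phi> c i j + \<phi> d i j" "\<phi> (\<lambda>x. c x - d x) i j = \<phi> c i j - \<phi> d i j"
    "\<eta> (\<lambda>x. c x + d x) i = \<eta> c i + \<eta> d i" for c d i j
    by (simp_all add: \<phi>_def \<eta>_def algebra_simps sum.distrib sum_subtractf)
  have FF: "F (\<eta> (\<lambda>x. c x + d w x)) = F (\<lambda>i. w i + \<eta> c i)" for c w
    unfolding F_def
  proof (intro arg_cong[of _ _ \<chi>3] sum.cong refl)
    fix i
    have "a i = 0 \<or> e i * e i = 1" using e square_3 by blast
    then show "- a i * \<eta> (\<lambda>x. c x + d w x) i * \<eta> (\<lambda>x. c x + d w x) i = - a i * (w i + \<eta> c i) * (w i + \<eta> c i)"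
      unfolding lin \<eta>d by (auto simp: add.commute)
  qed
  \<comment> \<open>Averaging over \<open>w\<close> replaces \<open>\<eta> c\<close> by a uniformly
    distributed argument, whence the factor \<open>card C\<close>.\<close>
  have "3 ^ CARD('k) * (\<Sum>c\<in>C. F (\<eta> c)) = (\<Sum>w\<in>(UNIV :: ('k \<Rightarrow> 3) set). \<Sum>c\<in>C. F (\<eta> (\<lambda>x. c x + d w x)))"
    by (subst sum_shift) (auto simp: card_fun C_def lin \<phi>d)
  also have "\<dots> = (\<Sum>c\<in>C. \<Sum>w\<in>(UNIV :: ('k \<Rightarrow> 3) set). F (\<lambda>i. w i + \<eta> c i))"
    unfolding FF by (rule sum.swap)
  also have "\<dots> = of_nat (card C) * (\<Sum>w\<in>UNIV. F w)"
    by (subst sum_shift) auto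
  also have "(\<Sum>w\<in>UNIV. F w) = (\<Prod>i\<in>UNIV. gauss3 (- a i))"
    unfolding F_def by (rule sum_\<chi>3_quadratic)
  finally have "3 ^ CARD('k) * gauss3 \<mu> ^ CARD('h) = of_nat (card C) * (\<Prod>i\<in>UNIV. gauss3 (- a i))"
    unfolding S2 using QF by simp
  moreover have "(\<lambda>_. 0) \<in> C" by (simp add: C_def \<phi>_def)
  then have "card C > 0" using fin[of C] by (auto simp: card_gt_0_iff)
  ultimately show ?thesis by blast
qed

text \<open>For a = 1 or a = - 1, \<open>gauss3 (- a)\<close> is - i sqrt 3 times that sign, so the
  signs multiply as the coefficients do. That the product is nonzero is carried along for the
  induction.\<close>

lemma prod_gauss3:
  assumes "finite S" "\<And>i. i \<in> S \<Longrightarrow> a i \<noteq> 0"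
  shows "(\<Prod>i\<in>S. gauss3 (- a i)) = (if (\<Prod>i\<in>S. a i) = 1 then 1 else - 1) * (- (\<i> * sqrt 3)) ^ card S
    \<and> (\<Prod>i\<in>S. a i) \<noteq> 0"
  using assms
proof (induction S rule: finite_induct)
  case (insert x S)
  then have IH: "(\<Prod>i\<in>S. gauss3 (- a i)) = (if (\<Prod>i\<in>S. a i) = 1 then 1 else - 1) * (- (\<i> * sqrt 3)) ^ card S"
    "(\<Prod>i\<in>S. a i) \<noteq> 0" by auto
  have "a x \<noteq> 0" using insert.prems by simp
  then show ?case
    using IH insert.hyps
    by (cases "a x" rule: cases_3; cases "\<Prod>i\<in>S. a i" rule: cases_3) (auto simp: gauss3_simps)
qed simp

text \<open>There are \<open>k \<equiv> 6\<close> modulo 8 nonzero coefficients and \<open>s\<close> is divisible by 4, so the two sides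
  of the reduction formula have different signs unless the discriminant is \<open>-1\<close>.\<close>

lemma discriminant_from_gauss_sum:
  fixes a :: "'k::finite \<Rightarrow> 3"
  assumes \<mu>: "\<mu> \<noteq> 0" and s: "4 dvd s" and k: "CARD('k) = 8 * r + 7"
    and a: "a i0 = 0" "\<And>i. i \<noteq> i0 \<Longrightarrow> a i \<noteq> 0"
    and N: "N > 0" "3 ^ CARD('k) * gauss3 \<mu> ^ s = of_nat N * (\<Prod>i\<in>UNIV. gauss3 (- a i))"
  shows "(\<Prod>i\<in>UNIV - {i0}. a i) = - 1"
proof -
  have i2: "(\<i> * sqrt 3)\<^sup>2 = - 3" by (simp add: power_mult_distrib flip: of_real_power)
  obtain l where l: "s = 4 * l" using s by blast
  \<comment> \<open>\<open>gauss3 \<mu>\<close> is a square root of - 3; as 4 divides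
    \<open>s\<close>, the left side of the reduction formula is positive.\<close>
  have "gauss3 \<mu> ^ 4 = 9"
  proof -
    have "gauss3 \<mu> ^ 4 = (gauss3 \<mu> ^ 2)\<^sup>2" by (simp flip: power_mult)
    also have "gauss3 \<mu> ^ 2 = - 3"
      using \<mu> i2 by (cases \<mu> rule: cases_3) (auto simp: gauss3_simps)
    finally show ?thesis by simp
  qed
  then have L: "gauss3 \<mu> ^ s = of_real (9 ^ l)" by (simp add: l power_mult)
  \<comment> \<open>There remain 8 r + 6 factors, and (i sqrt 3)^(8 r + 6) = (- 3)^(4 r + 3) is
    negative.\<close>
  have c: "card (UNIV - {i0}) = 2 * (4 * r + 3)" using k by (simp add: card_Diff_subset)
  have pw: "(- (\<i> * sqrt 3)) ^ (2 * (4 * r + 3)) = of_real (- (3 ^ (4 * r + 3)))"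
    unfolding power_mult by (simp add: i2)
  have "(\<Prod>i\<in>UNIV. gauss3 (- a i)) = 3 * (\<Prod>i\<in>UNIV - {i0}. gauss3 (- a i))"
    by (subst prod.remove[of UNIV i0]) (auto simp: a(1) gauss3_simps)
  then have P: "(\<Prod>i\<in>UNIV. gauss3 (- a i)) =
      of_real (3 * ((if (\<Prod>i\<in>UNIV - {i0}. a i) = 1 then 1 else - 1) * - (3 ^ (4 * r + 3))))"
    and nz: "(\<Prod>i\<in>UNIV - {i0}. a i) \<noteq> 0"
    using prod_gauss3[of "UNIV - {i0}" a] a(2) unfolding c pw by auto
  have "(\<Prod>i\<in>UNIV - {i0}. a i) \<noteq> 1"
  proof
    assume "(\<Prod>i\<in>UNIV - {i0}. a i) = 1"
    then have "of_real (3 ^ CARD('k) * 9 ^ l) = (of_real (real N * (3 * - (3 ^ (4 * r + 3)))) :: complex)"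
      using N(2) unfolding L P by simp
    then have "3 ^ CARD('k) * 9 ^ l = real N * (3 * - (3 ^ (4 * r + 3)))"
      by (simp only: of_real_eq_iff)
    moreover have "3 ^ CARD('k) * 9 ^ l > (0 :: real)" by simp
    moreover have "real N * (3 * - (3 ^ (4 * r + 3))) < 0" using N(1) by simp
    ultimately show False by linarith
  qed
  with nz show ?thesis by (cases "\<Prod>i\<in>UNIV - {i0}. a i" rule: cases_3) auto
qed

section \<open>The discriminant at 3\<close>

text \<open>Unordered pairs with repetition number n (n + 1) / 2, as many as the lines, so they
  index the lines where \<open>gauss_sum_reduction\<close> asks for a finite type.\<close>

instance uprod :: (finite) finite
proof
  have "(UNIV :: 'a uprod set) = range (\<lambda>(x, y). Upair x y)"
  proof (intro equalityI subsetI)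
    fix z :: "'a uprod"
    obtain x y where "z = Upair x y" by (rule uprod_exhaust)
    then show "z \<in> range (\<lambda>(x, y). Upair x y)" by (intro range_eqI[of _ _ "(x, y)"]) simp
  qed simp
  then show "finite (UNIV :: 'a uprod set)" by simp
qed

lemma of_int_3_eq_0_iff: "(of_int k :: 3) = 0 \<longleftrightarrow> 3 dvd k"
  by (simp add: of_int_eq_0_iff_char_dvd)

lemma of_int_3_surj: "\<exists>k. of_int k = (z :: 3)"
  by (cases z rule: cases_3) (auto intro: exI[of _ 0] exI[of _ 1] exI[of _ "- 1"])

section \<open>Coordinates of the lines modulo 3\<close>

context tight_lines_three
begin

context
  fixes i0 :: 'n and z :: real and A :: "'n \<Rightarrow> int"
  assumes a_i0: "a i0 = 3 * z" and z: "z \<in> p_integral 3" "cong3 z 1"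
    and units: "\<And>i. i \<noteq> i0 \<Longrightarrow> inverse (a i) \<in> p_integral 3"
    and A: "\<And>i. cong3 (a i) (of_int (A i))"
begin

text \<open>In \<open>sum_coordinates4\<close> the factor M carries a 3, while all four coefficients
  are units.\<close>

lemma coordinates_isotropic:
  assumes "i \<noteq> i0" "j \<noteq> i0" "k \<noteq> i0" "l \<noteq> i0"
  shows "3 dvd (\<Sum>x\<in>H. \<xi> x i * \<xi> x j * \<xi> x k * \<xi> x l)"
proof -
  define S where "S = (\<Sum>x\<in>H. \<xi> x i * \<xi> x j * \<xi> x k * \<xi> x l)"
  define B where "B = (b i \<bullet> b j) * (b k \<bullet> b l) + (b i \<bullet> b k) * (b j \<bullet> b l) + (b i \<bullet> b l) * (b j \<bullet> b k)"
  have "of_int S * (a i * a j * a k * a l) = 2 * of_int M * B"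
    unfolding S_def B_def by (rule sum_coordinates4)
  then have "of_int S / of_int (3 ^ 1) = of_int (2 * M') * B * (inverse (a i) * inverse (a j) * inverse (a k) * inverse (a l))"
    by (simp add: M_eq field_simps)
  also have "\<dots> \<in> p_integral 3"
    unfolding B_def b_orthogonal using a(2) units assms
    by (intro p_integral_mult p_integral_add) (auto simp del: of_int_mult)
  finally show ?thesis using dvd_if_p_integral[of S 1] by (simp add: S_def)
qed

text \<open>Each of the three pairings in \<open>sum_coordinates4\<close> matches \<open>i0\<close>
  with a different index.\<close>

lemma coordinates_orthogonal:
  assumes "i \<noteq> i0" "j \<noteq> i0" "k \<noteq> i0"
  shows "(\<Sum>x\<in>H. \<xi> x i * \<xi> x j * \<xi> x k * \<xi> x i0) = 0"
proof -
  have "of_int (\<Sum>x\<in>H. \<xi> x i * \<xi> x j * \<xi> x k * \<xi> x i0) * (a i * a j * a k * a i0) = 0"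
    unfolding sum_coordinates4 using assms by (simp add: b_orthogonal)
  then show ?thesis by (simp del: of_int_sum)
qed

lemma coordinates_diagonal:
  assumes "i \<noteq> i0" "j \<noteq> i0" "i \<noteq> j"
  shows "(\<Sum>x\<in>H. \<xi> x i * \<xi> x j * \<xi> x i0 * \<xi> x i0) = 0"
proof -
  have "of_int (\<Sum>x\<in>H. \<xi> x i * \<xi> x j * \<xi> x i0 * \<xi> x i0) * (a i * a j * a i0 * a i0) = 0"
    unfolding sum_coordinates4 using assms by (simp add: b_orthogonal)
  then show ?thesis by (simp del: of_int_sum)
qed

text \<open>The 3 in \<open>a i0\<close> cancels the one in 2 M, leaving K a_i z = 2 M', which is
  prime to 3.\<close>

lemma coordinates_diagonal_nonzero:
  assumes "i \<noteq> i0" shows "\<not> 3 dvd (\<Sum>x\<in>H. \<xi> x i * \<xi> x i * \<xi> x i0 * \<xi> x i0)"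
proof
  define K where "K = (\<Sum>x\<in>H. \<xi> x i * \<xi> x i * \<xi> x i0 * \<xi> x i0)"
  assume "3 dvd (\<Sum>x\<in>H. \<xi> x i * \<xi> x i * \<xi> x i0 * \<xi> x i0)"
  then obtain k where k: "K = 3 * k" unfolding K_def by blast
  have "of_int K * (a i * a i * a i0 * a i0) = 2 * of_int M * (a i * a i0)"
    unfolding K_def sum_coordinates4 using assms by (simp add: b_orthogonal)
  then have "of_int K * (a i * a i0) = 2 * of_int M"
    using a_nonzero[of i] a_nonzero[of i0] by (simp add: field_simps)
  then have "of_int (2 * M') / of_int (3 ^ 1) = of_int k * a i * z"
    using k by (simp add: a_i0 M_eq mult_ac)
  also have "\<dots> \<in> p_integral 3" using a(2) z by (intro p_integral_intros)
  finally have "3 dvd 2 * M'" using dvd_if_p_integral[of "2 * M'" 1] by simp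
  then show False using M'(2) by presburger
qed

text \<open>\<open>key_identity\<close> is divided by 3 and read modulo 3. On the right the entries
  away from \<open>i0\<close> have squares divisible by 9, the corner carries the square of
  \<open>a i0 = 3 z\<close>, and only the cross terms remain, twice and with factor 3 z. On the left
  the square of the sum of \<open>c\<close> drops out.\<close>

lemma coordinates_key:
  fixes c :: "real ^ 'n \<Rightarrow> int"
  assumes c: "\<And>i j. i \<noteq> i0 \<Longrightarrow> j \<noteq> i0 \<Longrightarrow> 3 dvd (\<Sum>x\<in>H. c x * \<xi> x i * \<xi> x j)"
  shows "3 dvd M' * (\<Sum>x\<in>H. (c x)\<^sup>2) + (\<Sum>i\<in>UNIV - {i0}. A i * (\<Sum>x\<in>H. c x * \<xi> x i * \<xi> x i0)\<^sup>2)"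
proof -
  define T where "T i j = (\<Sum>x\<in>H. c x * \<xi> x i * \<xi> x j)" for i j
  define X where "X = (\<Sum>x\<in>H. (c x)\<^sup>2)"
  define s where "s = (\<Sum>x\<in>H. c x)"
  let ?U = "UNIV - {i0}"
  have sym: "T i j = T j i" for i j unfolding T_def by (intro sum.cong refl) (simp only: mult_ac)
  have div: "of_int (T i j) / 3 \<in> p_integral 3" if "i \<noteq> i0" "j \<noteq> i0" for i j
    using c[OF that] unfolding T_def[symmetric] by auto
  \<comment> \<open>The trace of the tensor: as (x,x) = t = 1 mod 3, it shows that 3 divides
    \<open>s\<close>.\<close>
  have "of_int (t * s) = (\<Sum>i\<in>UNIV. a i * of_int (T i i))"
  proof -
    have "of_int (t * s) = (\<Sum>x\<in>H. of_int (c x) * (x \<bullet> x))"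
    proof -
      have "of_int (t * s) = (\<Sum>x\<in>H. of_int (c x)) * real_of_int t"
        unfolding s_def of_int_mult of_int_sum by (rule mult.commute)
      also have "\<dots> = (\<Sum>x\<in>H. of_int (c x) * (x \<bullet> x))"
        unfolding sum_distrib_right by (intro sum.cong refl) (simp only: norm_H t_def)
      finally show ?thesis .
    qed
    also have "\<dots> = (\<Sum>x\<in>H. \<Sum>i\<in>UNIV. a i * (of_int (c x * \<xi> x i * \<xi> x i)))"
      by (intro sum.cong refl) (simp add: inner_H_expansion sum_distrib_left mult_ac)
    also have "\<dots> = (\<Sum>i\<in>UNIV. \<Sum>x\<in>H. a i * (of_int (c x * \<xi> x i * \<xi> x i)))"
      by (rule sum.swap)
    finally show ?thesis by (simp only: T_def of_int_sum sum_distrib_left)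
  qed
  also have "\<dots> = a i0 * of_int (T i0 i0) + (\<Sum>i\<in>?U. a i * of_int (T i i))"
    by (subst sum.remove[of UNIV i0]) auto
  finally have "of_int (t * s) / of_int (3 ^ 1) = z * of_int (T i0 i0) + (\<Sum>i\<in>?U. a i * (of_int (T i i) / 3))"
    by (simp add: a_i0 sum_divide_distrib add_divide_distrib)
  also have "\<dots> \<in> p_integral 3"
    using z a(2) div by (intro p_integral_intros) auto
  finally have "3 dvd t * s" using dvd_if_p_integral[of "t * s" 1] by simp
  moreover have "t * s = s + 2 * m * s" by (simp add: t_def algebra_simps)
  moreover have "3 dvd 2 * m * s" using m_mod_3 by simp
  ultimately have "3 dvd s" using dvd_add_left_iff by metis
  then obtain k where k: "s = 3 * k" by blast
  define L where "L = 4 * of_int M * (\<Sum>x\<in>H. (of_int (c x))\<^sup>2) + (\<Sum>x\<in>H. real_of_int (c x))\<^sup>2"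
  have L: "L / 3 = of_int (4 * M' * X) + 3 * of_int (k\<^sup>2)"
  proof -
    have "(\<Sum>x\<in>H. real_of_int (c x)) = of_int s" by (simp add: s_def)
    then show ?thesis
      unfolding L_def M_eq X_def by (simp add: k power2_eq_square)
  qed
  have cL: "cong3 (of_int (4 * M' * X)) (L / 3)"
    unfolding L cong3_def by (simp add: p_integral_uminus flip: of_int_power)
  define Y where "Y = (\<Sum>i\<in>?U. a i * (of_int (T i i0))\<^sup>2)"
  define W where "W = (\<Sum>i\<in>?U. \<Sum>j\<in>?U. a i * a j * (of_int (T i j) / 3)\<^sup>2)"
  have "L = (\<Sum>i\<in>UNIV. \<Sum>j\<in>UNIV. a i * a j * (of_int (T i j))\<^sup>2)"
    unfolding L_def T_def by (rule key_identity)
  also have "\<dots> = (\<Sum>j\<in>UNIV. a i0 * a j * (of_int (T i0 j))\<^sup>2)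
      + (\<Sum>i\<in>?U. a i * a i0 * (of_int (T i i0))\<^sup>2 + (\<Sum>j\<in>?U. a i * a j * (of_int (T i j))\<^sup>2))"
    by (subst sum.remove[of UNIV i0]) (auto intro!: sum.cong sum.remove)
  also have "(\<Sum>j\<in>UNIV. a i0 * a j * (of_int (T i0 j))\<^sup>2)
      = a i0 * a i0 * (of_int (T i0 i0))\<^sup>2 + (\<Sum>j\<in>?U. a i0 * a j * (of_int (T i0 j))\<^sup>2)"
    by (subst sum.remove[of UNIV i0]) auto
  also have "(\<Sum>j\<in>?U. a i0 * a j * (of_int (T i0 j))\<^sup>2) = a i0 * Y"
    unfolding Y_def sum_distrib_left sym[of i0] by (simp only: mult.assoc)
  also have "(\<Sum>i\<in>?U. a i * a i0 * (of_int (T i i0))\<^sup>2 + (\<Sum>j\<in>?U. a i * a j * (of_int (T i j))\<^sup>2))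
      = a i0 * Y + 9 * W"
  proof -
    have "(\<Sum>i\<in>?U. a i * a i0 * (of_int (T i i0))\<^sup>2) = a i0 * Y"
      unfolding Y_def sum_distrib_left by (intro sum.cong refl) (simp only: mult_ac)
    moreover have "(\<Sum>i\<in>?U. \<Sum>j\<in>?U. a i * a j * (of_int (T i j))\<^sup>2) = 9 * W"
      unfolding W_def sum_distrib_left by (intro sum.cong refl) (simp add: power2_eq_square)
    ultimately show ?thesis by (simp only: sum.distrib)
  qed
  finally have "L / 3 = 3 * (z\<^sup>2 * (of_int (T i0 i0))\<^sup>2 + W) + 2 * (z * Y)"
    unfolding a_i0 by (simp add: power2_eq_square)
  moreover have "z\<^sup>2 * (of_int (T i0 i0))\<^sup>2 + W \<in> p_integral 3"
    using z a(2) div unfolding W_def by (intro p_integral_intros) auto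
  moreover have "(3 * W' + 2 * (z * Y) - 2 * (z * Y)) / 3 = W'" for W' by simp
  ultimately have c1: "cong3 (L / 3) (2 * (z * Y))" by (simp only: cong3_def)
  have Yint: "Y \<in> p_integral 3" using a(2) unfolding Y_def by (intro p_integral_intros) auto
  define Z where "Z = (\<Sum>i\<in>?U. A i * (T i i0)\<^sup>2)"
  have YZ: "cong3 Y (of_int Z)"
    unfolding Y_def Z_def of_int_sum of_int_mult of_int_power
    by (intro cong3_sum cong3_mult A cong3_refl a p_integral_intros)
  have "cong3 (z * Y) (1 * of_int Z)" using YZ z by (intro cong3_mult) auto
  then have "cong3 (of_int 2 * (z * Y)) (of_int 2 * of_int Z)"
    by (intro cong3_mult cong3_refl p_integral_of_int) simp
  then have "cong3 (of_int (4 * M' * X)) (of_int (2 * Z))"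
    using cong3_trans[OF cL c1] cong3_trans by simp
  then have "3 dvd 4 * M' * X - 2 * Z" by (simp only: cong3_of_int)
  then obtain r where r: "4 * M' * X - 2 * Z = 3 * r" by blast
  \<comment> \<open>Modulo 3 both 4 and - 2 are 1, so the difference is the required sum.\<close>
  then have "M' * X + Z = 3 * (r - M' * X + Z)" by (simp add: algebra_simps)
  then have "3 dvd M' * X + Z" by (rule dvdI)
  then show ?thesis by (simp only: X_def Z_def T_def)
qed

end

lemma cong3_prod:
  assumes "\<And>i. i \<in> S \<Longrightarrow> cong3 (f i) (g i)" "\<And>i. i \<in> S \<Longrightarrow> f i \<in> p_integral 3" "\<And>i. i \<in> S \<Longrightarrow> g i \<in> p_integral 3"
  shows "cong3 (prod f S) (prod g S) \<and> prod f S \<in> p_integral 3 \<and> prod g S \<in> p_integral 3"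
  using assms
  by (induction S rule: infinite_finite_induct) (auto intro: cong3_mult p_integral_mult)

text \<open>Reduced modulo 3, the lines fit \<open>gauss_sum_reduction\<close>: the coordinate at
  \<open>i0\<close> becomes \<open>\<kappa>\<close> and the other coordinates become
  \<open>x3\<close>.\<close>

lemma three_adic_discriminant:
  assumes "inverse (a i0) \<notin> p_integral 3" and even_M: "even M"
  shows "cong3 (\<Prod>i\<in>UNIV - {i0}. a i) (- 1)"
proof -
  obtain z where z: "a i0 = 3 * z" "z \<in> p_integral 3" "cong3 z 1"
    using nonunit_coefficient[OF assms(1)] by metis
  have units: "inverse (a i) \<in> p_integral 3" if "i \<noteq> i0" for i
    using nonunit_unique[OF assms(1), of i] that by blast
  have "\<exists>k. cong3 (a i) (of_int k)" for i
    using cong3_int_exists[OF a(2)[of i]] by metis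
  then obtain A where A: "\<And>i. cong3 (a i) (of_int (A i))" by metis
  note facts = z units A
  have "int (2 * card H) = int (CARD('n) * (CARD('n) + 1))"
    unfolding of_nat_mult of_nat_add dimension card_H by (simp add: algebra_simps)
  then have "card H = CARD('n uprod)"
    by (simp only: of_nat_eq_iff card_UNIV_uprod)
  then obtain X :: "'n uprod \<Rightarrow> real ^ 'n" where X: "bij_betw X UNIV H"
    using finite_same_card_bij[of "UNIV :: 'n uprod set" H] finite_H by auto
  \<comment> \<open>At \<open>i0\<close> values are set to 0 rather than removed, which keeps the
    index type \<open>'n\<close>; the zero coefficient then costs only the positive factor
    \<open>gauss3 0 = 3\<close>.\<close>
  define x3 where "x3 u i = (if i = i0 then 0 else of_int (\<xi> (X u) i) :: 3)" for u i
  define \<kappa> where "\<kappa> u = (of_int (\<xi> (X u) i0) :: 3)" for u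
  define al where "al i = (if i = i0 then 0 else of_int (A i) :: 3)" for i
  define e where "e i = (if i = i0 then 0 else of_int (\<Sum>x\<in>H. \<xi> x i * \<xi> x i * \<xi> x i0 * \<xi> x i0) :: 3)" for i
  have sumX: "(\<Sum>u\<in>UNIV. of_int (f (X u))) = (of_int (\<Sum>x\<in>H. f x) :: 3)" for f
    unfolding of_int_sum by (rule sum.reindex_bij_betw[OF X])
  have al0: "al i \<noteq> 0" if "i \<noteq> i0" for i
  proof
    assume "al i = 0"
    then have "3 dvd A i" using that by (simp add: al_def of_int_3_eq_0_iff)
    then have "cong3 (of_int (A i)) (of_int 0)" unfolding cong3_of_int by simp
    then have "cong3 (a i) 0" using cong3_trans[OF A[of i]] by simp
    then have "a i / 3 * inverse (a i) \<in> p_integral 3"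
      using units[OF that] by (intro p_integral_mult) (auto simp: cong3_def)
    then show False using not_p_integral_inverse by (simp add: inverse_eq_divide)
  qed
  have e0: "e i \<noteq> 0" if "al i \<noteq> 0" for i
  proof -
    have "i \<noteq> i0" using that by (auto simp: al_def)
    then show ?thesis
      using coordinates_diagonal_nonzero[OF z(1,2,3) units A, of i]
      by (simp add: e_def of_int_3_eq_0_iff del: of_int_sum)
  qed
  have \<mu>: "(of_int M' :: 3) \<noteq> 0" using M'(2) by (simp add: of_int_3_eq_0_iff)
  have "\<exists>N > 0. 3 ^ CARD('n) * gauss3 (of_int M') ^ CARD('n uprod) = of_nat N * (\<Prod>i\<in>UNIV. gauss3 (- al i))"
  proof (rule gauss_sum_reduction[of "of_int M'" x3 \<kappa> e al, OF \<mu> _ _ _ e0])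
    show "(\<Sum>u\<in>UNIV. x3 u i * x3 u j * x3 u k * x3 u l) = 0" for i j k l
    proof (cases "i = i0 \<or> j = i0 \<or> k = i0 \<or> l = i0")
      case False
      then have "(\<Sum>u\<in>UNIV. x3 u i * x3 u j * x3 u k * x3 u l)
          = (\<Sum>u\<in>UNIV. of_int (\<xi> (X u) i * \<xi> (X u) j * \<xi> (X u) k * \<xi> (X u) l))"
        by (simp add: x3_def)
      also have "\<dots> = of_int (\<Sum>x\<in>H. \<xi> x i * \<xi> x j * \<xi> x k * \<xi> x l)" by (rule sumX)
      finally show ?thesis
        using coordinates_isotropic[OF z(1,2,3) units A] False by (simp add: of_int_3_eq_0_iff del: of_int_sum)
    qed (auto simp: x3_def)
    show "(\<Sum>u\<in>UNIV. x3 u i * x3 u j * x3 u k * \<kappa> u) = 0" for i j k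
    proof (cases "i = i0 \<or> j = i0 \<or> k = i0")
      case False
      then have "(\<Sum>u\<in>UNIV. x3 u i * x3 u j * x3 u k * \<kappa> u)
          = (\<Sum>u\<in>UNIV. of_int (\<xi> (X u) i * \<xi> (X u) j * \<xi> (X u) k * \<xi> (X u) i0))"
        by (simp add: x3_def \<kappa>_def)
      also have "\<dots> = of_int (\<Sum>x\<in>H. \<xi> x i * \<xi> x j * \<xi> x k * \<xi> x i0)" by (rule sumX)
      finally show ?thesis
        using coordinates_orthogonal[OF z(1,2,3) units A] False by (simp del: of_int_sum)
    qed (auto simp: x3_def)
    show "(\<Sum>u\<in>UNIV. x3 u i * x3 u j * \<kappa> u * \<kappa> u) = (if i = j then e i else 0)" for i j
    proof (cases "i = i0 \<or> j = i0")
      case False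
      then have "(\<Sum>u\<in>UNIV. x3 u i * x3 u j * \<kappa> u * \<kappa> u)
          = (\<Sum>u\<in>UNIV. of_int (\<xi> (X u) i * \<xi> (X u) j * \<xi> (X u) i0 * \<xi> (X u) i0))"
        by (simp add: x3_def \<kappa>_def)
      also have "\<dots> = of_int (\<Sum>x\<in>H. \<xi> x i * \<xi> x j * \<xi> x i0 * \<xi> x i0)" by (rule sumX)
      finally show ?thesis
        using coordinates_diagonal[OF z(1,2,3) units A] False by (simp add: e_def del: of_int_sum)
    qed (auto simp: x3_def e_def)
    fix c :: "'n uprod \<Rightarrow> 3"
    assume C: "\<And>i j. (\<Sum>u\<in>UNIV. c u * x3 u i * x3 u j) = 0"
    \<comment> \<open>The function \<open>c\<close> is moved from the index type to the lines and
      lifted to integers, as \<open>coordinates_key\<close> expects.\<close>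
    have "\<forall>h. \<exists>k. of_int k = c (inv_into UNIV X h)" by (intro allI of_int_3_surj)
    then obtain c' where c': "\<And>h. of_int (c' h) = c (inv_into UNIV X h)"
      unfolding choice_iff by blast
    have cX: "c u = of_int (c' (X u))" for u
      using X by (simp add: c' bij_betw_def)
    have divc: "3 dvd (\<Sum>x\<in>H. c' x * \<xi> x i * \<xi> x j)" if "i \<noteq> i0" "j \<noteq> i0" for i j
    proof -
      have "(\<Sum>u\<in>UNIV. c u * x3 u i * x3 u j) = (\<Sum>u\<in>UNIV. of_int (c' (X u) * \<xi> (X u) i * \<xi> (X u) j))"
        using that by (simp add: x3_def cX)
      also have "\<dots> = of_int (\<Sum>x\<in>H. c' x * \<xi> x i * \<xi> x j)" by (rule sumX)
      finally show ?thesis using C[of i j] by (simp add: of_int_3_eq_0_iff del: of_int_sum)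
    qed
    have "3 dvd M' * (\<Sum>x\<in>H. (c' x)\<^sup>2) + (\<Sum>i\<in>UNIV - {i0}. A i * (\<Sum>x\<in>H. c' x * \<xi> x i * \<xi> x i0)\<^sup>2)"
      by (rule coordinates_key[OF z]) (fact units A divc)+
    then have *: "(of_int (M' * (\<Sum>x\<in>H. (c' x)\<^sup>2) + (\<Sum>i\<in>UNIV - {i0}. A i * (\<Sum>x\<in>H. c' x * \<xi> x i * \<xi> x i0)\<^sup>2)) :: 3) = 0"
      by (simp only: of_int_3_eq_0_iff)
    have s1: "(\<Sum>u\<in>UNIV. c u * c u) = of_int (\<Sum>x\<in>H. (c' x)\<^sup>2)"
      unfolding sumX[of "\<lambda>x. (c' x)\<^sup>2", symmetric] by (simp add: cX power2_eq_square)
    have s2: "(\<Sum>u\<in>UNIV. c u * x3 u i * \<kappa> u) = of_int (\<Sum>x\<in>H. c' x * \<xi> x i * \<xi> x i0)" if "i \<noteq> i0" for i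
      unfolding sumX[of "\<lambda>x. c' x * \<xi> x i * \<xi> x i0", symmetric] using that by (simp add: cX x3_def \<kappa>_def)
    have "(\<Sum>i\<in>UNIV. al i * (\<Sum>u\<in>UNIV. c u * x3 u i * \<kappa> u) * (\<Sum>u\<in>UNIV. c u * x3 u i * \<kappa> u))
        = (\<Sum>i\<in>UNIV - {i0}. of_int (A i * (\<Sum>x\<in>H. c' x * \<xi> x i * \<xi> x i0)\<^sup>2))"
    proof -
      have "al i * (\<Sum>u\<in>UNIV. c u * x3 u i * \<kappa> u) * (\<Sum>u\<in>UNIV. c u * x3 u i * \<kappa> u)
          = of_int (A i * (\<Sum>x\<in>H. c' x * \<xi> x i * \<xi> x i0)\<^sup>2)" if "i \<in> UNIV - {i0}" for i
      proof -
        have "i \<noteq> i0" using that by simp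
        then show ?thesis
          unfolding s2[OF \<open>i \<noteq> i0\<close>] by (simp add: al_def power2_eq_square mult.assoc del: of_int_sum)
      qed
      moreover have "al i0 = 0" by (simp add: al_def)
      ultimately show ?thesis by (subst sum.remove[of UNIV i0]) simp_all
    qed
    then show "of_int M' * (\<Sum>u\<in>UNIV. c u * c u)
        = - (\<Sum>i\<in>UNIV. al i * (\<Sum>u\<in>UNIV. c u * x3 u i * \<kappa> u) * (\<Sum>u\<in>UNIV. c u * x3 u i * \<kappa> u))"
      using * unfolding s1 by (simp only: of_int_add of_int_mult[of M'] of_int_sum[of _ "UNIV - {i0}"] eq_neg_iff_add_eq_0)
  qed
  then obtain N where N: "N > 0"
    "3 ^ CARD('n) * gauss3 (of_int M') ^ CARD('n uprod) = of_nat N * (\<Prod>i\<in>UNIV. gauss3 (- al i))" by blast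
  \<comment> \<open>With M = 2 l there are 4 l (4 M - 1) lines, and n = 8 l - 1 = 8 (l - 1) +
    7.\<close>
  obtain l where l: "M = 2 * l" using even_M by blast
  have "4 dvd int (card H)" unfolding card_H t_M_defs l by simp
  then have s4: "4 dvd CARD('n uprod)"
    using \<open>card H = CARD('n uprod)\<close> by presburger
  have "int CARD('n) = 8 * l - 1" using dimension unfolding t_M_defs l by simp
  moreover have "l > 0" using M_pos l by simp
  ultimately have "CARD('n) = 8 * nat (l - 1) + 7" by linarith
  from discriminant_from_gauss_sum[OF \<mu> s4 this _ al0 N]
  have "(\<Prod>i\<in>UNIV - {i0}. al i) = - 1" by (simp add: al_def)
  also have "(\<Prod>i\<in>UNIV - {i0}. al i) = of_int (\<Prod>i\<in>UNIV - {i0}. A i)"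
    by (simp add: al_def)
  finally have "(of_int ((\<Prod>i\<in>UNIV - {i0}. A i) - - 1) :: 3) = 0" by simp
  then have "cong3 (of_int (\<Prod>i\<in>UNIV - {i0}. A i)) (of_int (- 1))"
    unfolding cong3_of_int of_int_3_eq_0_iff .
  moreover have "cong3 (\<Prod>i\<in>UNIV - {i0}. a i) (\<Prod>i\<in>UNIV - {i0}. of_int (A i))"
    using cong3_prod[of "UNIV - {i0}" a "\<lambda>i. of_int (A i)"] A a(2) by simp
  ultimately show ?thesis using cong3_trans by simp
qed

end

section \<open>The square class of the discriminant\<close>

text \<open>A prime dividing \<open>D\<close> exactly once gives \<open>D * u\<close> odd valuation,
  unlike a square. Either \<open>p\<close> divides \<open>q\<close>, or \<open>inverse q\<close> is
  integral; both cases make 1 / p integral.\<close>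

lemma (in prime_int) square_class_coprime:
  assumes D: "\<not> p\<^sup>2 dvd D" and q: "q \<in> \<rat>"
    and u: "u \<in> p_integral p" "inverse u \<in> p_integral p" "u \<noteq> 0" and eq: "of_int D * u = q\<^sup>2"
  shows "\<not> p dvd D"
proof
  assume "p dvd D"
  then obtain E where E: "D = p * E" by blast
  with D have pE: "\<not> p dvd E" by (auto simp: power2_eq_square)
  then have E0: "E \<noteq> 0" by auto
  have Einv: "inverse (of_int E) \<in> p_integral p"
    by (rule p_integralI[OF pE, of _ 1]) (simp add: inverse_eq_divide)
  have p0: "of_int p \<noteq> (0 :: real)" using prime by auto
  show False
  proof (cases "q / of_int p \<in> p_integral p")
    case True
    have "of_int E * u = of_int p * (q / of_int p)\<^sup>2"
      using eq p0 by (simp add: E power2_eq_square field_simps)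
    moreover have "q \<noteq> 0" using eq E0 p0 u(3) by (auto simp: E)
    ultimately have "inverse (of_int p) = (q / of_int p)\<^sup>2 * (inverse (of_int E) * inverse u)"
      using E0 p0 u(3) by (simp add: field_simps)
    also have "\<dots> \<in> p_integral p" using True Einv u by (intro p_integral_mult p_integral_power)
    finally show False using not_p_integral_inverse by blast
  next
    case False
    have qinv: "inverse q \<in> p_integral p"
      using p_integral_or_inverse[OF q] p_integral_unit[OF _ False] by blast
    have "q \<noteq> 0" using False by auto
    then have "inverse (of_int p) = of_int E * u * (inverse q)\<^sup>2"
      using eq p0 by (simp add: E power2_eq_square field_simps)
    also have "\<dots> \<in> p_integral p" using qinv u by (intro p_integral_intros)
    finally show False using not_p_integral_inverse by blast
  qed
qed

text \<open>a / b = (a b) / b^2, and the integer a b is its squarefree part times a square.\<close>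

lemma Rats_squarefree_class:
  assumes "r \<in> \<rat>" "r > 0"
  obtains D :: nat and c where "squarefree D" "c \<in> \<rat>" "c \<noteq> 0" "r = real D * c\<^sup>2"
proof -
  obtain a b where ab: "r = of_int a / of_int b" "b > 0"
    using Rats_cases'[OF assms(1)] by metis
  with assms(2) have "a > 0" by (simp add: zero_less_divide_iff)
  define n where "n = nat (a * b)"
  have n: "real n = of_int a * of_int b" using ab(2) \<open>a > 0\<close> by (simp add: n_def)
  have n2: "real n = real (squarefree_part n) * (real (square_part n))\<^sup>2"
    using squarefree_decompose[of n] by (metis of_nat_mult of_nat_power)
  show thesis
  proof (rule that[of "squarefree_part n" "real (square_part n) / of_int b"])
    have "n \<noteq> 0" using mult_pos_pos[OF \<open>a > 0\<close> ab(2)] by (simp add: n_def)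
    then have "square_part n \<noteq> 0"
      using n2 by auto
    then show "real (square_part n) / of_int b \<noteq> 0" using ab(2) by simp
    have "r = real n / (of_int b)\<^sup>2" using ab n by (simp add: power2_eq_square)
    also have "\<dots> = real (squarefree_part n) * (real (square_part n) / of_int b)\<^sup>2"
      unfolding n2 by (simp add: power_divide)
    finally show "r = real (squarefree_part n) * (real (square_part n) / of_int b)\<^sup>2" .
  qed auto
qed

lemma mod_12_prime_factors:
  fixes n :: nat
  assumes "n > 0" "\<And>p. prime p \<Longrightarrow> p dvd n \<Longrightarrow> p mod 12 = 1"
  shows "n mod 12 = 1"
  using assms
proof (induction n rule: less_induct)
  case (less n)
  show ?case
  proof (cases "n = 1")
    case False
    obtain p where p: "prime p" "p dvd n" using prime_factor_nat[OF False] by blast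
    obtain k where k: "n = p * k" using p(2) by (rule dvdE)
    have k0: "k > 0" using less.prems(1) unfolding k by (rule nat_0_less_mult_iff[THEN iffD1, THEN conjunct2])
    have kn: "k < n" unfolding k using k0 prime_gt_1_nat[OF p(1)] by simp
    have "k mod 12 = 1"
    proof (rule less.IH[OF kn k0])
      fix q assume "prime q" "q dvd k"
      then show "q mod 12 = 1" unfolding k by (intro less.prems(2)) (simp_all add: k)
    qed
    moreover have "p mod 12 = 1" using p by (rule less.prems(2))
    ultimately have "(p mod 12) * (k mod 12) mod 12 = 1" by simp
    then show ?thesis unfolding k mod_mult_eq .
  qed simp
qed

text \<open>Without the factor 3, \<open>D\<close> would be 1 mod 12, contrary to D = 3 mod 4. By
  squarefreeness 3 does not divide \<open>P\<close>, so the same argument makes \<open>P\<close> 1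
  mod 12.\<close>

lemma squarefree_3_mod_4:
  fixes D :: nat
  assumes sf: "squarefree D" and D4: "4 dvd D + 1"
    and primes: "\<And>p. prime p \<Longrightarrow> p dvd D \<Longrightarrow> p \<noteq> 3 \<Longrightarrow> p mod 12 = 1"
  obtains P where "D = 3 * P" "P mod 3 = 1"
proof -
  have D0: "D > 0" using D4 by (cases D) auto
  have "3 dvd D"
  proof (rule ccontr)
    assume n: "\<not> 3 dvd D"
    have "D mod 12 = 1"
    proof (rule mod_12_prime_factors[OF D0])
      fix p assume "prime p" "p dvd D"
      then show "p mod 12 = 1" using n by (intro primes) blast+
    qed
    with D4 show False by presburger
  qed
  then obtain P where P: "D = 3 * P" by (rule dvdE)
  have n: "\<not> 3 dvd P"
  proof
    assume "3 dvd P"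
    then have "3 * 3 dvd D" unfolding P by (intro mult_dvd_mono dvd_refl)
    then have "is_unit (3 :: nat)" using sf unfolding squarefree_def power2_eq_square by blast
    then show False by simp
  qed
  have "P mod 12 = 1"
  proof (rule mod_12_prime_factors)
    show "P > 0" using D0 P by simp
    fix p assume "prime p" "p dvd P"
    then show "p mod 12 = 1" using n by (intro primes) (auto simp only: P dvd_mult)
  qed
  then have "P mod 3 = 1" by presburger
  with P show thesis by (rule that)
qed

context tight_lines_two
begin

text \<open>\<open>D\<close> and \<open>q\<close> turn out to be units at 2, so q^2 = 1 mod 4, while
  the left side is - D mod 4.\<close>

lemma two_adic_class:
  assumes q: "q \<in> \<rat>" and u: "u \<in> p_integral 2" and D: "\<not> 4 dvd D"
    and eq: "of_int D * - (1 + 4 * u) = q\<^sup>2"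
  shows "4 dvd D + 1"
proof -
  let ?v = "- (1 + 4 * u)"
  have v: "?v \<in> p_integral 2" using u p_integral_of_int[of 4] by (intro p_integral_intros) auto
  have vh: "?v / of_int 2 \<notin> p_integral 2"
  proof
    assume "?v / of_int 2 \<in> p_integral 2"
    then have "- (?v / of_int 2 + of_int 2 * u) \<in> p_integral 2" using u by (intro p_integral_intros)
    also have "- (?v / of_int 2 + of_int 2 * u) = 1 / 2" by (simp add: field_simps)
    finally show False using half_not_integral by blast
  qed
  then have "?v \<noteq> 0" by (metis div_0 p_integral_0)
  have "\<not> 2 dvd D"
    using square_class_coprime[OF _ q v p_integral_unit[OF v vh] \<open>?v \<noteq> 0\<close> eq] D by simp
  then have oddD: "odd D" .
  have q_int: "q \<in> p_integral 2"
  proof (rule ccontr)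
    assume n: "q \<notin> p_integral 2"
    then have "inverse q \<in> p_integral 2" using p_integral_or_inverse[OF q] by blast
    moreover from n have "inverse (inverse q) \<notin> p_integral 2" by simp
    ultimately have h: "inverse q / of_int 2 \<in> p_integral 2" using p_integral_unit by blast
    have "q \<noteq> 0" using n by auto
    then have "1 / 2 = (inverse q / of_int 2) * (inverse q / of_int 2) * of_int 2 * q\<^sup>2"
      by (simp add: field_simps power2_eq_square)
    also have "\<dots> = (inverse q / of_int 2) * (inverse q / of_int 2) * of_int 2 * (of_int D * ?v)"
      by (simp only: eq)
    also have "\<dots> \<in> p_integral 2" using h v by (intro p_integral_mult p_integral_of_int)
    finally show False using half_not_integral by blast
  qed
  have "\<not> q / 2 \<in> p_integral 2"
  proof
    assume h: "q / 2 \<in> p_integral 2"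
    have "of_int D / of_int (2 ^ 1) = - (q * (q / 2)) - of_int (2 * D) * u"
      using eq by (simp add: field_simps power2_eq_square)
    also have "\<dots> \<in> p_integral 2" using h q_int u by (intro p_integral_intros)
    finally have "2 ^ 1 dvd D" by (rule dvd_if_p_integral)
    with oddD show False by simp
  qed
  then have y: "(q - 1) / 2 \<in> p_integral 2" using p_integral_parity[OF q_int] by blast
  define y where "y = (q - 1) / 2"
  have "q = 1 + 2 * y" unfolding y_def by (simp add: field_simps)
  then have "of_int (D + 1) / of_int (2 ^ 2) = - (y + y\<^sup>2) - of_int D * u"
    using eq by (simp add: field_simps power2_eq_square)
  also have "\<dots> \<in> p_integral 2" using y u unfolding y_def by (intro p_integral_intros)
  finally have "2 ^ 2 dvd D + 1" by (rule dvd_if_p_integral)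
  then show ?thesis by simp
qed

end

context tight_lines_three
begin

text \<open>If all coefficients are units, so is their product, but 3 P c^2 has odd valuation.
  Otherwise cancelling the 3 of \<open>a i0\<close> leaves P c^2 = - 1 mod 3, whereas P and the
  squares of units are 1.\<close>

lemma three_adic_class:
  assumes even_M: "even M" and P: "P mod 3 = 1" and c: "c \<in> \<rat>" "c \<noteq> 0"
    and eq: "(\<Prod>i\<in>UNIV. a i) = of_int (3 * P) * c\<^sup>2"
  shows False
proof (cases "\<exists>i0. inverse (a i0) \<notin> p_integral 3")
  case False
  then have ainv: "inverse (a i) \<in> p_integral 3" for i by blast
  have prods: "(\<Prod>i\<in>S. a i) \<in> p_integral 3" "inverse (\<Prod>i\<in>S. a i) \<in> p_integral 3" for S
    using a(2) ainv by (induction S rule: infinite_finite_induct) (auto intro: p_integral_mult)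
  have "\<not> 3 dvd 3 * P"
  proof (rule square_class_coprime[of _ "inverse c"])
    have "\<not> 9 dvd 3 * P" using P by presburger
    then show "\<not> 3\<^sup>2 dvd 3 * P" by simp
    have "(of_int (3 * P) * inverse (\<Prod>i\<in>UNIV. a i)) * c\<^sup>2 = (\<Prod>i\<in>UNIV. a i) * inverse (\<Prod>i\<in>UNIV. a i)"
      by (simp only: eq mult_ac)
    also have "\<dots> = 1" by (rule right_inverse) simp
    finally have e: "(of_int (3 * P) * inverse (\<Prod>i\<in>UNIV. a i)) * c\<^sup>2 = 1" .
    have "c\<^sup>2 \<noteq> 0" using c(2) by simp
    from eq_divide_imp[OF this e]
    show "of_int (3 * P) * inverse (\<Prod>i\<in>UNIV. a i) = (inverse c)\<^sup>2"
      by (simp only: power_one_over inverse_eq_divide)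
  qed (use c prods in auto)
  then show False by simp
next
  case True
  then obtain i0 where i0: "inverse (a i0) \<notin> p_integral 3" by blast
  obtain z where z: "a i0 = 3 * z" "z \<in> p_integral 3" "cong3 z 1"
    using nonunit_coefficient[OF i0] by metis
  define E where "E = z * (\<Prod>i\<in>UNIV - {i0}. a i)"
  have E: "E = of_int P * c\<^sup>2"
  proof -
    have "3 * E = of_int (3 * P) * c\<^sup>2"
      unfolding eq[symmetric] E_def by (subst prod.remove[of UNIV i0]) (auto simp: z(1))
    then show ?thesis by simp
  qed
  have "cong3 E (1 * - 1)"
    unfolding E_def using z three_adic_discriminant[OF i0 even_M] p_integral_of_int[of "- 1"]
    by (intro cong3_mult) auto
  then have E1: "cong3 E (- 1)" by simp
  have third: "1 / 3 \<notin> p_integral 3" using not_p_integral_inverse by (simp add: inverse_eq_divide)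
  have P3: "\<not> 3 dvd P" using P by presburger
  have E3: "E / 3 \<notin> p_integral 3"
  proof
    assume "E / 3 \<in> p_integral 3"
    then have "(E - - 1) / 3 - E / 3 \<in> p_integral 3"
      using E1 unfolding cong3_def by (intro p_integral_diff)
    then show False using third by (simp add: diff_divide_distrib[symmetric])
  qed
  have c_int: "c \<in> p_integral 3"
  proof (rule ccontr)
    assume n: "c \<notin> p_integral 3"
    then have "inverse c \<in> p_integral 3" using p_integral_or_inverse[OF c(1)] by blast
    moreover from n have "inverse (inverse c) \<notin> p_integral 3" by simp
    ultimately have h: "inverse c / of_int 3 \<in> p_integral 3" using p_integral_unit by blast
    have "E \<in> p_integral 3"
    proof -
      have "(E - - 1) / 3 * of_int 3 + of_int (- 1) \<in> p_integral 3"
        using E1 unfolding cong3_def by (intro p_integral_intros)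
      also have "(E - - 1) / 3 * of_int 3 + of_int (- 1) = E" by (simp add: field_simps)
      finally show ?thesis .
    qed
    then have "(inverse c / of_int 3)\<^sup>2 * of_int 3 * E \<in> p_integral 3"
      using h by (intro p_integral_mult p_integral_power p_integral_of_int)
    also have "(inverse c / of_int 3)\<^sup>2 * of_int 3 * E = of_int P / of_int (3 ^ 1)"
      using c(2) by (simp add: E field_simps power2_eq_square)
    finally have "3 ^ 1 dvd P" by (rule dvd_if_p_integral)
    with P3 show False by simp
  qed
  obtain k where k: "cong3 c (of_int k)" using cong3_int_exists[OF c_int] .
  have "\<not> 3 dvd k"
  proof
    assume "3 dvd k"
    then have "cong3 (of_int k) (of_int 0)" unfolding cong3_of_int by simp
    then have "cong3 c 0" using cong3_trans[OF k] by simp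
    then have "of_int P * c * (c / 3) \<in> p_integral 3"
      using c_int by (intro p_integral_mult p_integral_of_int) (auto simp: cong3_def)
    then show False using E3 by (simp add: E power2_eq_square mult_ac)
  qed
  then have "3 dvd k - 1 \<or> 3 dvd k + 1" by presburger
  moreover have "k * k - 1 = (k - 1) * (k + 1)" by algebra
  ultimately have kk: "3 dvd k * k - 1" by (metis dvd_mult dvd_mult2)
  have "cong3 (of_int P * (c * c)) (of_int P * (of_int k * of_int k))"
    using k c_int by (intro cong3_mult cong3_refl p_integral_intros)
  then have "cong3 E (of_int (P * (k * k)))" by (simp add: E power2_eq_square)
  moreover have "cong3 E (of_int (- 1))" using E1 by simp
  ultimately have "cong3 (of_int (P * (k * k))) (of_int (- 1))"
    by (metis cong3_sym cong3_trans)
  then have "3 dvd P * (k * k) + 1" unfolding cong3_of_int by simp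
  then have "3 dvd P * (k * k - 1) + (P + 1)" by (simp add: algebra_simps)
  then have "3 dvd P + 1"
    using dvd_add_right_iff[OF dvd_mult[OF kk], of P "P + 1"] by blast
  then show False using P by presburger
qed

end

lemma (in tight_lines_prime) orthogonal_basis_square_class:
  assumes b: "orthogonal_basis b" and b': "orthogonal_basis b'"
  shows "\<exists>q\<in>\<rat>. (\<Prod>i\<in>UNIV. b i \<bullet> b i) * (\<Prod>i\<in>UNIV. b' i \<bullet> b' i) = q\<^sup>2"
proof -
  have r: "b i \<bullet> b' j \<in> \<rat>" for i j
    by (rule inner_Rats) (use b b' in \<open>simp_all add: orthogonal_basis_def\<close>)
  have o: "b i \<bullet> b j = 0" "b' i \<bullet> b' j = 0" if "i \<noteq> j" for i j
    using b b' that unfolding orthogonal_basis_def by auto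
  obtain q where "q \<in> \<rat>" "(\<Prod>i\<in>UNIV. b i \<bullet> b i) * (\<Prod>i\<in>UNIV. b' i \<bullet> b' i) = q\<^sup>2"
    by (rule orthogonal_bases_square_class[OF o r])
  then show ?thesis by (rule bexI[rotated])
qed

context tight_equiangular_lines
begin

text \<open>\<open>D\<close> is the squarefree part of the product of norms of the basis at 3; the
  other primes compare their own bases with that one through \<open>same_class\<close>.\<close>

lemma no_tight_lines:
  assumes even_m: "even m" and m3: "3 dvd m" and M': "m * (m + 1) = 3 * M'" "\<not> 3 dvd M'"
    and M2: "\<not> 64 dvd m * (m + 1)"
    and Mp: "\<And>p :: int. prime p \<Longrightarrow> p \<ge> 5 \<Longrightarrow> p mod 12 \<noteq> 1 \<Longrightarrow> \<not> p\<^sup>2 dvd m * (m + 1)"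
  shows False
proof -
  interpret three: tight_lines_prime H m 3 by unfold_locales simp
  interpret two: tight_lines_two H m
    using even_m M2 by unfold_locales simp_all
  have Ints_fun: "\<exists>k. \<forall>x\<in>H. \<forall>i. of_int (k x i) = f x i"
    if f: "\<And>i x. x \<in> H \<Longrightarrow> f x i \<in> \<int>" for f :: "real ^ 'n \<Rightarrow> 'n \<Rightarrow> real"
    by (rule exI[of _ "\<lambda>x i. \<lfloor>f x i\<rfloor>"]) (use f in simp)
  obtain b3 where b3: "three.orthogonal_basis b3" "\<And>i. b3 i \<bullet> b3 i \<in> p_integral 3"
    "\<And>i x. x \<in> H \<Longrightarrow> (x \<bullet> b3 i) / (b3 i \<bullet> b3 i) \<in> \<int>"
  proof -
    have "(3 :: int) \<noteq> 2" by simp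
    from three.odd_orthogonal_basis[OF this] show thesis using that .
  qed
  obtain \<xi>3 where \<xi>3: "\<forall>x\<in>H. \<forall>i. of_int (\<xi>3 x i) = (x \<bullet> b3 i) / (b3 i \<bullet> b3 i)"
    using Ints_fun[of "\<lambda>x i. (x \<bullet> b3 i) / (b3 i \<bullet> b3 i)"] b3(3) by blast
  interpret three': tight_lines_three H m b3 "\<lambda>i. b3 i \<bullet> b3 i" \<xi>3 M'
    using b3(1,2) \<xi>3 m3 M' by unfold_locales auto
  define \<delta> where "\<delta> = (\<Prod>i\<in>UNIV. b3 i \<bullet> b3 i)"
  have \<delta>0: "\<delta> > 0" using three'.a_pos unfolding \<delta>_def by (intro prod_pos) auto
  have \<delta>R: "\<delta> \<in> \<rat>" unfolding \<delta>_def using b3(2) p_integral_Rats by (intro Rats_prod) blast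
  obtain D :: nat and c where D: "squarefree D" "c \<in> \<rat>" "c \<noteq> 0" "\<delta> = real D * c\<^sup>2"
    by (rule Rats_squarefree_class[OF \<delta>R \<delta>0])
  have same_class: "\<exists>q\<in>\<rat>. \<delta> * (\<Prod>i\<in>UNIV. b i \<bullet> b i) = q\<^sup>2"
    if b: "three.orthogonal_basis b" for b
    unfolding \<delta>_def by (rule three.orthogonal_basis_square_class[OF b3(1) b])
  have primes: "p mod 12 = 1" if p: "prime p" "p dvd D" "p \<noteq> 3" "p \<noteq> 2" for p :: nat
  proof (rule ccontr)
    assume p12: "p mod 12 \<noteq> 1"
    have p5: "p \<ge> 5"
    proof (rule ccontr)
      assume "\<not> p \<ge> 5"
      moreover have "p \<ge> 2" using p(1) by (rule prime_ge_2_nat)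
      ultimately have "p = 4" using p(3,4) by linarith
      moreover have "\<not> prime (4 :: nat)" by simp
      ultimately show False using p(1) by simp
    qed
    define q where "q = int p"
    have pq: "prime q" "q \<noteq> 2" "q \<noteq> 3" "q \<ge> 5" "q mod 12 \<noteq> 1"
    proof -
      have "q mod 12 = int (p mod 12)" by (simp add: q_def zmod_int)
      then show "q mod 12 \<noteq> 1" using p12 by simp
    qed (use p p5 in \<open>simp_all add: q_def\<close>)
    interpret q: tight_lines_prime H m q using pq by unfold_locales
    obtain b where b: "q.orthogonal_basis b" "\<And>i. b i \<bullet> b i \<in> p_integral q"
      "\<And>i x. x \<in> H \<Longrightarrow> (x \<bullet> b i) / (b i \<bullet> b i) \<in> \<int>"
    proof -
      from q.odd_orthogonal_basis[OF pq(2)] show thesis using that .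
    qed
    obtain \<xi> where \<xi>: "\<forall>x\<in>H. \<forall>i. of_int (\<xi> x i) = (x \<bullet> b i) / (b i \<bullet> b i)"
      using Ints_fun[of "\<lambda>x i. (x \<bullet> b i) / (b i \<bullet> b i)"] b(3) by blast
    interpret q': tight_lines_odd H m q b "\<lambda>i. b i \<bullet> b i" \<xi>
      using b(1,2) \<xi> by unfold_locales auto
    have inv: "inverse (b i \<bullet> b i) \<in> p_integral q" for i
      using q'.a_unit pq Mp[OF pq(1)] by (simp add: M_def)
    have prods: "(\<Prod>i\<in>S. b i \<bullet> b i) \<in> p_integral q" "inverse (\<Prod>i\<in>S. b i \<bullet> b i) \<in> p_integral q" for S
      using b(2) inv by (induction S rule: infinite_finite_induct) (auto intro: q.p_integral_mult)
    obtain r where r: "r \<in> \<rat>" "\<delta> * (\<Prod>i\<in>UNIV. b i \<bullet> b i) = r\<^sup>2"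
      using same_class b(1) by blast
    have "\<not> q dvd int D"
    proof (rule q.square_class_coprime[of _ "r / c"])
      have "\<not> p\<^sup>2 dvd D" using D(1) p(1) by (auto simp: squarefree_def)
      then show "\<not> q\<^sup>2 dvd int D" unfolding q_def by (metis of_nat_dvd_iff of_nat_power)
      show "of_int (int D) * (\<Prod>i\<in>UNIV. b i \<bullet> b i) = (r / c)\<^sup>2"
      proof -
        have "c\<^sup>2 * (of_int (int D) * (\<Prod>i\<in>UNIV. b i \<bullet> b i)) = r\<^sup>2"
          unfolding r(2)[symmetric] D(4) by (simp only: of_int_of_nat_eq mult_ac)
        then show ?thesis using D(3) by (simp add: power_divide eq_divide_eq mult.commute)
      qed
      show "(\<Prod>i\<in>UNIV. b i \<bullet> b i) \<noteq> 0" using q'.a_nonzero by simp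
    qed (use r D prods in auto)
    with p(2) show False by (simp add: q_def)
  qed
  obtain b2 s u where b2: "two.orthogonal_basis b2" "s \<in> \<rat>" "s \<noteq> 0" "u \<in> p_integral 2"
    "(\<Prod>i\<in>UNIV. b2 i \<bullet> b2 i) = - (s\<^sup>2 * (1 + 4 * u))"
    by (rule two.two_adic_orthogonal_basis)
  obtain r where r: "r \<in> \<rat>" "\<delta> * (\<Prod>i\<in>UNIV. b2 i \<bullet> b2 i) = r\<^sup>2"
    using same_class b2(1) by blast
  have "4 dvd int D + 1"
  proof (rule two.two_adic_class[of "r / (c * s)" u])
    have "\<not> 2\<^sup>2 dvd D"
    proof
      assume "2\<^sup>2 dvd D"
      then have "is_unit (2 :: nat)" using D(1) unfolding squarefree_def by blast
      then show False by simp
    qed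
    then have "\<not> 4 dvd D" by simp
    then show "\<not> 4 dvd int D" by presburger
    show "of_int (int D) * - (1 + 4 * u) = (r / (c * s))\<^sup>2"
    proof -
      have "(c * s)\<^sup>2 * (of_int (int D) * - (1 + 4 * u)) = r\<^sup>2"
        unfolding r(2)[symmetric] D(4) b2(5) power_mult_distrib of_int_of_nat_eq by algebra
      then show ?thesis using D(3) b2(3) by (simp add: power_divide eq_divide_eq mult.commute)
    qed
  qed (use r D b2 in auto)
  then have D4: "4 dvd D + 1" by presburger
  \<comment> \<open>The prime 2, left open in \<open>primes\<close>, is excluded by parity.\<close>
  then have "\<not> 2 dvd D" by presburger
  then have "p \<noteq> 2" if "p dvd D" for p using that by blast
  with primes have "p mod 12 = 1" if "prime p" "p dvd D" "p \<noteq> 3" for p using that by blast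
  then obtain P where P: "D = 3 * P" "P mod 3 = 1" by (rule squarefree_3_mod_4[OF D(1) D4])
  have "even M" using even_m by (simp add: M_def)
  moreover have "int P mod 3 = 1" using P(2) by presburger
  ultimately show False
  proof (rule three'.three_adic_class[of "int P" c])
    have "\<delta> = of_int (3 * int P) * c\<^sup>2" unfolding D(4) P(1) by simp
    then show "(\<Prod>i\<in>UNIV. b3 i \<bullet> b3 i) = of_int (3 * int P) * c\<^sup>2" unfolding \<delta>_def .
  qed (fact D)+
qed

end

theorem theorem1p2:
  fixes m :: nat
  assumes "m > 0" and "even m"
    and "[m = 0] (mod 3)"
    and "multiplicity 3 (m * (m + 1)) = 1"
    and "multiplicity 2 (m * (m + 1)) \<le> 5"
    and "\<And>p::nat. prime p \<Longrightarrow> p \<ge> 5 \<Longrightarrow> \<not> [p = 1] (mod 12) \<Longrightarrow>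
           multiplicity p (m * (m + 1)) \<le> 1"
    and "CARD('n::finite) = (2 * m + 1)\<^sup>2 - 2"
  shows "\<not> (\<exists>D :: (real ^ 'n) set. tight_spherical_5_design D)"
proof
  assume "\<exists>D :: (real ^ 'n) set. tight_spherical_5_design D"
  then obtain D :: "(real ^ 'n) set" where D: "tight_spherical_5_design D" by blast
  define t :: real where "t = 2 * real m + 1"
  define M where "M = int m * (int m + 1)"
  \<comment> \<open>Ensures that the subtraction of naturals in n = (2 m + 1)^2 - 2 is not
    truncated.\<close>
  have "(2 * m + 1)\<^sup>2 \<ge> 2" using assms(1) by (simp add: power2_eq_square)
  then have "int CARD('n) = int ((2 * m + 1)\<^sup>2) - 2"
    unfolding assms(7) by (simp only: of_nat_diff of_nat_numeral)
  then have n: "int CARD('n) = 4 * M - 1"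
    by (simp add: M_def power2_eq_square algebra_simps)
  have t2: "t\<^sup>2 = 4 * of_int M + 1"
    by (simp add: t_def M_def power2_eq_square algebra_simps)
  have "real CARD('n) = 4 * of_int M - 1"
    using arg_cong[OF n, of real_of_int] by simp
  then have nt: "real CARD('n) + 2 = t\<^sup>2" using t2 by simp
  have t0: "t > 0" by (simp add: t_def)
  obtain H :: "(real ^ 'n) set" where H:
    "finite H" "2 * card H = CARD('n) * (CARD('n) + 1)"
    "\<And>x. x \<in> H \<Longrightarrow> x \<bullet> x = t"
    "\<And>x y. x \<in> H \<Longrightarrow> y \<in> H \<Longrightarrow> x \<noteq> y \<Longrightarrow> x \<bullet> y = 1 \<or> x \<bullet> y = - 1"
    "\<And>v. (\<Sum>x\<in>H. (x \<bullet> v)\<^sup>2) = (t\<^sup>2 - 1) * t / 2 * (v \<bullet> v)"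
    "\<And>v. (\<Sum>x\<in>H. (x \<bullet> v) ^ 4) = 3 * (t\<^sup>2 - 1) / 2 * (v \<bullet> v)\<^sup>2"
  proof -
    from tight_design_equiangular_lines[OF D t0 nt] show thesis using that .
  qed
  have "2 * int (card H) = int CARD('n) * (int CARD('n) + 1)"
    using arg_cong[OF H(2), of int] by (simp add: algebra_simps)
  then have cH: "int (card H) = 2 * M * (4 * M - 1)" unfolding n by simp
  interpret tight_equiangular_lines H "int m"
  proof
    show "finite H" by fact
    show "int m > 0" using assms(1) by simp
    show "int CARD('n) = 4 * (int m * (int m + 1)) - 1" using n by (simp only: M_def)
    show "int (card H) = 2 * (int m * (int m + 1)) * (4 * (int m * (int m + 1)) - 1)"
      using cH by (simp only: M_def)
    show "x \<bullet> x = of_int (2 * int m + 1)" if "x \<in> H" for x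
      using H(3)[OF that] by (simp add: t_def)
    show "(\<Sum>x\<in>H. (x \<bullet> v)\<^sup>2) = of_int (2 * (int m * (int m + 1)) * (2 * int m + 1)) * (v \<bullet> v)" for v
      unfolding H(5) t2 by (simp add: M_def t_def)
    show "(\<Sum>x\<in>H. (x \<bullet> v) ^ 4) = of_int (6 * (int m * (int m + 1))) * (v \<bullet> v)\<^sup>2" for v
      unfolding H(6) t2 by (simp add: M_def)
  qed (fact H(4))
  have M0: "m * (m + 1) \<noteq> 0" using assms(1) by simp
  have dvd: "p ^ k dvd m * (m + 1) \<longleftrightarrow> k \<le> multiplicity p (m * (m + 1))" if "p > 1" for p k
    by (rule power_dvd_iff_le_multiplicity) (use M0 that in auto)
  have int_M: "int (m * (m + 1)) = int m * (int m + 1)" by (simp add: algebra_simps)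
  have m3: "3 dvd m" using assms(3) by (simp add: cong_0_iff)
  then have "3 dvd m * (m + 1)" by (rule dvd_mult2)
  then obtain M' where M': "m * (m + 1) = 3 * M'" by (rule dvdE)
  have "\<not> 3 dvd M'"
  proof
    assume "3 dvd M'"
    then have "3 ^ 2 dvd m * (m + 1)" unfolding M' power2_eq_square by (intro mult_dvd_mono dvd_refl)
    then show False using dvd[of 3 2] assms(4) by simp
  qed
  show False
  proof (rule no_tight_lines)
    show "even (int m)" using assms(2) by simp
    show "3 dvd int m" using m3 by presburger
    show "int m * (int m + 1) = 3 * int M'" by (simp only: int_M[symmetric] M' of_nat_mult of_nat_numeral)
    show "\<not> 3 dvd int M'" using \<open>\<not> 3 dvd M'\<close> by presburger
    have "\<not> 2 ^ 6 dvd m * (m + 1)" using dvd[of 2 6] assms(5) by simp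
    then have "\<not> int (2 ^ 6) dvd int (m * (m + 1))" by (simp only: of_nat_dvd_iff not_False_eq_True)
    then show "\<not> 64 dvd int m * (int m + 1)" unfolding int_M by simp
    fix p :: int assume p: "prime p" "p \<ge> 5" "p mod 12 \<noteq> 1"
    define r where "r = nat p"
    have pr: "p = int r" using p(2) by (simp add: r_def)
    have "prime r" "r \<ge> 5" using p(1,2) by (simp_all add: pr)
    moreover have "\<not> [r = 1] (mod 12)"
    proof
      assume "[r = 1] (mod 12)"
      then have "r mod 12 = 1" by (simp add: Cong.cong_def)
      then have "p mod 12 = int 1" unfolding pr by presburger
      with p(3) show False by simp
    qed
    ultimately have "multiplicity r (m * (m + 1)) \<le> 1" by (rule assms(6))
    then have "\<not> r ^ 2 dvd m * (m + 1)" using dvd[of r 2] \<open>r \<ge> 5\<close> by simp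
    then have "\<not> int (r ^ 2) dvd int (m * (m + 1))" by (simp only: of_nat_dvd_iff not_False_eq_True)
    then show "\<not> p\<^sup>2 dvd int m * (int m + 1)" unfolding int_M pr by simp
  qed
qed

end
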